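(* Let $\Gamma$ be a splice diagram with $n$ leaves satisfying the edge determinant and semigroup conditions, let $\mathcal{S}(\Gamma)$ be a splice type system associated to $\Gamma$, and let $(X,0)\hookrightarrow(\mathbb{C}^n,0)$ be the germ it defines. Then the local tropicalization of $(X,0)$ (i.e. of the ideal of $\mathcal{O}$ generated by $\mathcal{S}(\Gamma)$) equals the splice fan $\mathbb{R}_{\ge0}\,\rho(\Gamma)$.
   Context: A splice diagram is a finite tree $\Gamma$ with at least one vertex of valency $\geq3$ and no vertex of valency $2$; vertices of valency $1$ are leaves, others nodes; $\delta_v$ is the valency of $v$. For each node $v$ and edge $e$ at $v$ a positive integer weight $d_{v,e}$ is given; $d_v=\prod_{e\ni v}d_{v,e}$; $d_{v,u}$ is the weight at $v$ of the edge toward $u$. For distinct vertices $u,v$, $\ell_{u,v}$ is the product of all $d_{w,e}$ with $w$ a node on the geodesic $[u,v]$ and $e$ an edge at $w$ not in $[u,v]$; $\ell_{v,v}=d_v$. Edge determinant condition: $d_{u,v}d_{v,u}>\ell_{u,v}$ for every edge between nodes. Semigroup condition: for each node $v$ and edge $e$ at $v$, $d_v\in\sum_{\lambda\in L(v,e)}\mathbb{N}\ell_{v,\lambda}$, $L(v,e)$ the set of leaves $\lambda$ with $e\subseteq[v,\lambda]$. Variables $z_\lambda$ and standard basis vectors $w_\lambda$ of $\mathbb{R}^n$ are indexed by leaves; $w_u=\sum_\lambda\ell_{u,\lambda}w_\lambda$ for nodes $u$. Fix $\alpha_{v,e,\lambda}\in\mathbb{N}$ with $d_v=\sum_{\lambda\in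 L(v,e)}\alpha_{v,e,\lambda}\ell_{v,\lambda}$ and set $z^{m_{v,e}}=\prod_\lambda z_\lambda^{\alpha_{v,e,\lambda}}$, $m_{v,e}=\sum\alpha_{v,e,\lambda}w_\lambda$. A splice type system is a family $F_{v,i}=f_{v,i}+g_{v,i}\in\mathcal{O}:=\mathbb{C}\{z_\lambda\}$ ($v$ node, $1\le i\le\delta_v-2$), $f_{v,i}=\sum_{e\ni v}c_{v,e,i}z^{m_{v,e}}$ with all maximal minors of $(c_{v,e,i})_{e,i}$ nonzero, and $g_{v,i}$ convergent with every exponent $m$ satisfying $w_v\cdot m>d_v$ and $w_u\cdot m>\ell_{u,v}$ for all nodes $u\ne v$. For $w\in\mathbb{R}^n_{\ge0}$, $\mathrm{in}_w(f)$ is the sum of the terms of $f$ of minimal $w$-weight, and $\mathrm{in}_w(I)$ is the ideal of $\mathcal{O}$ generated by $\mathrm{in}_w(f)$, $f\in I$. The local tropicalization of an ideal $I$ is $\{w\in\mathbb{R}^n_{\ge0}:\mathrm{in}_w(I)\text{ contains no monomial}\}$. The map $\rho:\Gamma\to\mathbb{R}^n$ sends each vertex $u$ to $w_u/|w_u|$ ($1$-norm) and is affine on each edge; the splice fan is the cone $\mathbb{R}_{\ge0}\rho(\Gamma)$, with two-dimensional cones $\mathbb{R}_{\ge0}\rho([u,v])$ for edges $[u,v]$. *)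

theory Defs
  imports "HOL-Analysis.Infinite_Sum" "Jordan_Normal_Form.Determinant"
begin

definition gpath :: "('v \<Rightarrow> 'v \<Rightarrow> bool) \<Rightarrow> 'v \<Rightarrow> 'v \<Rightarrow> 'v list \<Rightarrow> bool" where
  "gpath adj u v p \<longleftrightarrow> p \<noteq> [] \<and> hd p = u \<and> last p = v \<and> distinct p \<and>
     (\<forall>i. Suc i < length p \<longrightarrow> adj (p ! i) (p ! Suc i))"

definition is_tree :: "'v set \<Rightarrow> ('v \<Rightarrow> 'v \<Rightarrow> bool) \<Rightarrow> bool" where
  "is_tree V adj \<longleftrightarrow> finite V \<and> V \<noteq> {} \<and>
     (\<forall>x y. adj x y \<longrightarrow> x \<in> V \<and> y \<in> V \<and> x \<noteq> y \<and> adj y x) \<and>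
     (\<forall>u\<in>V. \<forall>v\<in>V. \<exists>!p. gpath adj u v p)"

definition geod :: "('v \<Rightarrow> 'v \<Rightarrow> bool) \<Rightarrow> 'v \<Rightarrow> 'v \<Rightarrow> 'v set" where
  "geod adj u v = set (THE p. gpath adj u v p)"

definition nbrs :: "('v \<Rightarrow> 'v \<Rightarrow> bool) \<Rightarrow> 'v \<Rightarrow> 'v set" where
  "nbrs adj v = {u. adj v u}"

definition valency :: "('v \<Rightarrow> 'v \<Rightarrow> bool) \<Rightarrow> 'v \<Rightarrow> nat" where
  "valency adj v = card (nbrs adj v)"

definition leaves :: "'v set \<Rightarrow> ('v \<Rightarrow> 'v \<Rightarrow> bool) \<Rightarrow> 'v set" where
  "leaves V adj = {v\<in>V. valency adj v = 1}"

definition nodes :: "'v set \<Rightarrow> ('v \<Rightarrow> 'v \<Rightarrow> bool) \<Rightarrow> 'v set" where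
  "nodes V adj = V - leaves V adj"

text \<open>Edge weights: for a node v and a neighbour u, d v u is the weight d_{v,e}
of the edge e = [v,u] at v.\<close>

definition splice_diagram :: "'v set \<Rightarrow> ('v \<Rightarrow> 'v \<Rightarrow> bool) \<Rightarrow> ('v \<Rightarrow> 'v \<Rightarrow> nat) \<Rightarrow> bool" where
  "splice_diagram V adj d \<longleftrightarrow> is_tree V adj \<and>
     (\<exists>v\<in>V. valency adj v \<ge> 3) \<and> (\<forall>v\<in>V. valency adj v \<noteq> 2) \<and>
     (\<forall>v\<in>nodes V adj. \<forall>u\<in>nbrs adj v. d v u > 0)"

definition dv :: "('v \<Rightarrow> 'v \<Rightarrow> bool) \<Rightarrow> ('v \<Rightarrow> 'v \<Rightarrow> nat) \<Rightarrow> 'v \<Rightarrow> nat" where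
  "dv adj d v = (\<Prod>u\<in>nbrs adj v. d v u)"

text \<open>ell_{u,v}: product of d_{w,e} over nodes w of [u,v] and edges e at w not in [u,v]
(an edge [w,x] with w on the geodesic lies in it iff x does); ell_{v,v} = d_v.\<close>
definition ell :: "'v set \<Rightarrow> ('v \<Rightarrow> 'v \<Rightarrow> bool) \<Rightarrow> ('v \<Rightarrow> 'v \<Rightarrow> nat) \<Rightarrow> 'v \<Rightarrow> 'v \<Rightarrow> nat" where
  "ell V adj d u v = (if u = v then dv adj d v else
     (\<Prod>w\<in>nodes V adj \<inter> geod adj u v. \<Prod>x\<in>nbrs adj w - geod adj u v. d w x))"

definition leaves_beyond :: "'v set \<Rightarrow> ('v \<Rightarrow> 'v \<Rightarrow> bool) \<Rightarrow> 'v \<Rightarrow> 'v \<Rightarrow> 'v set" where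
  "leaves_beyond V adj v u = {l\<in>leaves V adj. v \<in> geod adj v l \<and> u \<in> geod adj v l}"

definition edge_determinant :: "'v set \<Rightarrow> ('v \<Rightarrow> 'v \<Rightarrow> bool) \<Rightarrow> ('v \<Rightarrow> 'v \<Rightarrow> nat) \<Rightarrow> bool" where
  "edge_determinant V adj d \<longleftrightarrow>
     (\<forall>u\<in>nodes V adj. \<forall>v\<in>nodes V adj. adj u v \<longrightarrow> d u v * d v u > ell V adj d u v)"

definition semigroup_cond :: "'v set \<Rightarrow> ('v \<Rightarrow> 'v \<Rightarrow> bool) \<Rightarrow> ('v \<Rightarrow> 'v \<Rightarrow> nat) \<Rightarrow> bool" where
  "semigroup_cond V adj d \<longleftrightarrow>
     (\<forall>v\<in>nodes V adj. \<forall>u\<in>nbrs adj v. \<exists>a :: 'v \<Rightarrow> nat.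
        dv adj d v = (\<Sum>l\<in>leaves_beyond V adj v u. a l * ell V adj d v l))"

text \<open>Weight vectors w_u in R^n, with R^n realised as functions on the leaf set
(vanishing off the leaves).\<close>
definition wvec :: "'v set \<Rightarrow> ('v \<Rightarrow> 'v \<Rightarrow> bool) \<Rightarrow> ('v \<Rightarrow> 'v \<Rightarrow> nat) \<Rightarrow> 'v \<Rightarrow> 'v \<Rightarrow> real" where
  "wvec V adj d u = (if u \<in> leaves V adj then (\<lambda>x. if x = u then 1 else 0)
     else (\<lambda>x. if x \<in> leaves V adj then real (ell V adj d u x) else 0))"

definition norm1 :: "'v set \<Rightarrow> ('v \<Rightarrow> real) \<Rightarrow> real" where
  "norm1 L w = (\<Sum>x\<in>L. \<bar>w x\<bar>)"

definition rho :: "'v set \<Rightarrow> ('v \<Rightarrow> 'v \<Rightarrow> bool) \<Rightarrow> ('v \<Rightarrow> 'v \<Rightarrow> nat) \<Rightarrow> 'v \<Rightarrow> 'v \<Rightarrow> real" where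
  "rho V adj d u = (\<lambda>x. wvec V adj d u x / norm1 (leaves V adj) (wvec V adj d u))"

definition splice_fan :: "'v set \<Rightarrow> ('v \<Rightarrow> 'v \<Rightarrow> bool) \<Rightarrow> ('v \<Rightarrow> 'v \<Rightarrow> nat) \<Rightarrow> ('v \<Rightarrow> real) set" where
  "splice_fan V adj d = {(\<lambda>x. t * ((1 - s) * rho V adj d u x + s * rho V adj d v x)) | t s u v.
      t \<ge> 0 \<and> 0 \<le> s \<and> s \<le> 1 \<and> adj u v}"

type_synonym 'v series = "('v \<Rightarrow> nat) \<Rightarrow> complex"

definition exps :: "'v set \<Rightarrow> ('v \<Rightarrow> nat) set" where
  "exps L = {m. \<forall>x. x \<notin> L \<longrightarrow> m x = 0}"

definition conv_series :: "'v set \<Rightarrow> 'v series \<Rightarrow> bool" where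
  "conv_series L f \<longleftrightarrow> (\<forall>m. f m \<noteq> 0 \<longrightarrow> m \<in> exps L) \<and>
     (\<exists>r::real. r > 0 \<and> (\<lambda>m. norm (f m) * r ^ (\<Sum>x\<in>L. m x)) summable_on exps L)"

definition smul :: "'v series \<Rightarrow> 'v series \<Rightarrow> 'v series" where
  "smul f g = (\<lambda>m. \<Sum>a\<in>{a. a \<le> m}. f a * g (m - a))"

definition ideal_span :: "'v set \<Rightarrow> 'v series set \<Rightarrow> 'v series set" where
  "ideal_span L G = {f. \<exists>S h. finite S \<and> S \<subseteq> G \<and> (\<forall>g\<in>S. conv_series L (h g)) \<and>
      f = (\<lambda>m. \<Sum>g\<in>S. smul (h g) g m)}"

definition monomial_term :: "('v \<Rightarrow> nat) \<Rightarrow> 'v series" where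
  "monomial_term a = (\<lambda>m. if m = a then 1 else 0)"

definition is_monomial :: "'v series \<Rightarrow> bool" where
  "is_monomial f \<longleftrightarrow> (\<exists>a c. c \<noteq> 0 \<and> f = (\<lambda>m. c * monomial_term a m))"

definition wt :: "'v set \<Rightarrow> ('v \<Rightarrow> real) \<Rightarrow> ('v \<Rightarrow> nat) \<Rightarrow> real" where
  "wt L w m = (\<Sum>x\<in>L. w x * real (m x))"

definition init_form :: "'v set \<Rightarrow> ('v \<Rightarrow> real) \<Rightarrow> 'v series \<Rightarrow> 'v series" where
  "init_form L w f = (\<lambda>m. if f m \<noteq> 0 \<and> wt L w m = (INF k\<in>{k. f k \<noteq> 0}. wt L w k)
      then f m else 0)"

definition init_ideal :: "'v set \<Rightarrow> ('v \<Rightarrow> real) \<Rightarrow> 'v series set \<Rightarrow> 'v series set" where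
  "init_ideal L w I = ideal_span L (init_form L w ` I)"

definition local_trop :: "'v set \<Rightarrow> 'v series set \<Rightarrow> ('v \<Rightarrow> real) set" where
  "local_trop L I = {w. (\<forall>x\<in>L. w x \<ge> 0) \<and> (\<forall>x. x \<notin> L \<longrightarrow> w x = 0) \<and>
      \<not> (\<exists>f\<in>init_ideal L w I. is_monomial f)}"

text \<open>alpha v u l = alpha_{v,e,l} for e = [v,u]; m_{v,e} = sum alpha w_l over l in L(v,e).\<close>
definition mexp :: "'v set \<Rightarrow> ('v \<Rightarrow> 'v \<Rightarrow> bool) \<Rightarrow> ('v \<Rightarrow> 'v \<Rightarrow> 'v \<Rightarrow> nat) \<Rightarrow> 'v \<Rightarrow> 'v \<Rightarrow> 'v \<Rightarrow> nat" where
  "mexp V adj alpha v u = (\<lambda>l. if l \<in> leaves_beyond V adj v u then alpha v u l else 0)"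

definition admissible_alpha :: "'v set \<Rightarrow> ('v \<Rightarrow> 'v \<Rightarrow> bool) \<Rightarrow> ('v \<Rightarrow> 'v \<Rightarrow> nat) \<Rightarrow>
    ('v \<Rightarrow> 'v \<Rightarrow> 'v \<Rightarrow> nat) \<Rightarrow> bool" where
  "admissible_alpha V adj d alpha \<longleftrightarrow> (\<forall>v\<in>nodes V adj. \<forall>u\<in>nbrs adj v.
      dv adj d v = (\<Sum>l\<in>leaves_beyond V adj v u. alpha v u l * ell V adj d v l))"

text \<open>Coefficient matrix (c_{v,e,i}): rows e (edges at v, indexed by neighbour u),
columns i (0-based, i < delta_v - 2). All maximal minors nonzero: for every set S of
delta_v - 2 edges at v (in any ordering), the corresponding square minor is nonzero.\<close>
definition minors_nonzero :: "('v \<Rightarrow> 'v \<Rightarrow> bool) \<Rightarrow> ('v \<Rightarrow> 'v \<Rightarrow> nat \<Rightarrow> complex) \<Rightarrow> 'v \<Rightarrow> bool" where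
  "minors_nonzero adj c v \<longleftrightarrow> (let k = valency adj v - 2 in
     \<forall>S \<sigma>. S \<subseteq> nbrs adj v \<longrightarrow> card S = k \<longrightarrow> bij_betw \<sigma> {..<k} S \<longrightarrow>
        det (mat k k (\<lambda>(a, b). c v (\<sigma> a) b)) \<noteq> 0)"

definition f_part :: "'v set \<Rightarrow> ('v \<Rightarrow> 'v \<Rightarrow> bool) \<Rightarrow> ('v \<Rightarrow> 'v \<Rightarrow> 'v \<Rightarrow> nat) \<Rightarrow>
    ('v \<Rightarrow> 'v \<Rightarrow> nat \<Rightarrow> complex) \<Rightarrow> 'v \<Rightarrow> nat \<Rightarrow> 'v series" where
  "f_part V adj alpha c v i = (\<lambda>m. \<Sum>u\<in>nbrs adj v. c v u i * monomial_term (mexp V adj alpha v u) m)"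

definition g_admissible :: "'v set \<Rightarrow> ('v \<Rightarrow> 'v \<Rightarrow> bool) \<Rightarrow> ('v \<Rightarrow> 'v \<Rightarrow> nat) \<Rightarrow> 'v \<Rightarrow> 'v series \<Rightarrow> bool" where
  "g_admissible V adj d v g \<longleftrightarrow> conv_series (leaves V adj) g \<and>
     (\<forall>m. g m \<noteq> 0 \<longrightarrow>
        (\<Sum>l\<in>leaves V adj. real (ell V adj d v l) * real (m l)) > real (dv adj d v) \<and>
        (\<forall>u\<in>nodes V adj. u \<noteq> v \<longrightarrow>
           (\<Sum>l\<in>leaves V adj. real (ell V adj d u l) * real (m l)) > real (ell V adj d u v)))"

definition splice_type_system :: "'v set \<Rightarrow> ('v \<Rightarrow> 'v \<Rightarrow> bool) \<Rightarrow> ('v \<Rightarrow> 'v \<Rightarrow> nat) \<Rightarrow>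
   ('v \<Rightarrow> 'v \<Rightarrow> 'v \<Rightarrow> nat) \<Rightarrow> ('v \<Rightarrow> 'v \<Rightarrow> nat \<Rightarrow> complex) \<Rightarrow> ('v \<Rightarrow> nat \<Rightarrow> 'v series) \<Rightarrow> bool" where
  "splice_type_system V adj d alpha c g \<longleftrightarrow> admissible_alpha V adj d alpha \<and>
     (\<forall>v\<in>nodes V adj. minors_nonzero adj c v \<and>
        (\<forall>i < valency adj v - 2. g_admissible V adj d v (g v i)))"

definition splice_F :: "'v set \<Rightarrow> ('v \<Rightarrow> 'v \<Rightarrow> bool) \<Rightarrow> ('v \<Rightarrow> 'v \<Rightarrow> 'v \<Rightarrow> nat) \<Rightarrow>
   ('v \<Rightarrow> 'v \<Rightarrow> nat \<Rightarrow> complex) \<Rightarrow> ('v \<Rightarrow> nat \<Rightarrow> 'v series) \<Rightarrow> 'v \<Rightarrow> nat \<Rightarrow> 'v series" where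
  "splice_F V adj alpha c g v i = (\<lambda>m. f_part V adj alpha c v i m + g v i m)"

definition splice_ideal :: "'v set \<Rightarrow> ('v \<Rightarrow> 'v \<Rightarrow> bool) \<Rightarrow> ('v \<Rightarrow> 'v \<Rightarrow> 'v \<Rightarrow> nat) \<Rightarrow>
   ('v \<Rightarrow> 'v \<Rightarrow> nat \<Rightarrow> complex) \<Rightarrow> ('v \<Rightarrow> nat \<Rightarrow> 'v series) \<Rightarrow> 'v series set" where
  "splice_ideal V adj alpha c g = ideal_span (leaves V adj)
     {splice_F V adj alpha c g v i | v i. v \<in> nodes V adj \<and> i < valency adj v - 2}"

end

theory Submission
  imports Defs "HOL-Analysis.Analysis"
begin

text \<open>
A weight w lies in the local tropicalization iff no element of the ideal has a monomial as its w-initial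
form.

Fan inside tropicalization. If an element of the ideal has a monomial initial form at a point of the cone of an
edge [u,v], then also at a nearby point of the interior with positive integral coordinates. There, at every
node, exactly the term of the edge towards [u,v] drops out of the initial forms. The remaining system is
solved in the torus, with surjective logarithmic differential, by induction on the subtrees hanging off
[u,v]. Lifting the solution modulo increasing powers of t gives arcs with these orders of vanishing,
along which a monomial initial form cannot cancel.

Tropicalization inside fan. If all coordinates of w are positive, subtract a point p of the fan with p below w and p
maximal. By maximality w - p vanishes at some leaf on every side of p. At each node a linear combination
of the equations involves just three of the admissible monomials; as its initial form must not be a
monomial, zeros of w - p spread through the subtrees and w = p. If some coordinate of w vanishes but two do
not, the equations together with these two variables generate an ideal containing powers of all variables:
this holds for the initial forms with respect to the weight vector of a node by the same spreading argument, and
passes to the ideal by Nakayama's lemma. Restricting to the variables of weight zero then gives an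
element whose initial form is a power of a variable.
\<close>

section \<open>The ring of convergent power series\<close>

text \<open>The first sentence of the overview has content: an element of the initial ideal is only
  a combination of initial forms, and it is lifted to a single initial form by cutting each
  multiplier down to one weight. Arcs need positive integral orders, while \<open>w\<close> is real:
  the weights above that of a given exponent stay a fixed gap away from it, so a large multiple of
  \<open>w\<close>, with its two cone coefficients rounded up, still singles out the same monomial.
  The arc equations are needed only up to an order fixed by that monomial, so no limit of the
  lifting and no convergence of an arc enters. Both inclusions rest on one comparison:
  \<open>w_u\<close> is proportional to \<open>w_s\<close> on the sides of \<open>s\<close> not
  containing \<open>u\<close> and strictly larger than that multiple on the side of
  \<open>u\<close>. This is where the edge determinant condition is used. A vanishing coordinate of
  \<open>w\<close> needs its own argument, because then only multiples of leaf vectors lie below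
  \<open>w\<close>, and for these the higher order terms \<open>g\<close> need not be
  heavier.\<close>

lemma finite_le_fun:
  fixes m :: "'v \<Rightarrow> nat"
  assumes "finite {x. m x \<noteq> 0}"
  shows "finite {a. a \<le> m}"
proof -
  define S where "S = {x. m x \<noteq> 0}"
  have S: "finite S" using assms by (simp add: S_def)
  have fin: "finite {f. \<forall>x. (x \<in> S \<longrightarrow> f x \<in> {..Max (m ` S)}) \<and> (x \<notin> S \<longrightarrow> f x = 0)}"
    by (rule finite_set_of_finite_funs[OF S]) simp
  have 1: "a x \<le> Max (m ` S)" if "a \<le> m" "x \<in> S" for a x
  proof -
    have "m x \<le> Max (m ` S)" using S that(2) by (intro Max_ge) auto
    then show ?thesis using le_funD[OF that(1), of x] by linarith
  qed
  have 2: "a x = 0" if "a \<le> m" "x \<notin> S" for a x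
  proof -
    have "m x = 0" using that(2) unfolding S_def by simp
    then show ?thesis using le_funD[OF that(1), of x] by simp
  qed
  show ?thesis
    by (rule finite_subset[OF _ fin], rule subsetI, unfold mem_Collect_eq atMost_iff) (blast intro: 1 2)
qed

lemma exps_finite_support: "finite L \<Longrightarrow> m \<in> exps L \<Longrightarrow> finite {x. m x \<noteq> 0}"
  by (rule finite_subset[of _ L]) (auto simp: exps_def)

lemma exps_le:
  assumes "m \<in> exps L" "a \<le> m"
  shows "a \<in> exps L"
proof -
  have "a x = 0" if "x \<notin> L" for x
    using assms(1) that le_funD[OF assms(2), of x] by (simp add: exps_def)
  then show ?thesis by (simp add: exps_def)
qed

lemma exps_diff: "m \<in> exps L \<Longrightarrow> m - a \<in> exps L"
  by (auto simp: exps_def)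

lemma exps_add: "m \<in> exps L \<Longrightarrow> a \<in> exps L \<Longrightarrow> (\<lambda>x. m x + a x) \<in> exps L"
  by (auto simp: exps_def)

lemma exps_mono: "L \<subseteq> L' \<Longrightarrow> exps L \<subseteq> exps L'"
  by (auto simp: exps_def)

section \<open>Weighted l1 bounds for power series and their Cauchy products\<close>

definition nbound :: "'v set \<Rightarrow> real \<Rightarrow> real \<Rightarrow> 'v series \<Rightarrow> bool" where
  "nbound L r C f \<longleftrightarrow> (\<forall>F. finite F \<longrightarrow> F \<subseteq> exps L \<longrightarrow> (\<Sum>m\<in>F. norm (f m) * r ^ sum m L) \<le> C)"

lemma nboundD: "nbound L r C f \<Longrightarrow> finite F \<Longrightarrow> F \<subseteq> exps L \<Longrightarrow> (\<Sum>m\<in>F. norm (f m) * r ^ sum m L) \<le> C"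
  by (simp add: nbound_def)

lemma nbound_nonneg: "nbound L r C f \<Longrightarrow> C \<ge> 0"
  using nboundD[of L r C f "{}"] by simp

lemma nbound_dominated:
  assumes "nbound L r C f" "0 < s" "s \<le> r" "\<And>m. norm (g m) \<le> norm (f m)"
  shows "nbound L s C g"
  unfolding nbound_def
proof (intro allI impI)
  fix F assume F: "finite F" "F \<subseteq> exps L"
  have "(\<Sum>m\<in>F. norm (g m) * s ^ sum m L) \<le> (\<Sum>m\<in>F. norm (f m) * r ^ sum m L)"
    using assms by (intro sum_mono mult_mono power_mono) auto
  then show "(\<Sum>m\<in>F. norm (g m) * s ^ sum m L) \<le> C" using nboundD[OF assms(1) F] by linarith
qed

text \<open>For nonnegative terms summability is boundedness of the finite partial sums. The
  explicit constant is what later estimates multiply and rescale.\<close>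

lemma conv_series_iff:
  "conv_series L f \<longleftrightarrow> (\<forall>m. f m \<noteq> 0 \<longrightarrow> m \<in> exps L) \<and> (\<exists>r C. r > 0 \<and> nbound L r C f)"
proof -
  have "((\<lambda>m. norm (f m) * r ^ sum m L) summable_on exps L) \<longleftrightarrow> (\<exists>C. nbound L r C f)" if "r > 0" for r :: real
  proof
    assume s: "(\<lambda>m. norm (f m) * r ^ sum m L) summable_on exps L"
    show "\<exists>C. nbound L r C f" unfolding nbound_def
      by (rule exI, intro allI impI, rule finite_sum_le_infsum[OF s]) (use that in auto)
  next
    assume "\<exists>C. nbound L r C f"
    then show "(\<lambda>m. norm (f m) * r ^ sum m L) summable_on exps L"
      by (intro nonneg_bdd_above_summable_on) (use that in \<open>auto simp: nbound_def bdd_above_def\<close>)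
  qed
  then show ?thesis unfolding conv_series_def by blast
qed

lemma conv_seriesI: "(\<And>m. f m \<noteq> 0 \<Longrightarrow> m \<in> exps L) \<Longrightarrow> r > 0 \<Longrightarrow> nbound L r C f \<Longrightarrow> conv_series L f"
  unfolding conv_series_iff by blast

lemma conv_series_exps: "conv_series L f \<Longrightarrow> f m \<noteq> 0 \<Longrightarrow> m \<in> exps L"
  by (simp add: conv_series_def)

lemma conv_seriesE:
  assumes "conv_series L f"
  obtains r C where "r > 0" "nbound L r C f"
  using assms unfolding conv_series_iff by blast

lemma conv_seriesE2:
  assumes "conv_series L f" "conv_series L g"
  obtains r C D where "r > 0" "nbound L r C f" "nbound L r D g"
proof -
  obtain r C where r: "r > 0" "nbound L r C f" by (rule conv_seriesE[OF assms(1)])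
  obtain s D where s: "s > 0" "nbound L s D g" by (rule conv_seriesE[OF assms(2)])
  show thesis
  proof (rule that)
    show "min r s > 0" using r s by simp
    show "nbound L (min r s) C f" using r s by (intro nbound_dominated[OF r(2)]) auto
    show "nbound L (min r s) D g" using r s by (intro nbound_dominated[OF s(2)]) auto
  qed
qed

lemma conv_series_dominated:
  assumes f: "conv_series L f" and g: "\<And>m. g m \<noteq> 0 \<Longrightarrow> m \<in> exps L"
    and le: "\<And>m. norm (g m) \<le> norm (f m)"
  shows "conv_series L g"
proof -
  obtain r C where r: "r > 0" "nbound L r C f" by (rule conv_seriesE[OF f])
  show ?thesis by (rule conv_seriesI[OF g r(1) nbound_dominated[OF r(2,1) order_refl le]])
qed

lemma conv_series_mono:
  assumes "L \<subseteq> L'" "finite L'" "conv_series L f"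
  shows "conv_series L' f"
proof -
  obtain r C where r: "r > 0" and C: "nbound L r C f" by (rule conv_seriesE[OF assms(3)])
  show ?thesis
  proof (rule conv_seriesI[OF _ r])
    fix m assume "f m \<noteq> 0" then show "m \<in> exps L'"
      using conv_series_exps[OF assms(3)] exps_mono[OF assms(1)] by blast
  next
    show "nbound L' r C f" unfolding nbound_def
    proof (intro allI impI)
      fix F assume F: "finite F" "F \<subseteq> exps L'"
      have "(\<Sum>m\<in>F. norm (f m) * r ^ sum m L') = (\<Sum>m\<in>F \<inter> exps L. norm (f m) * r ^ sum m L)"
      proof (rule sum.mono_neutral_cong_right)
        show "\<forall>i\<in>F - F \<inter> exps L. cmod (f i) * r ^ sum i L' = 0"
          using conv_series_exps[OF assms(3)] by auto
      next
        fix m assume "m \<in> F \<inter> exps L"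
        then have "sum m L' = sum m L"
          using assms by (intro sum.mono_neutral_right) (auto simp: exps_def)
        then show "cmod (f m) * r ^ sum m L' = cmod (f m) * r ^ sum m L" by simp
      qed (use F in auto)
      also have "\<dots> \<le> C" using F by (intro nboundD[OF C]) auto
      finally show "(\<Sum>m\<in>F. norm (f m) * r ^ sum m L') \<le> C" .
    qed
  qed
qed

lemma nbound_add:
  assumes r: "r > 0" and "nbound L r C f" "nbound L r D g"
  shows "nbound L r (C + D) (\<lambda>m. f m + g m)"
  unfolding nbound_def
proof (intro allI impI)
  fix F assume F: "finite F" "F \<subseteq> exps L"
  have "(\<Sum>m\<in>F. norm (f m + g m) * r ^ sum m L) \<le> (\<Sum>m\<in>F. norm (f m) * r ^ sum m L + norm (g m) * r ^ sum m L)"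
    using r by (intro sum_mono) (auto simp: norm_triangle_ineq mult_right_mono simp flip: distrib_right)
  also have "\<dots> \<le> C + D" unfolding sum.distrib
    using nboundD[OF assms(2) F] nboundD[OF assms(3) F] by linarith
  finally show "(\<Sum>m\<in>F. norm (f m + g m) * r ^ sum m L) \<le> C + D" .
qed

lemma conv_series_add:
  assumes f: "conv_series L f" and g: "conv_series L g"
  shows "conv_series L (\<lambda>m. f m + g m)"
proof -
  obtain r C D where r: "r > 0" "nbound L r C f" "nbound L r D g" by (rule conv_seriesE2[OF f g])
  show ?thesis
  proof (rule conv_seriesI[OF _ r(1) nbound_add[OF r]])
    fix m assume "f m + g m \<noteq> 0"
    then have "f m \<noteq> 0 \<or> g m \<noteq> 0" by auto
    then show "m \<in> exps L" using conv_series_exps[OF f] conv_series_exps[OF g] by blast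
  qed
qed

text \<open>The bound in this form also controls powers, which is what inverting a series needs.\<close>
lemma nbound_smul:
  assumes L: "finite L" and r: "r > 0" and f: "nbound L r A f" and g: "nbound L r B g"
  shows "nbound L r (A * B) (smul f g)"
  unfolding nbound_def
proof (intro allI impI)
  fix F assume F: "finite F" "F \<subseteq> exps L"
  \<comment> \<open>The downward closure of \<open>F\<close> contains both factors \<open>a\<close>
    and \<open>m - a\<close> of every member, so the double sum of the Cauchy product embeds into
    the square \<open>D \<times> D\<close>.\<close>
  define D where "D = (\<Union>m\<in>F. {a. a \<le> m})"
  have D: "finite D" "D \<subseteq> exps L"
    unfolding D_def using F finite_le_fun exps_finite_support[OF L] exps_le by blast+
  have "(\<Sum>m\<in>F. norm (smul f g m) * r ^ sum m L) \<le>
      (\<Sum>m\<in>F. \<Sum>a\<in>{a. a \<le> m}. (norm (f a) * r ^ sum a L) * (norm (g (m - a)) * r ^ sum (m - a) L))"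
  proof (rule sum_mono)
    fix m assume m: "m \<in> F"
    have "norm (smul f g m) * r ^ sum m L \<le> (\<Sum>a\<in>{a. a \<le> m}. norm (f a * g (m - a))) * r ^ sum m L"
      unfolding smul_def using r by (intro mult_right_mono sum_norm_le) auto
    also have "\<dots> = (\<Sum>a\<in>{a. a \<le> m}. (norm (f a) * r ^ sum a L) * (norm (g (m - a)) * r ^ sum (m - a) L))"
      unfolding sum_distrib_right
    proof (rule sum.cong[OF refl])
      fix a assume "a \<in> {a. a \<le> m}"
      then have "sum m L = sum a L + sum (m - a) L"
        unfolding sum.distrib[symmetric] by (intro sum.cong) (auto simp: le_fun_def)
      then show "norm (f a * g (m - a)) * r ^ sum m L = norm (f a) * r ^ sum a L * (norm (g (m - a)) * r ^ sum (m - a) L)"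
        by (simp add: norm_mult power_add)
    qed
    finally show "norm (smul f g m) * r ^ sum m L \<le> \<dots>" .
  qed
  also have "\<dots> = (\<Sum>(m,a)\<in>(SIGMA m:F. {a. a \<le> m}). (norm (f a) * r ^ sum a L) * (norm (g (m - a)) * r ^ sum (m - a) L))"
    using F finite_le_fun exps_finite_support[OF L] by (subst sum.Sigma) auto
  also have "\<dots> = (\<Sum>(a,b)\<in>(\<lambda>(m,a). (a, m - a)) ` (SIGMA m:F. {a. a \<le> m}). (norm (f a) * r ^ sum a L) * (norm (g b) * r ^ sum b L))"
  proof (subst sum.reindex)
    show "inj_on (\<lambda>(m, a). (a, m - a)) (SIGMA m:F. {a. a \<le> m})"
    proof (rule inj_onI, clarsimp)
      fix m m' a :: "'a \<Rightarrow> nat" assume h: "a \<le> m" "a \<le> m'" "m - a = m' - a"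
      show "m = m'"
      proof
        fix x show "m x = m' x" using le_funD[OF h(1), of x] le_funD[OF h(2), of x] fun_cong[OF h(3), of x] by simp
      qed
    qed
  qed (auto simp: case_prod_unfold)
  also have "\<dots> \<le> (\<Sum>(a,b)\<in>D \<times> D. (norm (f a) * r ^ sum a L) * (norm (g b) * r ^ sum b L))"
  proof (rule sum_mono2)
    show "finite (D \<times> D)" using D by auto
    have "m - a \<le> m" for m a :: "'a \<Rightarrow> nat" by (auto simp: le_fun_def)
    then show "(\<lambda>(m,a). (a, m - a)) ` (SIGMA m:F. {a. a \<le> m}) \<subseteq> D \<times> D"
      unfolding D_def by auto
  qed (use r in auto)
  also have "\<dots> = (\<Sum>a\<in>D. norm (f a) * r ^ sum a L) * (\<Sum>b\<in>D. norm (g b) * r ^ sum b L)"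
    by (simp add: sum.cartesian_product sum_product)
  also have "\<dots> \<le> A * B"
    using nboundD[OF f D] nboundD[OF g D] nbound_nonneg[OF f] r by (intro mult_mono) (auto intro!: sum_nonneg)
  finally show "(\<Sum>m\<in>F. norm (smul f g m) * r ^ sum m L) \<le> A * B" .
qed

lemma smul_nonzeroE:
  assumes "smul f g m \<noteq> 0"
  obtains a where "a \<le> m" "f a \<noteq> 0" "g (m - a) \<noteq> 0"
proof -
  have "\<exists>a\<in>{a. a \<le> m}. f a * g (m - a) \<noteq> 0"
    using assms unfolding smul_def by (meson sum.neutral)
  then show thesis using that by auto
qed

lemma conv_series_smul:
  assumes L: "finite L" and f: "conv_series L f" and g: "conv_series L g"
  shows "conv_series L (smul f g)"
proof -
  obtain r C D where r: "r > 0" "nbound L r C f" "nbound L r D g" by (rule conv_seriesE2[OF f g])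
  show ?thesis
  proof (rule conv_seriesI[OF _ r(1) nbound_smul[OF L r]])
    fix m assume "smul f g m \<noteq> 0"
    then obtain a where a: "a \<le> m" "f a \<noteq> 0" "g (m - a) \<noteq> 0" by (rule smul_nonzeroE)
    have "(\<lambda>x. a x + (m - a) x) \<in> exps L"
      by (rule exps_add[OF conv_series_exps[OF f a(2)] conv_series_exps[OF g a(3)]])
    also have "(\<lambda>x. a x + (m - a) x) = m" using a(1) by (auto simp: le_fun_def)
    finally show "m \<in> exps L" .
  qed
qed

lemma conv_series_monomial:
  assumes "a \<in> exps L"
  shows "conv_series L (monomial_term a)"
proof (rule conv_seriesI[of _ _ 1 1])
  show "nbound L 1 1 (monomial_term a)" unfolding nbound_def
  proof (intro allI impI)
    fix F :: "('a \<Rightarrow> nat) set" assume "finite F"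
    then have "(\<Sum>m\<in>F. norm (monomial_term a m) * 1 ^ sum m L) = (\<Sum>m\<in>F. if m = a then 1 else 0)"
      by (intro sum.cong) (auto simp: monomial_term_def)
    also have "\<dots> \<le> 1" using \<open>finite F\<close> by simp
    finally show "(\<Sum>m\<in>F. norm (monomial_term a m) * 1 ^ sum m L) \<le> 1" .
  qed
qed (use assms in \<open>auto simp: monomial_term_def split: if_splits\<close>)

lemma conv_series_zero: "conv_series L (\<lambda>m. 0)"
  by (rule conv_seriesI[of _ _ 1 0]) (auto simp: nbound_def)

lemma conv_series_uminus: "conv_series L f \<Longrightarrow> conv_series L (\<lambda>m. - f m)"
  by (rule conv_series_dominated) (auto intro: conv_series_exps)

section \<open>Ring laws of the Cauchy product\<close>

lemma diff_diff_fun: "a \<le> m \<Longrightarrow> m - (m - a) = a" for a m :: "'v \<Rightarrow> nat"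
  by (auto simp: le_fun_def)

lemma diff_le_fun: "m - a \<le> m" for a m :: "'v \<Rightarrow> nat"
  by (auto simp: le_fun_def)

lemma smul_commute: "smul f g = smul g f"
proof
  fix m :: "'a \<Rightarrow> nat"
  show "smul f g m = smul g f m"
    unfolding smul_def
    by (rule sum.reindex_bij_witness[where i = "\<lambda>a. m - a" and j = "\<lambda>a. m - a"])
       (auto simp: diff_diff_fun diff_le_fun mult.commute)
qed

lemma smul_add_right: "smul f (\<lambda>m. g m + h m) = (\<lambda>m. smul f g m + smul f h m)"
  by (auto simp: smul_def fun_eq_iff algebra_simps sum.distrib)

lemma smul_assoc: "smul (smul f g) h = smul f (smul g h)"
proof
  fix m :: "'a \<Rightarrow> nat"
  show "smul (smul f g) h m = smul f (smul g h) m"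
  proof (cases "finite {a. a \<le> m}")
    case False
    then show ?thesis by (simp add: smul_def)
  next
    case True
    have fin: "finite {b. b \<le> a}" if "a \<le> m" for a
      by (rule finite_subset[OF _ True]) (use that order_trans in blast)
    have A: "(\<lambda>x. b x + (a x - b x)) = a" "b \<le> m" "a - b \<le> m - b" "m - b - (a - b) = m - a"
      if "a \<le> m" "b \<le> a" for a b :: "'a \<Rightarrow> nat"
    proof -
      have *: "a x \<le> m x \<and> b x \<le> a x" for x using le_funD[OF that(1)] le_funD[OF that(2)] by blast
      show "(\<lambda>x. b x + (a x - b x)) = a" using * by simp
      show "b \<le> m" using that by (rule order_trans[rotated])
      show "a - b \<le> m - b" using * by (simp add: le_fun_def diff_le_mono)
      show "m - b - (a - b) = m - a" using * by (simp add: fun_eq_iff)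
    qed
    have B: "(\<lambda>x. b x + c x) \<le> m" "b \<le> (\<lambda>x. b x + c x)" "(\<lambda>x. b x + c x) - b = c"
      if "b \<le> m" "c \<le> m - b" for b c :: "'a \<Rightarrow> nat"
    proof -
      have "b x + c x \<le> m x" for x using le_funD[OF that(1), of x] le_funD[OF that(2), of x] by simp
      then show "(\<lambda>x. b x + c x) \<le> m" by (simp add: le_fun_def)
      show "b \<le> (\<lambda>x. b x + c x)" by (simp add: le_fun_def)
      show "(\<lambda>x. b x + c x) - b = c" by (simp add: fun_eq_iff)
    qed
    have "smul (smul f g) h m = (\<Sum>a\<in>{a. a \<le> m}. \<Sum>b\<in>{b. b \<le> a}. f b * g (a - b) * h (m - a))"
      unfolding smul_def by (simp add: sum_distrib_right)
    also have "\<dots> = (\<Sum>(a,b)\<in>(SIGMA a:{a. a \<le> m}. {b. b \<le> a}). f b * g (a - b) * h (m - a))"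
      using True fin by (intro sum.Sigma) auto
    also have "\<dots> = (\<Sum>(b,c)\<in>(SIGMA b:{b. b \<le> m}. {c. c \<le> m - b}). f b * g c * h (m - b - c))"
      by (rule sum.reindex_bij_witness[where i = "\<lambda>(b,c). (\<lambda>x. b x + c x, b)" and j = "\<lambda>(a,b). (b, a - b)"])
         (clarsimp simp: A B)+
    also have "\<dots> = (\<Sum>b\<in>{b. b \<le> m}. \<Sum>c\<in>{c. c \<le> m - b}. f b * g c * h (m - b - c))"
      using True fin[OF diff_le_fun] by (intro sum.Sigma[symmetric]) auto
    also have "\<dots> = smul f (smul g h) m"
      unfolding smul_def by (simp add: sum_distrib_left mult.assoc)
    finally show ?thesis .
  qed
qed

text \<open>An exponent of infinite support has infinitely many divisors, and a sum over an infinite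
  set is 0; hence the restriction to series supported on finite exponents.\<close>

lemma smul_one:
  assumes "\<And>m. f m \<noteq> 0 \<Longrightarrow> finite {x. m x \<noteq> 0}"
  shows "smul (monomial_term (\<lambda>_. 0)) f = f"
proof
  fix m
  show "smul (monomial_term (\<lambda>_. 0)) f m = f m"
  proof (cases "finite {a. a \<le> m}")
    case True
    have "smul (monomial_term (\<lambda>_. 0)) f m = (\<Sum>a\<in>{a. a \<le> m}. if a = (\<lambda>_. 0) then f (m - a) else 0)"
      unfolding smul_def by (rule sum.cong) (auto simp: monomial_term_def)
    also have "\<dots> = f (m - (\<lambda>_. 0))" using True by (simp add: sum.delta' le_fun_def)
    also have "m - (\<lambda>_. 0) = m" by auto
    finally show ?thesis .
  next
    case False
    then have "f m = 0" using assms finite_le_fun by blast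
    then show ?thesis using False by (simp add: smul_def)
  qed
qed

text \<open>The finite set of variables varies with the series. This makes a commutative ring for
  any type of variables, with no parameter \<open>L\<close>; that a series involves only the
  variables in \<open>L\<close> is imposed separately by \<open>conv_series L\<close>.\<close>

typedef 'v cs = "{f :: 'v series. \<exists>L. finite L \<and> conv_series L f}" morphisms cnth Abs_cs
  using conv_series_zero[of "{}"] by blast

lemma conv_series_pair:
  assumes "\<exists>L. finite L \<and> conv_series L f" "\<exists>L. finite L \<and> conv_series L g"
  obtains L where "finite L" "conv_series L f" "conv_series L g"
proof -
  obtain L L' where "finite L" "conv_series L f" "finite L'" "conv_series L' g"
    using assms by auto
  then show thesis
    using that[of "L \<union> L'"] conv_series_mono[of L "L \<union> L'" f] conv_series_mono[of L' "L \<union> L'" g] by simp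
qed

lemma cnth_conv: "\<exists>L. finite L \<and> conv_series L (cnth f)"
  using cnth[of f] by simp

lemma cnth_Abs_cs: "finite L \<Longrightarrow> conv_series L f \<Longrightarrow> cnth (Abs_cs f) = f"
  by (rule Abs_cs_inverse) auto

lemma cs_eqI: "cnth f = cnth g \<Longrightarrow> f = g"
  by (simp add: cnth_inject)

lemma cnth_finite_support: "cnth f m \<noteq> 0 \<Longrightarrow> finite {x. m x \<noteq> 0}"
  using cnth_conv[of f] conv_series_exps exps_finite_support by metis

instantiation cs :: (type) comm_ring_1
begin
definition zero_cs :: "'a cs" where "0 = Abs_cs (\<lambda>m. 0)"
definition one_cs :: "'a cs" where "1 = Abs_cs (monomial_term (\<lambda>_. 0))"
definition plus_cs :: "'a cs \<Rightarrow> 'a cs \<Rightarrow> 'a cs" where "f + g = Abs_cs (\<lambda>m. cnth f m + cnth g m)"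
definition uminus_cs :: "'a cs \<Rightarrow> 'a cs" where "- f = Abs_cs (\<lambda>m. - cnth f m)"
definition minus_cs :: "'a cs \<Rightarrow> 'a cs \<Rightarrow> 'a cs" where "f - g = f + - (g :: 'a cs)"
definition times_cs :: "'a cs \<Rightarrow> 'a cs \<Rightarrow> 'a cs" where "f * g = Abs_cs (smul (cnth f) (cnth g))"

lemma cnth_zero: "cnth (0 :: 'a cs) = (\<lambda>m. 0)"
  unfolding zero_cs_def by (rule cnth_Abs_cs[OF finite.emptyI conv_series_zero[of "{}"]])
lemma cnth_one: "cnth (1 :: 'a cs) = monomial_term (\<lambda>_. 0)"
  unfolding one_cs_def
  by (rule cnth_Abs_cs[OF finite.emptyI conv_series_monomial[of _ "{}"]]) (simp add: exps_def)
lemma cnth_add: "cnth (f + g :: 'a cs) = (\<lambda>m. cnth f m + cnth g m)"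
proof -
  obtain L where L: "finite L" "conv_series L (cnth f)" "conv_series L (cnth g)"
    using conv_series_pair[OF cnth_conv cnth_conv] .
  show ?thesis unfolding plus_cs_def by (rule cnth_Abs_cs[OF L(1) conv_series_add[OF L(2,3)]])
qed
lemma cnth_uminus: "cnth (- f :: 'a cs) = (\<lambda>m. - cnth f m)"
proof -
  obtain L where L: "finite L" "conv_series L (cnth f)" using cnth_conv[of f] by blast
  show ?thesis unfolding uminus_cs_def by (rule cnth_Abs_cs[OF L(1) conv_series_uminus[OF L(2)]])
qed
lemma cnth_mult: "cnth (f * g :: 'a cs) = smul (cnth f) (cnth g)"
proof -
  obtain L where L: "finite L" "conv_series L (cnth f)" "conv_series L (cnth g)"
    using conv_series_pair[OF cnth_conv cnth_conv] .
  show ?thesis unfolding times_cs_def by (rule cnth_Abs_cs[OF L(1) conv_series_smul[OF L]])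
qed

instance
proof
  fix a b c :: "'a cs"
  show "a * b * c = a * (b * c)" by (rule cs_eqI) (simp add: cnth_mult smul_assoc)
  show "a * b = b * a" by (rule cs_eqI) (simp add: cnth_mult smul_commute)
  show "1 * a = a"
    by (rule cs_eqI) (simp add: cnth_mult cnth_one smul_one[OF cnth_finite_support])
  have "a * (b + c) = a * b + a * c" for a b c :: "'a cs"
    by (rule cs_eqI) (simp add: cnth_mult cnth_add smul_add_right)
  moreover have "a * b = b * a" for a b :: "'a cs"
    by (rule cs_eqI) (simp add: cnth_mult smul_commute)
  ultimately show "(a + b) * c = a * c + b * c" by metis
  have "cnth (0 :: 'a cs) (\<lambda>_. 0) \<noteq> cnth (1 :: 'a cs) (\<lambda>_. 0)"
    unfolding cnth_zero cnth_one by (simp add: monomial_term_def)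
  then show "(0 :: 'a cs) \<noteq> 1" by metis
  show "a + b + c = a + (b + c)" by (rule cs_eqI) (simp add: cnth_add add.assoc)
  show "a + b = b + a" by (rule cs_eqI) (simp add: cnth_add add.commute)
  show "0 + a = a" by (rule cs_eqI) (simp add: cnth_add cnth_zero)
  show "- a + a = 0" by (rule cs_eqI) (simp add: cnth_add cnth_uminus cnth_zero)
  show "a - b = a + - b" by (rule minus_cs_def)
qed
end

lemma cnth_diff: "cnth (f - g) m = cnth f m - cnth g m"
  unfolding minus_cs_def cnth_add cnth_uminus by simp

lemma cnth_sum: "cnth (sum f A) m = (\<Sum>x\<in>A. cnth (f x) m)"
  by (induction A rule: infinite_finite_induct) (simp_all add: cnth_zero cnth_add)

lemma cnth_exps: "conv_series L (cnth f) \<Longrightarrow> m \<notin> exps L \<Longrightarrow> cnth f m = 0"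
  using conv_series_exps by blast

lemma cnth_mult_eq: "cnth (f * g) m = (\<Sum>a\<in>{a. a \<le> m}. cnth f a * cnth g (m - a))"
  by (simp add: cnth_mult smul_def)

definition cconst :: "complex \<Rightarrow> 'v cs" where
  "cconst c = Abs_cs (\<lambda>m. c * monomial_term (\<lambda>_. 0) m)"

definition zmon :: "('v \<Rightarrow> nat) \<Rightarrow> 'v cs" where
  "zmon a = Abs_cs (monomial_term a)"

lemma conv_series_cmult:
  assumes "conv_series L f"
  shows "conv_series L (\<lambda>m. c * f m)"
proof -
  obtain r C where r: "r > 0" "nbound L r C f" by (rule conv_seriesE[OF assms])
  show ?thesis
  proof (rule conv_seriesI[OF _ r(1)])
    show "m \<in> exps L" if "c * f m \<noteq> 0" for m using that conv_series_exps[OF assms] by auto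
    show "nbound L r (norm c * C) (\<lambda>m. c * f m)"
      unfolding nbound_def norm_mult mult.assoc sum_distrib_left[symmetric]
      by (intro allI impI mult_left_mono nboundD[OF r(2)]) auto
  qed
qed

lemma cnth_cconst: "cnth (cconst c) m = (if m = (\<lambda>_. 0) then c else 0)"
proof -
  have "conv_series {} (\<lambda>m. c * monomial_term (\<lambda>_. 0 :: nat) m)"
    by (rule conv_series_cmult, rule conv_series_monomial) (simp add: exps_def)
  then show ?thesis
    unfolding cconst_def by (subst cnth_Abs_cs[of "{}"]) (auto simp: monomial_term_def)
qed

lemma cnth_cconst_mult: "cnth (cconst c * f) m = c * cnth f m"
proof -
  have "cnth (cconst c * f) = (\<lambda>m. c * smul (monomial_term (\<lambda>_. 0)) (cnth f) m)"
    unfolding cnth_mult smul_def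
    by (auto simp: fun_eq_iff cnth_cconst monomial_term_def sum_distrib_left intro!: sum.cong)
  then show ?thesis by (simp add: smul_one[OF cnth_finite_support])
qed

lemma cconst_mult_inverse: "c \<noteq> 0 \<Longrightarrow> cconst c * cconst (1 / c) = 1"
  by (rule cs_eqI) (auto simp: fun_eq_iff cnth_cconst_mult cnth_cconst cnth_one monomial_term_def)

lemma finite_support_exps: "finite {x. a x \<noteq> 0} \<Longrightarrow> a \<in> exps {x. a x \<noteq> (0::nat)}"
  by (auto simp: exps_def)

lemma cnth_zmon:
  assumes "finite {x. a x \<noteq> 0}"
  shows "cnth (zmon a) = monomial_term a"
  unfolding zmon_def
  by (rule cnth_Abs_cs[OF assms conv_series_monomial[OF finite_support_exps[OF assms]]])

lemma cnth_zmon_mult: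
  assumes "finite {x. a x \<noteq> 0}"
  shows "cnth (zmon a * f) m = (if a \<le> m then cnth f (m - a) else 0)"
proof (cases "finite {b. b \<le> m}")
  case True
  have "cnth (zmon a * f) m = (\<Sum>b\<in>{b. b \<le> m}. if b = a then cnth f (m - a) else 0)"
    unfolding cnth_mult_eq cnth_zmon[OF assms] by (rule sum.cong) (auto simp: monomial_term_def)
  then show ?thesis using True by (simp add: sum.delta')
next
  case False
  have "cnth f (m - a) = 0"
  proof (rule ccontr)
    assume "cnth f (m - a) \<noteq> 0"
    then have "finite ({x. (m - a) x \<noteq> 0} \<union> {x. a x \<noteq> 0})" using assms cnth_finite_support by blast
    then have "finite {x. m x \<noteq> 0}" by (rule finite_subset[rotated]) auto
    then show False using False finite_le_fun by blast
  qed
  then show ?thesis using False by (simp add: cnth_mult_eq)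
qed

lemma zmon_add:
  assumes "finite {x. a x \<noteq> 0}" "finite {x. b x \<noteq> 0}"
  shows "zmon a * zmon b = zmon (\<lambda>x. a x + b x)"
proof (rule cs_eqI, rule ext)
  fix m
  have "finite ({x. a x \<noteq> 0} \<union> {x. b x \<noteq> 0})" using assms by blast
  then have ab: "finite {x. a x + b x \<noteq> 0}" by (rule finite_subset[rotated]) auto
  have "a \<le> m \<and> m - a = b \<longleftrightarrow> m = (\<lambda>x. a x + b x)"
  proof
    assume h: "a \<le> m \<and> m - a = b"
    then have "a x \<le> m x" "b = m - a" for x by (auto simp: le_fun_def)
    then show "m = (\<lambda>x. a x + b x)" by (auto simp: fun_eq_iff)
  qed (auto simp: le_fun_def)
  then show "cnth (zmon a * zmon b) m = cnth (zmon (\<lambda>x. a x + b x)) m"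
    unfolding cnth_zmon_mult[OF assms(1)] cnth_zmon[OF assms(2)] cnth_zmon[OF ab] monomial_term_def by auto
qed

subsection \<open>Units\<close>

lemma sum_diff_le: "a \<le> m \<Longrightarrow> sum m L = sum a L + sum (m - a) L" for a m :: "'v \<Rightarrow> nat"
  unfolding sum.distrib[symmetric] by (intro sum.cong) (auto simp: le_fun_def)

lemma nbound_one: "s > 0 \<Longrightarrow> nbound L s 1 (monomial_term (\<lambda>_. 0))"
  unfolding nbound_def
proof (intro allI impI)
  fix F :: "('a \<Rightarrow> nat) set" assume "finite F"
  have "(\<Sum>m\<in>F. norm (monomial_term (\<lambda>_. 0) m) * s ^ sum m L) = (\<Sum>m\<in>F. if m = (\<lambda>_. 0) then 1 else 0)"
    by (intro sum.cong) (auto simp: monomial_term_def)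
  also have "\<dots> \<le> 1" using \<open>finite F\<close> by simp
  finally show "(\<Sum>m\<in>F. norm (monomial_term (\<lambda>_. 0) m) * s ^ sum m L) \<le> 1" .
qed

lemma conv_series_one: "conv_series L (cnth 1)"
  unfolding cnth_one by (rule conv_series_monomial) (simp add: exps_def)

lemma conv_series_mult: "finite L \<Longrightarrow> conv_series L (cnth f) \<Longrightarrow> conv_series L (cnth g) \<Longrightarrow> conv_series L (cnth (f * g))"
  unfolding cnth_mult by (rule conv_series_smul)

lemma conv_series_power: "finite L \<Longrightarrow> conv_series L (cnth f) \<Longrightarrow> conv_series L (cnth (f ^ k))"
  by (induction k) (auto intro: conv_series_one conv_series_mult)

lemma conv_series_plus: "conv_series L (cnth f) \<Longrightarrow> conv_series L (cnth g) \<Longrightarrow> conv_series L (cnth (f + g))"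
  unfolding cnth_add by (rule conv_series_add)

lemma conv_series_sum: "(\<And>x. x \<in> A \<Longrightarrow> conv_series L (cnth (f x))) \<Longrightarrow> conv_series L (cnth (sum f A))"
  by (induction A rule: infinite_finite_induct) (auto simp: cnth_zero conv_series_zero intro: conv_series_plus)

text \<open>Without constant term, \<open>\<phi>\<close> gets norm at most 1/2 on a small enough
  polydisc, so its powers sum to a convergent series. Only powers up to the degree of a monomial
  contribute to its coefficient, so no limit is taken coefficientwise.\<close>

lemma geometric_series:
  fixes \<phi> :: "'v cs"
  assumes "cnth \<phi> (\<lambda>_. 0) = 0"
  shows "\<exists>g. (1 - \<phi>) * g = 1"
proof -
  obtain L where L: "finite L" "conv_series L (cnth \<phi>)" using cnth_conv[of \<phi>] by blast
  obtain r C where r: "r > 0" "nbound L r C (cnth \<phi>)" by (rule conv_seriesE[OF L(2)])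
  have C: "C \<ge> 0" by (rule nbound_nonneg[OF r(2)])
  \<comment> \<open>On terms of degree at least 1, passing from \<open>r\<close> to \<open>s\<close>
    gains the factor \<open>s / r = 1 / (2 * (C + 1))\<close>, which turns the bound
    \<open>C\<close> into 1/2.\<close>
  define s where "s = r / (2 * (C + 1))"
  have s: "s > 0" "s \<le> r" using r C by (auto simp: s_def field_simps)
  have deg: "sum m L > 0" if "m \<in> exps L" "m \<noteq> (\<lambda>_. 0)" for m :: "'v \<Rightarrow> nat"
  proof (rule ccontr)
    assume "\<not> sum m L > 0"
    then have "\<forall>x\<in>L. m x = 0" using L(1) by simp
    then have "m x = 0" for x using that(1) by (cases "x \<in> L") (auto simp: exps_def)
    then show False using that(2) by auto
  qed
  have half: "nbound L s (1/2) (cnth \<phi>)"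
    unfolding nbound_def
  proof (intro allI impI)
    fix F assume F: "finite F" "F \<subseteq> exps L"
    have "(\<Sum>m\<in>F. norm (cnth \<phi> m) * s ^ sum m L) \<le> (\<Sum>m\<in>F. (s / r) * (norm (cnth \<phi> m) * r ^ sum m L))"
    proof (rule sum_mono)
      fix m assume m: "m \<in> F"
      show "norm (cnth \<phi> m) * s ^ sum m L \<le> (s / r) * (norm (cnth \<phi> m) * r ^ sum m L)"
      proof (cases "m = (\<lambda>_. 0)")
        case True then show ?thesis using assms by simp
      next
        case False
        then obtain k where k: "sum m L = Suc k" using deg[of m] m F gr0_implies_Suc by blast
        have "s ^ sum m L \<le> s * r ^ k" unfolding k using s by (simp add: power_mono)
        also have "\<dots> = (s / r) * r ^ sum m L" unfolding k using r by simp
        finally have "norm (cnth \<phi> m) * s ^ sum m L \<le> norm (cnth \<phi> m) * ((s / r) * r ^ sum m L)"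
          by (rule mult_left_mono) simp
        then show ?thesis by (simp add: mult.left_commute)
      qed
    qed
    also have "\<dots> = (s / r) * (\<Sum>m\<in>F. norm (cnth \<phi> m) * r ^ sum m L)" by (simp add: sum_distrib_left)
    also have "\<dots> \<le> (s / r) * C" using s r nboundD[OF r(2) F] by (intro mult_left_mono) auto
    also have "\<dots> = C / (2 * (C + 1))" unfolding s_def using r(1) by simp
    also have "\<dots> \<le> 1/2" using C by (simp add: field_simps)
    finally show "(\<Sum>m\<in>F. norm (cnth \<phi> m) * s ^ sum m L) \<le> 1/2" .
  qed
  have pow: "nbound L s ((1/2)^k) (cnth (\<phi> ^ k))" for k
  proof (induction k)
    case 0 then show ?case using nbound_one[OF s(1)] by (simp add: cnth_one)
  next
    case (Suc k) then show ?case using nbound_smul[OF L(1) s(1) half Suc] by (simp add: cnth_mult)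
  qed
  have van: "cnth (\<phi> ^ k) m = 0" if "sum m L < k" for k m
    using that
  proof (induction k arbitrary: m)
    case 0 then show ?case by simp
  next
    case (Suc k)
    show ?case
    proof (rule ccontr)
      assume "cnth (\<phi> ^ Suc k) m \<noteq> 0"
      then have "smul (cnth \<phi>) (cnth (\<phi> ^ k)) m \<noteq> 0" by (simp add: cnth_mult)
      then obtain a where a: "a \<le> m" "cnth \<phi> a \<noteq> 0" "cnth (\<phi> ^ k) (m - a) \<noteq> 0" by (rule smul_nonzeroE)
      have "a \<noteq> (\<lambda>_. 0)" using a(2) assms by auto
      then have "sum a L > 0" using deg[of a] conv_series_exps[OF L(2) a(2)] by blast
      moreover have "\<not> sum (m - a) L < k" using Suc.IH[of "m - a"] a(3) by blast
      ultimately show False using Suc.prems sum_diff_le[OF a(1), of L] by linarith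
    qed
  qed
  \<comment> \<open>The sum may stop at the degree of \<open>m\<close>: by \<open>van\<close> the
    higher powers have no term at \<open>m\<close>.\<close>
  define g :: "'v series" where "g m = (\<Sum>k\<le>sum m L. cnth (\<phi> ^ k) m)" for m
  have gN: "g m = (\<Sum>k\<le>N. cnth (\<phi> ^ k) m)" if "sum m L \<le> N" for m N
    unfolding g_def using that by (intro sum.mono_neutral_left) (auto intro!: van)
  have gexps: "m \<in> exps L" if "g m \<noteq> 0" for m
  proof (rule ccontr)
    assume "m \<notin> exps L"
    then have "cnth (\<phi> ^ k) m = 0" for k using conv_series_power[OF L] cnth_exps by blast
    then show False using that by (simp add: g_def)
  qed
  have "nbound L s 2 g"
    unfolding nbound_def
  proof (intro allI impI)
    fix F assume F: "finite F" "F \<subseteq> exps L"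
    define K where "K = (\<Sum>m\<in>F. sum m L)"
    have "(\<Sum>m\<in>F. norm (g m) * s ^ sum m L) \<le> (\<Sum>m\<in>F. \<Sum>k\<le>K. norm (cnth (\<phi> ^ k) m) * s ^ sum m L)"
    proof (rule sum_mono)
      fix m assume "m \<in> F"
      then have "sum m L \<le> K" unfolding K_def by (intro member_le_sum) (use F in auto)
      from gN[OF this] have "norm (g m) \<le> (\<Sum>k\<le>K. norm (cnth (\<phi> ^ k) m))" using norm_sum by metis
      then show "norm (g m) * s ^ sum m L \<le> (\<Sum>k\<le>K. norm (cnth (\<phi> ^ k) m) * s ^ sum m L)"
        using s by (simp add: mult_right_mono flip: sum_distrib_right)
    qed
    also have "\<dots> = (\<Sum>k\<le>K. \<Sum>m\<in>F. norm (cnth (\<phi> ^ k) m) * s ^ sum m L)" by (rule sum.swap)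
    also have "\<dots> \<le> (\<Sum>k\<le>K. (1/2)^k)" by (intro sum_mono nboundD[OF pow F])
    also have "\<dots> = 2 - (1/2)^K" by (induction K) (auto simp: field_simps)
    also have "\<dots> \<le> 2" by simp
    finally show "(\<Sum>m\<in>F. norm (g m) * s ^ sum m L) \<le> 2" .
  qed
  then have g: "conv_series L g" using gexps s(1) by (intro conv_seriesI[of g L s 2]) auto
  have "(1 - \<phi>) * Abs_cs g = 1"
  proof (rule cs_eqI, rule ext)
    fix m :: "'v \<Rightarrow> nat"
    \<comment> \<open>At all exponents below \<open>m\<close> the series \<open>g\<close> agrees
      with the same truncated geometric sum, whose remainder \<open>\<phi> ^ Suc N\<close> has no
      term at \<open>m\<close>.\<close>
    define N where "N = sum m L"
    have "cnth ((1 - \<phi>) * Abs_cs g) m = (\<Sum>a\<in>{a. a \<le> m}. cnth (1 - \<phi>) a * cnth (\<Sum>k\<le>N. \<phi> ^ k) (m - a))"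
      unfolding cnth_mult_eq
    proof (rule sum.cong[OF refl])
      fix a assume "a \<in> {a. a \<le> m}"
      then have "sum (m - a) L \<le> N" unfolding N_def using sum_diff_le[of a m L] by simp
      then show "cnth (1 - \<phi>) a * cnth (Abs_cs g) (m - a) = cnth (1 - \<phi>) a * cnth (\<Sum>k\<le>N. \<phi> ^ k) (m - a)"
        by (simp add: cnth_Abs_cs[OF L(1) g] gN cnth_sum)
    qed
    also have "\<dots> = cnth ((1 - \<phi>) * (\<Sum>k\<le>N. \<phi> ^ k)) m" by (rule cnth_mult_eq[symmetric])
    also have "(1 - \<phi>) * (\<Sum>k\<le>N. \<phi> ^ k) = 1 - \<phi> ^ Suc N" by (rule sum_gp_basic)
    also have "cnth (1 - \<phi> ^ Suc N) m = cnth 1 m"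
      unfolding cnth_diff using van[of m "Suc N"] by (simp add: N_def del: power_Suc)
    finally show "cnth ((1 - \<phi>) * Abs_cs g) m = cnth 1 m" .
  qed
  then show ?thesis by blast
qed

subsection \<open>Restriction of variables and ideals\<close>

text \<open>The substitution of 0 for the variables outside \<open>K\<close>.\<close>

definition cres :: "'v set \<Rightarrow> 'v cs \<Rightarrow> 'v cs" where
  "cres K f = Abs_cs (\<lambda>m. if m \<in> exps K then cnth f m else 0)"

lemma cnth_cres: "cnth (cres K f) m = (if m \<in> exps K then cnth f m else 0)"
proof -
  obtain L where L: "finite L" "conv_series L (cnth f)" using cnth_conv[of f] by blast
  have "conv_series L (\<lambda>m. if m \<in> exps K then cnth f m else 0)"
    by (rule conv_series_dominated[OF L(2)]) (auto split: if_splits intro: conv_series_exps[OF L(2)])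
  then show ?thesis unfolding cres_def using L(1) by (simp add: cnth_Abs_cs)
qed

lemma conv_series_cres:
  assumes K: "finite K"
  shows "conv_series K (cnth (cres K f))"
proof -
  obtain L where L: "finite L" "conv_series L (cnth (cres K f))" using cnth_conv[of "cres K f"] by blast
  have "conv_series (L \<union> K) (cnth (cres K f))" using K L by (intro conv_series_mono[OF _ _ L(2)]) auto
  then obtain r C where r: "r > 0" "nbound (L \<union> K) r C (cnth (cres K f))" by (rule conv_seriesE)
  show ?thesis
  proof (rule conv_seriesI[OF _ r(1)])
    show "m \<in> exps K" if "cnth (cres K f) m \<noteq> 0" for m using that by (auto simp: cnth_cres split: if_splits)
    show "nbound K r C (cnth (cres K f))" unfolding nbound_def
    proof (intro allI impI)
      fix F assume F: "finite F" "F \<subseteq> exps K"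
      have "(\<Sum>m\<in>F. norm (cnth (cres K f) m) * r ^ sum m K) = (\<Sum>m\<in>F. norm (cnth (cres K f) m) * r ^ sum m (L \<union> K))"
      proof (rule sum.cong[OF refl])
        fix m assume "m \<in> F"
        then have "sum m K = sum m (L \<union> K)" using F L K by (intro sum.mono_neutral_left) (auto simp: exps_def)
        then show "norm (cnth (cres K f) m) * r ^ sum m K = norm (cnth (cres K f) m) * r ^ sum m (L \<union> K)" by simp
      qed
      also have "\<dots> \<le> C" by (rule nboundD[OF r(2) F(1)]) (use F exps_mono[of K "L \<union> K"] in blast)
      finally show "(\<Sum>m\<in>F. norm (cnth (cres K f) m) * r ^ sum m K) \<le> C" .
    qed
  qed
qed

lemma cres_id: "conv_series K (cnth f) \<Longrightarrow> cres K f = f"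
  by (rule cs_eqI) (auto simp: fun_eq_iff cnth_cres dest: cnth_exps)

lemma cres_add: "cres K (f + g) = cres K f + cres K g"
  by (rule cs_eqI) (auto simp: fun_eq_iff cnth_cres cnth_add)

lemma cres_zero: "cres K 0 = 0"
  by (rule cs_eqI) (auto simp: fun_eq_iff cnth_cres cnth_zero)

lemma cres_sum: "cres K (sum f A) = (\<Sum>x\<in>A. cres K (f x))"
  by (induction A rule: infinite_finite_induct) (auto simp: cres_add cres_zero)

text \<open>\<open>exps K\<close> is closed under sums and under divisors, so a product of two terms
  lies in it exactly when both factors do.\<close>

lemma cres_mult: "cres K (f * g) = cres K f * cres K g"
proof (rule cs_eqI, rule ext)
  fix m
  show "cnth (cres K (f * g)) m = cnth (cres K f * cres K g) m"
  proof (cases "m \<in> exps K")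
    case True
    then show ?thesis
      unfolding cnth_mult_eq cnth_cres using exps_le[OF True] exps_diff[OF True] by (auto intro!: sum.cong)
  next
    case False
    have "cnth (cres K f) a * cnth (cres K g) (m - a) = 0" if "a \<le> m" for a
    proof (rule ccontr)
      assume "cnth (cres K f) a * cnth (cres K g) (m - a) \<noteq> 0"
      then have "a \<in> exps K" "m - a \<in> exps K" by (auto simp: cnth_cres split: if_splits)
      then have "(\<lambda>x. a x + (m - a) x) \<in> exps K" by (rule exps_add)
      moreover have "(\<lambda>x. a x + (m - a) x) = m" using that by (auto simp: le_fun_def)
      ultimately show False using False by simp
    qed
    then have "cnth (cres K f * cres K g) m = 0" unfolding cnth_mult_eq by (intro sum.neutral) blast
    then show ?thesis using False by (simp add: cnth_cres)
  qed
qed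

text \<open>With the ring acting on itself, submodules are ideals and \<open>span\<close> is the
  generated ideal. The rule \<open>scale_scale\<close> is then a reversed associativity law, hence
  its removal from the simplifier.\<close>

interpretation cs_ideal: Modules.module "(*) :: 'v cs \<Rightarrow> 'v cs \<Rightarrow> 'v cs"
  by standard (auto simp: algebra_simps)

declare cs_ideal.scale_scale [simp del]

text \<open>Multipliers taken from the whole ring may involve variables outside \<open>L\<close>.
  Applying \<open>cres L\<close>, which fixes \<open>f\<close> and the generators, brings them back
  into the ring of series in \<open>L\<close>.\<close>

lemma ideal_span_iff:
  assumes L: "finite L" and G: "\<And>g. g \<in> G \<Longrightarrow> conv_series L g"
  shows "f \<in> ideal_span L G \<longleftrightarrow> conv_series L f \<and> Abs_cs f \<in> cs_ideal.span (Abs_cs ` G)"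
proof
  assume "f \<in> ideal_span L G"
  then obtain S h where S: "finite S" "S \<subseteq> G" "\<And>g. g \<in> S \<Longrightarrow> conv_series L (h g)"
    and f: "f = (\<lambda>m. \<Sum>g\<in>S. smul (h g) g m)" unfolding ideal_span_def by blast
  define F where "F = (\<Sum>g\<in>S. Abs_cs (h g) * Abs_cs g)"
  have c: "cnth (Abs_cs g) = g" "cnth (Abs_cs (h g)) = h g" if "g \<in> S" for g
    using that S G by (auto intro!: cnth_Abs_cs[OF L])
  have "f = cnth F"
    unfolding f F_def by (auto simp: fun_eq_iff cnth_sum cnth_mult c intro!: sum.cong)
  moreover have "conv_series L (cnth F)"
    unfolding F_def using c S G by (intro conv_series_sum conv_series_mult[OF L]) auto
  moreover have "F \<in> cs_ideal.span (Abs_cs ` G)"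
    unfolding F_def using S(2) by (intro cs_ideal.span_sum cs_ideal.span_scale cs_ideal.span_base) auto
  ultimately show "conv_series L f \<and> Abs_cs f \<in> cs_ideal.span (Abs_cs ` G)" by (simp add: cnth_inverse)
next
  assume f: "conv_series L f \<and> Abs_cs f \<in> cs_ideal.span (Abs_cs ` G)"
  then obtain t r where t: "finite t" "t \<subseteq> Abs_cs ` G" "Abs_cs f = (\<Sum>a\<in>t. r a * a)"
    unfolding cs_ideal.span_explicit by blast
  have tG: "cnth a \<in> G" "conv_series L (cnth a)" if "a \<in> t" for a
    using that t(2) G by (auto simp: cnth_Abs_cs[OF L])
  have "Abs_cs f = cres L (Abs_cs f)" using f by (simp add: cres_id cnth_Abs_cs[OF L])
  also have "\<dots> = (\<Sum>a\<in>t. cres L (r a) * a)" unfolding t(3) cres_sum cres_mult using tG by (simp add: cres_id)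
  finally have "f = cnth (\<Sum>a\<in>t. cres L (r a) * a)" using f cnth_Abs_cs[OF L] by metis
  also have "\<dots> = (\<lambda>m. \<Sum>a\<in>t. smul (cnth (cres L (r a))) (cnth a) m)"
    by (simp add: fun_eq_iff cnth_sum cnth_mult)
  also have "\<dots> = (\<lambda>m. \<Sum>g\<in>cnth ` t. smul (cnth (cres L (r (Abs_cs g)))) g m)"
    by (subst sum.reindex) (auto simp: inj_on_def cnth_inject cnth_inverse)
  finally show "f \<in> ideal_span L G"
    unfolding ideal_span_def using t(1) tG conv_series_cres[OF L]
    by (intro CollectI exI[of _ "cnth ` t"] exI[of _ "\<lambda>g. cnth (cres L (r (Abs_cs g)))"]) auto
qed

subsection \<open>Weights\<close>

definition nwt :: "'v set \<Rightarrow> ('v \<Rightarrow> nat) \<Rightarrow> ('v \<Rightarrow> nat) \<Rightarrow> nat" where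
  "nwt L \<omega> a = (\<Sum>x\<in>L. \<omega> x * a x)"

lemma nwt_add: "nwt L \<omega> (\<lambda>x. a x + b x) = nwt L \<omega> a + nwt L \<omega> b"
  by (simp add: nwt_def algebra_simps sum.distrib)

lemma nwt_diff: "a \<le> m \<Longrightarrow> nwt L \<omega> m = nwt L \<omega> a + nwt L \<omega> (m - a)"
  unfolding nwt_def sum.distrib[symmetric]
  by (intro sum.cong) (auto simp: le_fun_def simp flip: distrib_left)

lemma finite_nwt_le:
  assumes "finite L" "\<And>x. x \<in> L \<Longrightarrow> \<omega> x > 0"
  shows "finite {m \<in> exps L. nwt L \<omega> m \<le> N}"
proof (rule finite_subset)
  show "{m \<in> exps L. nwt L \<omega> m \<le> N} \<subseteq> {m. \<forall>x. (x \<in> L \<longrightarrow> m x \<in> {..N}) \<and> (x \<notin> L \<longrightarrow> m x = 0)}"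
  proof (intro subsetI CollectI allI conjI impI)
    fix m x assume m: "m \<in> {m \<in> exps L. nwt L \<omega> m \<le> N}"
    show "m x = 0" if "x \<notin> L" using m that by (simp add: exps_def)
    show "m x \<in> {..N}" if "x \<in> L"
    proof -
      have "m x \<le> \<omega> x * m x" using assms(2)[OF that] by simp
      also have "\<dots> \<le> nwt L \<omega> m" unfolding nwt_def using assms(1) that by (intro member_le_sum) auto
      finally show ?thesis using m by simp
    qed
  qed
  show "finite \<dots>" by (rule finite_set_of_finite_funs[OF assms(1)]) simp
qed

text \<open>Removing one variable at a time lowers the weight by at most
  \<open>sum \<omega> L\<close>, so the descent cannot jump over the window above
  \<open>V\<close>.\<close>

lemma nwt_reduce:
  assumes L: "finite L" and "m \<in> exps L" "V \<le> nwt L \<omega> m"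
  shows "\<exists>a. a \<le> m \<and> a \<in> exps L \<and> V \<le> nwt L \<omega> a \<and> nwt L \<omega> a < V + Suc (sum \<omega> L)"
  using assms(2,3)
proof (induction "sum m L" arbitrary: m rule: less_induct)
  case less
  show ?case
  proof (cases "nwt L \<omega> m < V + Suc (sum \<omega> L)")
    case True then show ?thesis using less.prems by (intro exI[of _ m]) auto
  next
    case False
    then have "nwt L \<omega> m \<noteq> 0" by simp
    have "\<exists>x\<in>L. \<omega> x * m x \<noteq> 0"
    proof (rule ccontr)
      assume "\<not> (\<exists>x\<in>L. \<omega> x * m x \<noteq> 0)"
      then have "nwt L \<omega> m = 0" unfolding nwt_def by (intro sum.neutral) blast
      then show False using \<open>nwt L \<omega> m \<noteq> 0\<close> by simp
    qed
    then obtain x where x: "x \<in> L" "m x > 0" by auto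
    define e :: "'a \<Rightarrow> nat" where "e y = (if y = x then 1 else 0)" for y
    have em: "e \<le> m" unfolding le_fun_def e_def using x by auto
    have ne: "nwt L \<omega> e = \<omega> x" unfolding nwt_def e_def using x L by (simp add: if_distrib sum.delta cong: if_cong)
    have "sum e L = 1" unfolding e_def using x L by simp
    then have "sum (m - e) L < sum m L" using sum_diff_le[OF em, of L] by simp
    moreover have "m - e \<in> exps L" using less.prems(1) by (rule exps_diff)
    moreover have "\<omega> x \<le> sum \<omega> L" using x L by (intro member_le_sum) auto
    then have "V \<le> nwt L \<omega> (m - e)" using False nwt_diff[OF em, of L \<omega>] ne by simp
    ultimately have "\<exists>a. a \<le> m - e \<and> a \<in> exps L \<and> V \<le> nwt L \<omega> a \<and> nwt L \<omega> a < V + Suc (sum \<omega> L)"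
      by (rule less.hyps)
    then show ?thesis using order_trans[OF _ diff_le_fun[of m e]] by blast
  qed
qed

text \<open>Division by a monomial, possibly keeping only part of the terms, costs just the factor
  \<open>r ^ sum b L\<close> in the norm.\<close>

lemma conv_series_shift:
  assumes L: "finite L" and f: "conv_series L f" and b: "b \<in> exps L"
    and g: "\<And>m. g m = 0 \<or> m \<in> exps L \<and> g m = f (\<lambda>x. m x + b x)"
  shows "conv_series L g"
proof -
  obtain r C where r: "r > 0" "nbound L r C f" by (rule conv_seriesE[OF f])
  show ?thesis
  proof (rule conv_seriesI[OF _ r(1)])
    show "m \<in> exps L" if "g m \<noteq> 0" for m using g[of m] that by blast
    show "nbound L r (C / r ^ sum b L) g" unfolding nbound_def
    proof (intro allI impI)
      fix F assume F: "finite F" "F \<subseteq> exps L"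
      define T where "T = (\<lambda>m x. m x + b x) ` F"
      have inj: "inj_on (\<lambda>m x. m x + b x) F"
        by (rule inj_onI) (auto simp: fun_eq_iff)
      have "(\<Sum>m\<in>F. norm (g m) * r ^ sum m L) * r ^ sum b L \<le> (\<Sum>m\<in>F. norm (f (\<lambda>x. m x + b x)) * r ^ sum (\<lambda>x. m x + b x) L)"
        unfolding sum_distrib_right
      proof (rule sum_mono)
        fix m assume "m \<in> F"
        have "norm (g m) \<le> norm (f (\<lambda>x. m x + b x))" using g[of m] by auto
        then show "norm (g m) * r ^ sum m L * r ^ sum b L \<le> norm (f (\<lambda>x. m x + b x)) * r ^ sum (\<lambda>x. m x + b x) L"
          unfolding sum.distrib power_add using r(1) by (simp add: mult.assoc mult_right_mono)
      qed
      also have "\<dots> = (\<Sum>m\<in>T. norm (f m) * r ^ sum m L)"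
        unfolding T_def by (subst sum.reindex[OF inj]) simp
      also have "\<dots> \<le> C"
        by (rule nboundD[OF r(2)]) (use F b in \<open>auto simp: T_def intro: exps_add\<close>)
      finally show "(\<Sum>m\<in>F. norm (g m) * r ^ sum m L) \<le> C / r ^ sum b L"
        using r(1) by (simp add: pos_le_divide_eq)
    qed
  qed
qed

text \<open>A finite set of monomials generates all series of weight at least \<open>V\<close>: each
  exponent has a divisor in the window, and the terms are sorted by a chosen one. Finiteness is what
  Nakayama's lemma will need.\<close>

lemma span_of_weight_ge:
  assumes L: "finite L" and \<omega>: "\<And>x. x \<in> L \<Longrightarrow> \<omega> x > 0"
    and f: "conv_series L (cnth f)" and V: "\<And>m. cnth f m \<noteq> 0 \<Longrightarrow> V \<le> nwt L \<omega> m"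
  shows "f \<in> cs_ideal.span (zmon ` {a \<in> exps L. V \<le> nwt L \<omega> a \<and> nwt L \<omega> a < V + Suc (sum \<omega> L)})"
proof -
  define B where "B = {a \<in> exps L. V \<le> nwt L \<omega> a \<and> nwt L \<omega> a < V + Suc (sum \<omega> L)}"
  have B: "finite B" unfolding B_def
    by (rule finite_subset[OF _ finite_nwt_le[OF L \<omega>, of _ "V + Suc (sum \<omega> L)"]]) auto
  define \<beta> where "\<beta> m = (SOME a. a \<le> m \<and> a \<in> B)" for m
  have \<beta>: "\<beta> m \<le> m \<and> \<beta> m \<in> B" if "cnth f m \<noteq> 0" for m
  proof -
    have "\<exists>a. a \<le> m \<and> a \<in> B"
      using nwt_reduce[OF L conv_series_exps[OF f that] V[OF that]] unfolding B_def by blast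
    from someI_ex[OF this] show ?thesis unfolding \<beta>_def .
  qed
  \<comment> \<open>The terms of \<open>f\<close> whose chosen divisor is \<open>b\<close>, divided
    by that monomial; every term of \<open>f\<close> is thus used once.\<close>
  define h where "h b = (\<lambda>m. if m \<in> exps L \<and> \<beta> (\<lambda>x. m x + b x) = b then cnth f (\<lambda>x. m x + b x) else 0)" for b
  have finite_supp: "finite {x. b x \<noteq> 0}" "b \<in> exps L" if "b \<in> B" for b
    using that exps_finite_support[OF L] by (auto simp: B_def)
  have h: "conv_series L (h b)" if "b \<in> B" for b
    by (rule conv_series_shift[OF L f finite_supp(2)[OF that]]) (simp add: h_def)
  have "f = (\<Sum>b\<in>B. Abs_cs (h b) * zmon b)"
  proof (rule cs_eqI, rule ext)
    fix m
    have "cnth (\<Sum>b\<in>B. Abs_cs (h b) * zmon b) m = (\<Sum>b\<in>B. if b \<le> m then h b (m - b) else 0)"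
      unfolding cnth_sum
      by (rule sum.cong[OF refl]) (subst mult.commute, simp add: cnth_zmon_mult[OF finite_supp(1)] cnth_Abs_cs[OF L h])
    also have "\<dots> = (\<Sum>b\<in>B. if b = \<beta> m then cnth f m else 0)"
    proof (rule sum.cong[OF refl])
      fix b assume b: "b \<in> B"
      show "(if b \<le> m then h b (m - b) else 0) = (if b = \<beta> m then cnth f m else 0)"
      proof (cases "b \<le> m")
        case True
        have *: "(\<lambda>x. (m - b) x + b x) = m" using True by (auto simp: le_fun_def)
        have "m - b \<in> exps L" if "cnth f m \<noteq> 0" using conv_series_exps[OF f that] by (rule exps_diff)
        then show ?thesis using True unfolding h_def * by auto
      next
        case False
        then show ?thesis using \<beta>[of m] by auto
      qed
    qed
    also have "\<dots> = cnth f m" using B \<beta>[of m] by auto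
    finally show "cnth f m = cnth (\<Sum>b\<in>B. Abs_cs (h b) * zmon b) m" by simp
  qed
  also have "\<dots> \<in> cs_ideal.span (zmon ` B)"
    by (intro cs_ideal.span_sum cs_ideal.span_scale cs_ideal.span_base) auto
  finally show ?thesis unfolding B_def .
qed

lemma cnth_mult_0: "cnth (f * g) (\<lambda>_. 0) = cnth f (\<lambda>_. 0) * cnth g (\<lambda>_. 0)"
proof -
  have *: "{a. a \<le> (\<lambda>_. 0 :: nat)} = {\<lambda>_. 0 :: nat}" by (auto simp: le_fun_def fun_eq_iff)
  show ?thesis unfolding cnth_mult_eq by (subst *) (simp add: fun_diff_def)
qed

text \<open>The generators are eliminated one at a time, a series being a unit when its constant term is not 0.\<close>
lemma nakayama:
  fixes M :: "'v cs set"
  assumes "finite M" and J: "cs_ideal.subspace J"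
    and "\<And>a. a \<in> M \<Longrightarrow> \<exists>i \<mu>. i \<in> J \<and> (\<forall>b\<in>M. cnth (\<mu> b) (\<lambda>_. 0) = 0) \<and> a = i + (\<Sum>b\<in>M. \<mu> b * b)"
  shows "M \<subseteq> J"
  using assms(1,3)
proof (induction M rule: finite_induct)
  case empty
  then show ?case by simp
next
  case (insert a M)
  obtain i \<mu> where i: "i \<in> J" "\<forall>b\<in>insert a M. cnth (\<mu> b) (\<lambda>_. 0) = 0" "a = i + (\<Sum>b\<in>insert a M. \<mu> b * b)"
    using insert.prems[of a] by blast
  \<comment> \<open>As \<open>\<mu> a\<close> has no constant term, \<open>1 - \<mu> a\<close> is a
    unit and the relation can be solved for \<open>a\<close>. The new multipliers again have no
    constant term.\<close>
  obtain u where u: "(1 - \<mu> a) * u = 1" using geometric_series[of "\<mu> a"] i(2) by blast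
  have "a = ((1 - \<mu> a) * u) * a" using u by simp
  also have "\<dots> = u * (a - \<mu> a * a)" by (simp add: algebra_simps)
  also have "a - \<mu> a * a = i + (\<Sum>b\<in>M. \<mu> b * b)" using i(3) insert.hyps by (simp add: algebra_simps)
  finally have a: "a = u * i + (\<Sum>b\<in>M. u * \<mu> b * b)" by (simp add: algebra_simps sum_distrib_left)
  have "M \<subseteq> J"
  proof (rule insert.IH)
    fix c assume c: "c \<in> M"
    obtain j \<nu> where j: "j \<in> J" "\<forall>b\<in>insert a M. cnth (\<nu> b) (\<lambda>_. 0) = 0" "c = j + (\<Sum>b\<in>insert a M. \<nu> b * b)"
      using insert.prems[of c] c by blast
    have "c = j + \<nu> a * a + (\<Sum>b\<in>M. \<nu> b * b)" using j(3) insert.hyps by (simp add: algebra_simps)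
    also have "\<nu> a * a = \<nu> a * u * i + (\<Sum>b\<in>M. \<nu> a * u * \<mu> b * b)"
      by (subst a) (simp add: algebra_simps sum_distrib_left)
    finally have "c = (j + \<nu> a * u * i) + (\<Sum>b\<in>M. (\<nu> b + \<nu> a * u * \<mu> b) * b)"
      by (simp add: algebra_simps sum.distrib)
    moreover have "j + \<nu> a * u * i \<in> J"
      using j(1) i(1) J by (intro cs_ideal.subspace_add cs_ideal.subspace_scale) auto
    moreover have "\<forall>b\<in>M. cnth (\<nu> b + \<nu> a * u * \<mu> b) (\<lambda>_. 0) = 0"
      using i(2) j(2) by (simp add: cnth_add cnth_mult_0)
    ultimately show "\<exists>i \<mu>. i \<in> J \<and> (\<forall>b\<in>M. cnth (\<mu> b) (\<lambda>_. 0) = 0) \<and> c = i + (\<Sum>b\<in>M. \<mu> b * b)"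
      by (intro exI[of _ "j + \<nu> a * u * i"] exI[of _ "\<lambda>b. \<nu> b + \<nu> a * u * \<mu> b"] conjI)
  qed
  moreover have "u * i + (\<Sum>b\<in>M. u * \<mu> b * b) \<in> J"
    using J i(1) \<open>M \<subseteq> J\<close> by (intro cs_ideal.subspace_add cs_ideal.subspace_sum cs_ideal.subspace_scale) auto
  ultimately show ?case using a by auto
qed

subsection \<open>Initial monomials\<close>

lemma wt_diff: "a \<le> m \<Longrightarrow> wt L w m = wt L w a + wt L w (m - a)"
  unfolding wt_def sum.distrib[symmetric]
  by (intro sum.cong) (auto simp: le_fun_def simp flip: distrib_left of_nat_add)

lemma wt_nonneg: "(\<And>x. x \<in> L \<Longrightarrow> w x \<ge> 0) \<Longrightarrow> wt L w m \<ge> 0"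
  unfolding wt_def by (intro sum_nonneg) auto

lemma INF_wt_le:
  assumes "\<And>x. x \<in> L \<Longrightarrow> w x \<ge> 0" "f m \<noteq> 0"
  shows "(INF k\<in>{k. f k \<noteq> 0}. wt L w k) \<le> wt L w m"
  by (rule cINF_lower) (use assms wt_nonneg[of L w] in \<open>auto intro!: bdd_belowI2[of _ 0]\<close>)

text \<open>States that the \<open>w\<close>-initial form is a single term, without an infimum over
  the support.\<close>

definition initial_monomial :: "'v set \<Rightarrow> ('v \<Rightarrow> real) \<Rightarrow> 'v series \<Rightarrow> ('v \<Rightarrow> nat) \<Rightarrow> bool" where
  "initial_monomial L w f a \<longleftrightarrow> f a \<noteq> 0 \<and> (\<forall>m. f m \<noteq> 0 \<longrightarrow> m \<noteq> a \<longrightarrow> wt L w a < wt L w m)"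

text \<open>The monomial is a combination of initial forms of elements \<open>\<phi> g\<close>. If
  the multiplier of each keeps only the terms that bring its initial form to weight
  \<open>wt L w a\<close>, the same combination of the full series has nothing below that weight and
  exactly the monomial at it.\<close>

lemma initial_monomial_init_ideal:
  assumes L: "finite L" and w: "\<And>x. x \<in> L \<Longrightarrow> w x \<ge> 0" and G: "\<And>g. g \<in> G \<Longrightarrow> conv_series L g"
  shows "(\<exists>h\<in>init_ideal L w (ideal_span L G). is_monomial h) \<longleftrightarrow>
    (\<exists>f\<in>ideal_span L G. \<exists>a. initial_monomial L w f a)"
proof
  assume "\<exists>f\<in>ideal_span L G. \<exists>a. initial_monomial L w f a"
  then obtain f a where f: "f \<in> ideal_span L G" "f a \<noteq> 0"
    "\<And>m. f m \<noteq> 0 \<Longrightarrow> m \<noteq> a \<Longrightarrow> wt L w a < wt L w m" by (auto simp: initial_monomial_def)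
  have cf: "conv_series L f" using f(1) ideal_span_iff[OF L G] by blast
  have inf: "(INF k\<in>{k. f k \<noteq> 0}. wt L w k) = wt L w a"
  proof (rule cInf_eq_minimum)
    show "wt L w a \<in> wt L w ` {k. f k \<noteq> 0}" using f(2) by simp
    show "wt L w a \<le> x" if "x \<in> wt L w ` {k. f k \<noteq> 0}" for x
    proof -
      obtain k where k: "x = wt L w k" "f k \<noteq> 0" using \<open>x \<in> _\<close> by blast
      show ?thesis using f(3)[OF k(2)] k(1) by (cases "k = a") auto
    qed
  qed
  have 1: "init_form L w f = (\<lambda>m. f a * monomial_term a m)"
  proof (rule ext)
    fix m
    show "init_form L w f m = f a * monomial_term a m"
      unfolding init_form_def monomial_term_def inf
      using f(2) f(3)[of m] by (cases "m = a") auto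
  qed
  let ?h = "init_form L w f"
  have "finite {x. m x \<noteq> 0}" if "?h m \<noteq> 0" for m
    using that conv_series_exps[OF cf f(2)] exps_finite_support[OF L] by (auto simp: 1 monomial_term_def split: if_splits)
  then have "?h = (\<lambda>m. \<Sum>g\<in>{?h}. smul (monomial_term (\<lambda>_. 0)) g m)" by (simp add: smul_one)
  moreover have "conv_series L (monomial_term (\<lambda>_. 0))" by (rule conv_series_monomial) (simp add: exps_def)
  ultimately have "?h \<in> init_ideal L w (ideal_span L G)"
    unfolding init_ideal_def ideal_span_def[of L "init_form L w ` _"] using f(1)
    by (intro CollectI exI[of _ "{?h}"] exI[of _ "\<lambda>_. monomial_term (\<lambda>_. 0)"]) auto
  moreover have "is_monomial ?h" unfolding is_monomial_def 1 using f(2) by blast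
  ultimately show "\<exists>h\<in>init_ideal L w (ideal_span L G). is_monomial h" by blast
next
  assume "\<exists>h\<in>init_ideal L w (ideal_span L G). is_monomial h"
  then obtain h a c where h: "h \<in> init_ideal L w (ideal_span L G)" "c \<noteq> 0" "h = (\<lambda>m. c * monomial_term a m)"
    by (auto simp: is_monomial_def)
  then obtain S k where S: "finite S" "S \<subseteq> init_form L w ` ideal_span L G" "\<forall>g\<in>S. conv_series L (k g)"
    "h = (\<lambda>m. \<Sum>g\<in>S. smul (k g) g m)" unfolding init_ideal_def ideal_span_def[of L "init_form L w ` _"] by blast
  define \<phi> where "\<phi> g = (SOME f. f \<in> ideal_span L G \<and> g = init_form L w f)" for g
  have \<phi>: "\<phi> g \<in> ideal_span L G" "g = init_form L w (\<phi> g)" if "g \<in> S" for g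
  proof -
    have "\<exists>f. f \<in> ideal_span L G \<and> g = init_form L w f" using that S(2) by blast
    from someI_ex[OF this] show "\<phi> g \<in> ideal_span L G" "g = init_form L w (\<phi> g)" unfolding \<phi>_def by blast+
  qed
  define \<mu> where "\<mu> g = (INF k\<in>{k. \<phi> g k \<noteq> 0}. wt L w k)" for g
  \<comment> \<open>A term of this weight times a term of \<open>\<phi> g\<close> has weight at
    least \<open>wt L w a\<close>, with equality only for the initial form. For
    \<open>\<phi> g = 0\<close> the value of \<open>\<mu> g\<close> is arbitrary and
    harmless.\<close>
  define k' where "k' g = (\<lambda>m. if wt L w m = wt L w a - \<mu> g then k g m else 0)" for g
  have k': "conv_series L (k' g)" if "g \<in> S" for g
  proof -
    have kg: "conv_series L (k g)" using S(3) that by blast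
    show ?thesis
      by (rule conv_series_dominated[OF kg]) (auto simp: k'_def split: if_splits intro: conv_series_exps[OF kg])
  qed
  have c\<phi>: "conv_series L (\<phi> g)" "Abs_cs (\<phi> g) \<in> cs_ideal.span (Abs_cs ` G)" if "g \<in> S" for g
    using \<phi>(1)[OF that] ideal_span_iff[OF L G] by blast+
  define F where "F = (\<Sum>g\<in>S. Abs_cs (k' g) * Abs_cs (\<phi> g))"
  have cF: "conv_series L (cnth F)" unfolding F_def
    by (intro conv_series_sum conv_series_mult[OF L]) (simp_all add: cnth_Abs_cs[OF L] k' c\<phi>)
  have "F \<in> cs_ideal.span (Abs_cs ` G)" unfolding F_def
    by (intro cs_ideal.span_sum cs_ideal.span_scale c\<phi>)
  then have FI: "cnth F \<in> ideal_span L G" using cF ideal_span_iff[OF L G] by (simp add: cnth_inverse)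
  have Fm: "cnth F m = (\<Sum>g\<in>S. \<Sum>b\<in>{b. b \<le> m}. k' g b * \<phi> g (m - b))" for m
    unfolding F_def cnth_sum cnth_mult_eq by (intro sum.cong refl) (simp add: cnth_Abs_cs[OF L] k' c\<phi>)
  have \<mu>: "\<mu> g \<le> wt L w m" if "\<phi> g m \<noteq> 0" for g m
    unfolding \<mu>_def by (rule INF_wt_le) (use w that in auto)
  have low: "wt L w a \<le> wt L w m" if Fm0: "cnth F m \<noteq> 0" for m
  proof -
    obtain g where g: "g \<in> S" "(\<Sum>b\<in>{b. b \<le> m}. k' g b * \<phi> g (m - b)) \<noteq> 0"
      by (rule sum.not_neutral_contains_not_neutral[OF Fm0[unfolded Fm]])
    obtain b where "b \<in> {b. b \<le> m}" and "k' g b * \<phi> g (m - b) \<noteq> 0"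
      by (rule sum.not_neutral_contains_not_neutral[OF g(2)])
    then have "b \<le> m" by simp
    have "wt L w b = wt L w a - \<mu> g" "\<mu> g \<le> wt L w (m - b)"
      using \<mu> \<open>k' g b * \<phi> g (m - b) \<noteq> 0\<close> by (auto simp: k'_def split: if_splits)
    then show ?thesis using wt_diff[OF \<open>b \<le> m\<close>, of L w] by linarith
  qed
  have eq: "cnth F m = h m" if m: "wt L w m = wt L w a" for m
    unfolding Fm S(4) smul_def
  proof (intro sum.cong refl)
    fix g b assume gb: "g \<in> S" "b \<in> {b. b \<le> m}"
    have "wt L w m = wt L w b + wt L w (m - b)" using gb(2) by (intro wt_diff) simp
    then have "wt L w b = wt L w a - \<mu> g \<longleftrightarrow> wt L w (m - b) = \<mu> g" using m by linarith
    moreover have "g (m - b) = (if \<phi> g (m - b) \<noteq> 0 \<and> wt L w (m - b) = \<mu> g then \<phi> g (m - b) else 0)"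
      by (subst \<phi>(2)[OF gb(1)]) (simp add: init_form_def \<mu>_def)
    ultimately show "k' g b * \<phi> g (m - b) = k g b * g (m - b)" by (auto simp: k'_def)
  qed
  have "initial_monomial L w (cnth F) a"
    unfolding initial_monomial_def
  proof (intro conjI allI impI)
    show "cnth F a \<noteq> 0" using eq[of a] h(2,3) by (simp add: monomial_term_def)
    fix m assume m: "cnth F m \<noteq> 0" "m \<noteq> a"
    have "h m = 0" using h(3) m(2) by (simp add: monomial_term_def)
    then show "wt L w a < wt L w m" using low[OF m(1)] eq[of m] m(1) by force
  qed
  then show "\<exists>f\<in>ideal_span L G. \<exists>a. initial_monomial L w f a" using FI by blast
qed

lemma local_trop_iff:
  assumes L: "finite L" and G: "\<And>g. g \<in> G \<Longrightarrow> conv_series L g"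
  shows "w \<in> local_trop L (ideal_span L G) \<longleftrightarrow> (\<forall>x\<in>L. w x \<ge> 0) \<and> (\<forall>x. x \<notin> L \<longrightarrow> w x = 0) \<and>
    \<not> (\<exists>f\<in>ideal_span L G. \<exists>a. initial_monomial L w f a)"
  unfolding local_trop_def using initial_monomial_init_ideal[OF L _ G, of w] by blast

text \<open>Coordinates of weight 0 do not affect the value, and the others are bounded once the
  weight is bounded, so only finitely many values occur below any cutoff. This leaves room to
  perturb \<open>w\<close>.\<close>

lemma wt_gap:
  assumes L: "finite L" and w: "\<And>x. x \<in> L \<Longrightarrow> w x \<ge> 0"
  shows "\<exists>\<eta>>0. \<forall>m. wt L w a < wt L w m \<longrightarrow> wt L w a + \<eta> \<le> wt L w m"
proof -
  \<comment> \<open>Any cutoff above \<open>wt L w a\<close> would do; values beyond this one are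
    already 1 away.\<close>
  define C where "C = wt L w a + 1"
  define P where "P = {x \<in> L. w x > 0}"
  define D where "D = {m. \<forall>x. (x \<in> P \<longrightarrow> m x \<in> {..nat \<lceil>\<Sum>x\<in>P. C / w x\<rceil>}) \<and> (x \<notin> P \<longrightarrow> m x = (0::nat))}"
  have P: "finite P" unfolding P_def using L by simp
  have C: "C > 0" unfolding C_def using wt_nonneg[of L w a, OF w] by linarith
  have D: "finite D" unfolding D_def by (rule finite_set_of_finite_funs[OF P]) simp
  have wD: "wt L w m \<in> wt L w ` D" if m: "wt L w m \<le> C" for m
  proof -
    define m' where "m' x = (if x \<in> P then m x else 0)" for x
    have "wt L w m = wt L w m'" unfolding wt_def m'_def P_def
      using w by (intro sum.cong) (auto simp: less_le)
    moreover have "m' \<in> D"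
    proof -
      have "m x \<le> nat \<lceil>\<Sum>x\<in>P. C / w x\<rceil>" if x: "x \<in> P" for x
      proof -
        have "w x * real (m x) \<le> wt L w m" unfolding wt_def
          using x w L by (intro member_le_sum) (auto simp: P_def)
        then have "real (m x) \<le> C / w x" using m x by (simp add: P_def pos_le_divide_eq mult.commute)
        also have "\<dots> \<le> (\<Sum>x\<in>P. C / w x)" using x P C by (intro member_le_sum) (auto simp: P_def)
        finally show ?thesis by linarith
      qed
      then show ?thesis unfolding D_def m'_def by simp
    qed
    ultimately show ?thesis by blast
  qed
  define T where "T = (\<lambda>t. t - wt L w a) ` {t \<in> wt L w ` D. wt L w a < t}"
  have T: "finite T" "\<forall>t\<in>T. t > 0" unfolding T_def using D by auto
  define \<eta> where "\<eta> = Min (insert 1 T)"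
  have "\<eta> > 0" unfolding \<eta>_def using T by auto
  moreover have "wt L w a + \<eta> \<le> wt L w m" if "wt L w a < wt L w m" for m
  proof (cases "wt L w m \<le> C")
    case True
    then have "wt L w m - wt L w a \<in> T" unfolding T_def using wD[OF True] that by blast
    then have "\<eta> \<le> wt L w m - wt L w a" unfolding \<eta>_def using T by (intro Min_le) auto
    then show ?thesis by linarith
  next
    case False
    have "\<eta> \<le> 1" unfolding \<eta>_def using T by (intro Min_le) auto
    then show ?thesis using False unfolding C_def by linarith
  qed
  ultimately show ?thesis by blast
qed

subsection \<open>Substitution of arcs\<close>

definition ymon :: "'v set \<Rightarrow> ('v \<Rightarrow> complex fps) \<Rightarrow> ('v \<Rightarrow> nat) \<Rightarrow> complex fps" where
  "ymon L y m = (\<Prod>x\<in>L. y x ^ m x)"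

definition arcmon :: "'v set \<Rightarrow> ('v \<Rightarrow> nat) \<Rightarrow> ('v \<Rightarrow> complex fps) \<Rightarrow> ('v \<Rightarrow> nat) \<Rightarrow> complex fps" where
  "arcmon L \<omega> y m = fps_X ^ nwt L \<omega> m * ymon L y m"

text \<open>The substitution of \<open>t ^ \<omega> x * y x\<close> for the variable
  \<open>x\<close>. With all \<open>\<omega> x\<close> positive only finitely many exponents reach
  order \<open>n\<close>, so formal series in \<open>t\<close> suffice.\<close>

definition arc :: "'v set \<Rightarrow> ('v \<Rightarrow> nat) \<Rightarrow> ('v \<Rightarrow> complex fps) \<Rightarrow> 'v cs \<Rightarrow> complex fps" where
  "arc L \<omega> y f = Abs_fps (\<lambda>n. \<Sum>m\<in>{m \<in> exps L. nwt L \<omega> m \<le> n}. cnth f m * fps_nth (arcmon L \<omega> y m) n)"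

lemma ymon_add: "ymon L y (\<lambda>x. a x + b x) = ymon L y a * ymon L y b"
  by (simp add: ymon_def power_add prod.distrib)

lemma arcmon_add: "arcmon L \<omega> y (\<lambda>x. a x + b x) = arcmon L \<omega> y a * arcmon L \<omega> y b"
  by (simp add: arcmon_def nwt_add ymon_add power_add algebra_simps)

lemma arcmon_nth: "fps_nth (arcmon L \<omega> y m) n = (if n < nwt L \<omega> m then 0 else fps_nth (ymon L y m) (n - nwt L \<omega> m))"
  by (simp add: arcmon_def fps_X_power_mult_nth)

lemma ymon_nth_0: "fps_nth (ymon L y m) 0 = (\<Prod>x\<in>L. fps_nth (y x) 0 ^ m x)"
proof -
  have p: "fps_nth (f ^ k) 0 = fps_nth f 0 ^ k" for f :: "complex fps" and k
    by (induction k) auto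
  have "fps_nth (\<Prod>x\<in>A. y x ^ m x) 0 = (\<Prod>x\<in>A. fps_nth (y x) 0 ^ m x)" for A
    by (induction A rule: infinite_finite_induct) (auto simp: p)
  then show ?thesis unfolding ymon_def .
qed

lemma arc_add: "arc L \<omega> y (f + g) = arc L \<omega> y f + arc L \<omega> y g"
  by (simp add: arc_def fps_eq_iff cnth_add algebra_simps sum.distrib)

lemma arc_zero: "arc L \<omega> y 0 = 0"
  by (simp add: arc_def fps_eq_iff cnth_zero)

lemma arc_sum: "arc L \<omega> y (sum f A) = (\<Sum>x\<in>A. arc L \<omega> y (f x))"
  by (induction A rule: infinite_finite_induct) (auto simp: arc_add arc_zero)

context
  fixes L :: "'v set" and \<omega> :: "'v \<Rightarrow> nat"
  assumes L: "finite L" and \<omega>: "\<And>x. x \<in> L \<Longrightarrow> \<omega> x > 0"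
begin

lemma arc_nth:
  assumes "n \<le> N"
  shows "fps_nth (arc L \<omega> y f) n = (\<Sum>m\<in>{m \<in> exps L. nwt L \<omega> m \<le> N}. cnth f m * fps_nth (arcmon L \<omega> y m) n)"
  unfolding arc_def fps_nth_Abs_fps
  using assms finite_nwt_le[OF L \<omega>, of _ N] by (intro sum.mono_neutral_left) (auto simp: arcmon_nth)

text \<open>The coefficient of order \<open>n\<close> sees only exponents of weight at most
  \<open>n\<close>, which reduces multiplicativity to a finite rearrangement.\<close>

lemma arc_mult: "arc L \<omega> y (f * g) = arc L \<omega> y f * arc L \<omega> y g"
proof (rule fps_ext)
  fix n
  define D where "D = {m \<in> exps L. nwt L \<omega> m \<le> n}"
  let ?E = "arcmon L \<omega> y"
  have D: "finite D" unfolding D_def by (rule finite_nwt_le[OF L \<omega>])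
  have le_D: "a \<in> D" "m - a \<in> D" if "m \<in> D" "a \<le> m" for a m
    using that exps_le[of m L a] exps_diff[of m L a] nwt_diff[OF that(2), of L \<omega>] by (auto simp: D_def)
  have finD: "finite {a. a \<le> m}" if "m \<in> D" for m
    by (rule finite_le_fun, rule exps_finite_support[OF L]) (use that in \<open>simp add: D_def\<close>)
  have "fps_nth (arc L \<omega> y f * arc L \<omega> y g) n
      = (\<Sum>i=0..n. (\<Sum>a\<in>D. cnth f a * fps_nth (?E a) i) * (\<Sum>b\<in>D. cnth g b * fps_nth (?E b) (n - i)))"
    unfolding fps_mult_nth D_def by (intro sum.cong refl) (simp add: arc_nth[of _ n])
  also have "\<dots> = (\<Sum>i=0..n. \<Sum>a\<in>D. \<Sum>b\<in>D. cnth f a * cnth g b * (fps_nth (?E a) i * fps_nth (?E b) (n - i)))"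
    by (simp add: sum_product algebra_simps)
  also have "\<dots> = (\<Sum>a\<in>D. \<Sum>b\<in>D. \<Sum>i=0..n. cnth f a * cnth g b * (fps_nth (?E a) i * fps_nth (?E b) (n - i)))"
    by (subst sum.swap, intro sum.cong refl, subst sum.swap) simp
  also have "\<dots> = (\<Sum>a\<in>D. \<Sum>b\<in>D. cnth f a * cnth g b * fps_nth (?E (\<lambda>x. a x + b x)) n)"
    by (simp add: arcmon_add fps_mult_nth sum_distrib_left)
  also have "\<dots> = (\<Sum>(a,b)\<in>D \<times> D. cnth f a * cnth g b * fps_nth (?E (\<lambda>x. a x + b x)) n)"
    by (rule sum.cartesian_product)
  \<comment> \<open>A pair whose sum is heavier than \<open>n\<close> contributes nothing, since its
    monomial has order above \<open>n\<close>.\<close>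
  also have "\<dots> = (\<Sum>(a,b)\<in>{(a,b). (a,b) \<in> D \<times> D \<and> (\<lambda>x. a x + b x) \<in> D}. cnth f a * cnth g b * fps_nth (?E (\<lambda>x. a x + b x)) n)"
    by (rule sum.mono_neutral_right) (use D in \<open>auto simp: D_def arcmon_nth exps_add split: if_splits\<close>)
  also have "\<dots> = (\<Sum>(m,a)\<in>(SIGMA m:D. {a. a \<le> m}). cnth f a * cnth g (m - a) * fps_nth (?E m) n)"
  proof (rule sum.reindex_bij_witness[where i = "\<lambda>(m,a). (a, m - a)" and j = "\<lambda>(a,b). (\<lambda>x. a x + b x, a)"])
    fix p assume "p \<in> {(a,b). (a,b) \<in> D \<times> D \<and> (\<lambda>x. a x + b x) \<in> D}"
    then obtain a b where p: "p = (a,b)" "a \<in> D" "b \<in> D" "(\<lambda>x. a x + b x) \<in> D" by auto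
    have "(\<lambda>x. a x + b x) - a = b" by (simp add: fun_eq_iff)
    then show "(case case p of (a, b) \<Rightarrow> (\<lambda>x. a x + b x, a) of (m, a) \<Rightarrow> (a, m - a)) = p"
      "(case case p of (a, b) \<Rightarrow> (\<lambda>x. a x + b x, a) of (m, a) \<Rightarrow> cnth f a * cnth g (m - a) * fps_nth (?E m) n) =
         (case p of (a, b) \<Rightarrow> cnth f a * cnth g b * fps_nth (?E (\<lambda>x. a x + b x)) n)"
      unfolding p(1) by simp_all
    show "(case p of (a, b) \<Rightarrow> (\<lambda>x. a x + b x, a)) \<in> (SIGMA m:D. {a. a \<le> m})"
      unfolding p(1) using p(4) by (simp add: le_fun_def)
  next
    fix q assume "q \<in> (SIGMA m:D. {a. a \<le> m})"
    then obtain m a where q: "q = (m,a)" "m \<in> D" "a \<le> m" by auto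
    have m: "(\<lambda>x. a x + (m - a) x) = m" using q(3) by (auto simp: le_fun_def)
    show "(case case q of (m, a) \<Rightarrow> (a, m - a) of (a, b) \<Rightarrow> (\<lambda>x. a x + b x, a)) = q"
      unfolding q(1) using m by simp
    show "(case q of (m, a) \<Rightarrow> (a, m - a)) \<in> {(a,b). (a,b) \<in> D \<times> D \<and> (\<lambda>x. a x + b x) \<in> D}"
      unfolding q(1) using m le_D[OF q(2,3)] q(2) by simp
  qed
  also have "\<dots> = (\<Sum>m\<in>D. \<Sum>a\<in>{a. a \<le> m}. cnth f a * cnth g (m - a) * fps_nth (?E m) n)"
    using D finD by (intro sum.Sigma[symmetric]) auto
  also have "\<dots> = fps_nth (arc L \<omega> y (f * g)) n"
    unfolding arc_nth[OF order_refl] D_def[symmetric] cnth_mult_eq sum_distrib_right ..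
  finally show "fps_nth (arc L \<omega> y (f * g)) n = fps_nth (arc L \<omega> y f * arc L \<omega> y g) n" by simp
qed

text \<open>Substitution is multiplicative, so the series vanishing along the arc to order
  \<open>k\<close> form an ideal.\<close>

lemma arc_span_vanish:
  assumes "f \<in> cs_ideal.span G" "\<And>g n. g \<in> G \<Longrightarrow> n < k \<Longrightarrow> fps_nth (arc L \<omega> y g) n = 0" "n < k"
  shows "fps_nth (arc L \<omega> y f) n = 0"
proof -
  obtain t r where t: "t \<subseteq> G" "f = (\<Sum>a\<in>t. r a * a)" using assms(1) unfolding cs_ideal.span_explicit by blast
  have "fps_nth (arc L \<omega> y (r a * a)) n = 0" if "a \<in> t" for a
    unfolding arc_mult fps_mult_nth using assms(2)[of a] that t(1) assms(3)
    by (intro sum.neutral) (auto intro!: disjI2)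
  then show ?thesis unfolding t(2) arc_sum fps_sum_nth by (intro sum.neutral) blast
qed

lemma arc_nth_low:
  assumes "\<And>m. m \<in> exps L \<Longrightarrow> cnth f m \<noteq> 0 \<Longrightarrow> n < nwt L \<omega> m"
  shows "fps_nth (arc L \<omega> y f) n = 0"
  unfolding arc_nth[OF order_refl] by (rule sum.neutral) (use assms in \<open>fastforce simp: arcmon_nth\<close>)

lemma arc_nth_lead:
  assumes "\<And>m. m \<in> exps L \<Longrightarrow> cnth f m \<noteq> 0 \<Longrightarrow> n \<le> nwt L \<omega> m"
  shows "fps_nth (arc L \<omega> y f) n =
    (\<Sum>m\<in>{m \<in> exps L. nwt L \<omega> m = n}. cnth f m * (\<Prod>x\<in>L. fps_nth (y x) 0 ^ m x))"
proof -
  have "nwt L \<omega> m = n" if "m \<in> exps L" "nwt L \<omega> m \<le> n" "cnth f m \<noteq> 0" for m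
    using assms[OF that(1,3)] that(2) by linarith
  then have "fps_nth (arc L \<omega> y f) n = (\<Sum>m\<in>{m \<in> exps L. nwt L \<omega> m = n}. cnth f m * fps_nth (arcmon L \<omega> y m) n)"
    unfolding arc_nth[OF order_refl]
    using finite_nwt_le[OF L \<omega>, of _ n] by (intro sum.mono_neutral_right) auto
  then show ?thesis by (simp add: arcmon_nth ymon_nth_0)
qed

text \<open>First order expansion of a monomial in the parameter \<open>fps_X ^ k\<close>: the
  linear coefficient is the logarithmic differential, the pairing of \<open>m\<close> with
  \<open>\<xi>\<close>.\<close>

lemma ymon_perturb:
  assumes k: "k > 0"
  shows "\<exists>q. ymon L (\<lambda>x. y x * (1 + fps_const (\<xi> x) * fps_X ^ k)) m =
    ymon L y m * (1 + fps_const (\<Sum>x\<in>L. of_nat (m x) * \<xi> x) * fps_X ^ k + fps_X ^ Suc k * q)"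
proof -
  define X :: "complex fps" where "X = fps_X ^ k"
  have mul: "\<exists>q. (1 + fps_const s * X + fps_X ^ Suc k * q1) * (1 + fps_const t * X + fps_X ^ Suc k * q2)
      = 1 + fps_const (s + t) * X + fps_X ^ Suc k * q" for s t q1 q2
  proof -
    obtain j where j: "k = Suc j" using k gr0_implies_Suc by blast
    \<comment> \<open>Positivity of \<open>k\<close> enters here: the square of the parameter has
      order at least \<open>k + 1\<close>.\<close>
    have XX: "X * X = fps_X ^ Suc k * fps_X ^ j" unfolding X_def j by (simp add: power_add[symmetric])
    have "(1 + fps_const s * X + fps_X ^ Suc k * q1) * (1 + fps_const t * X + fps_X ^ Suc k * q2)
      = 1 + (fps_const s + fps_const t) * X + fps_const s * fps_const t * (X * X) + fps_X ^ Suc k *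
         (q1 + q2 + fps_const s * X * q2 + fps_const t * X * q1 + q1 * q2 * fps_X ^ Suc k)"
      by (simp only: algebra_simps mult_1_left mult_1_right)
    also have "\<dots> = 1 + fps_const (s + t) * X + fps_X ^ Suc k *
         (fps_const s * fps_const t * fps_X ^ j + q1 + q2 + fps_const s * X * q2 + fps_const t * X * q1 + q1 * q2 * fps_X ^ Suc k)"
      unfolding XX fps_const_add[symmetric] by (simp only: algebra_simps)
    finally show ?thesis by blast
  qed
  have pw: "\<exists>q. (1 + fps_const s * X) ^ i = 1 + fps_const (of_nat i * s) * X + fps_X ^ Suc k * q" for s i
  proof (induction i)
    case 0
    then show ?case by (intro exI[of _ 0]) simp
  next
    case (Suc i)
    then obtain q where q: "(1 + fps_const s * X) ^ i = 1 + fps_const (of_nat i * s) * X + fps_X ^ Suc k * q" by blast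
    obtain q' where "(1 + fps_const s * X + fps_X ^ Suc k * 0) * (1 + fps_const (of_nat i * s) * X + fps_X ^ Suc k * q)
      = 1 + fps_const (s + of_nat i * s) * X + fps_X ^ Suc k * q'" using mul by blast
    then show ?case unfolding power_Suc q by (intro exI[of _ q']) (simp add: algebra_simps)
  qed
  have "\<exists>q. (\<Prod>x\<in>A. (1 + fps_const (\<xi> x) * X) ^ m x) =
    1 + fps_const (\<Sum>x\<in>A. of_nat (m x) * \<xi> x) * X + fps_X ^ Suc k * q" if "finite A" for A
    using that
  proof (induction A)
    case empty
    then show ?case by (intro exI[of _ 0]) simp
  next
    case (insert a A)
    obtain q where q: "(\<Prod>x\<in>A. (1 + fps_const (\<xi> x) * X) ^ m x) =
      1 + fps_const (\<Sum>x\<in>A. of_nat (m x) * \<xi> x) * X + fps_X ^ Suc k * q" using insert.IH by blast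
    obtain q' where q': "(1 + fps_const (\<xi> a) * X) ^ m a = 1 + fps_const (of_nat (m a) * \<xi> a) * X + fps_X ^ Suc k * q'"
      using pw by blast
    show ?case unfolding prod.insert[OF insert.hyps] sum.insert[OF insert.hyps] q q' by (rule mul)
  qed
  from this[OF L] obtain q where "(\<Prod>x\<in>L. (1 + fps_const (\<xi> x) * X) ^ m x) =
    1 + fps_const (\<Sum>x\<in>L. of_nat (m x) * \<xi> x) * X + fps_X ^ Suc k * q" by blast
  then show ?thesis
    unfolding ymon_def power_mult_distrib prod.distrib X_def by (intro exI[of _ q]) simp
qed

text \<open>If all terms of \<open>f\<close> have weight at least \<open>W\<close>, perturbing
  \<open>y\<close> in relative order \<open>k\<close> is first felt at order \<open>W + k\<close>,
  and there only through the terms of weight exactly \<open>W\<close>. This is the derivative used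
  in the lifting.\<close>

lemma arc_perturb:
  assumes k: "k > 0" and W: "\<And>m. m \<in> exps L \<Longrightarrow> cnth f m \<noteq> 0 \<Longrightarrow> W \<le> nwt L \<omega> m" and n: "n \<le> W + k"
  shows "fps_nth (arc L \<omega> (\<lambda>x. y x * (1 + fps_const (\<xi> x) * fps_X ^ k)) f) n = fps_nth (arc L \<omega> y f) n +
    (if n = W + k then \<Sum>m\<in>{m \<in> exps L. nwt L \<omega> m = W}.
       cnth f m * (\<Prod>x\<in>L. fps_nth (y x) 0 ^ m x) * (\<Sum>x\<in>L. of_nat (m x) * \<xi> x) else 0)"
proof -
  let ?y = "\<lambda>x. y x * (1 + fps_const (\<xi> x) * fps_X ^ k)"
  define s where "s m = (\<Sum>x\<in>L. of_nat (m x) * \<xi> x)" for m :: "'v \<Rightarrow> nat"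
  have step: "fps_nth (ymon L ?y m) i = fps_nth (ymon L y m) i + (if i = k then fps_nth (ymon L y m) 0 * s m else 0)"
    if i: "i \<le> k" for m i
  proof -
    obtain q where "ymon L ?y m = ymon L y m * (1 + fps_const (s m) * fps_X ^ k + fps_X ^ Suc k * q)"
      unfolding s_def using ymon_perturb[OF k] by blast
    then have "ymon L ?y m = ymon L y m + fps_X ^ k * (fps_const (s m) * ymon L y m) + fps_X ^ Suc k * (q * ymon L y m)"
      by (simp add: algebra_simps)
    then show ?thesis using i
      by (auto simp: fps_X_power_mult_nth simp del: power_Suc)
  qed
  define D where "D = {m \<in> exps L. nwt L \<omega> m \<le> W + k}"
  have D: "finite D" unfolding D_def by (rule finite_nwt_le[OF L \<omega>])
  have *: "cnth f m * fps_nth (arcmon L \<omega> ?y m) n = cnth f m * fps_nth (arcmon L \<omega> y m) n +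
      (if n = W + k \<and> nwt L \<omega> m = W then cnth f m * fps_nth (ymon L y m) 0 * s m else 0)" if m: "m \<in> D" for m
  proof (cases "cnth f m = 0 \<or> n < nwt L \<omega> m")
    case True
    then show ?thesis by (auto simp: arcmon_nth)
  next
    case False
    then have "W \<le> nwt L \<omega> m" using W m by (auto simp: D_def)
    then have "n - nwt L \<omega> m \<le> k" and "n - nwt L \<omega> m = k \<longleftrightarrow> n = W + k \<and> nwt L \<omega> m = W"
      using n False by auto
    then show ?thesis using False step[of "n - nwt L \<omega> m" m] by (auto simp: arcmon_nth algebra_simps)
  qed
  have "fps_nth (arc L \<omega> ?y f) n = fps_nth (arc L \<omega> y f) n +
     (\<Sum>m\<in>D. if n = W + k \<and> nwt L \<omega> m = W then cnth f m * fps_nth (ymon L y m) 0 * s m else 0)"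
    unfolding arc_nth[OF n] D_def[symmetric] sum.distrib[symmetric] by (rule sum.cong[OF refl *])
  also have "(\<Sum>m\<in>D. if n = W + k \<and> nwt L \<omega> m = W then cnth f m * fps_nth (ymon L y m) 0 * s m else 0) =
    (if n = W + k then \<Sum>m\<in>{m \<in> exps L. nwt L \<omega> m = W}. cnth f m * fps_nth (ymon L y m) 0 * s m else 0)"
  proof (cases "n = W + k")
    case True
    have "(\<Sum>m\<in>D. if n = W + k \<and> nwt L \<omega> m = W then cnth f m * fps_nth (ymon L y m) 0 * s m else 0) =
      (\<Sum>m\<in>{m \<in> exps L. nwt L \<omega> m = W}. if n = W + k \<and> nwt L \<omega> m = W then cnth f m * fps_nth (ymon L y m) 0 * s m else 0)"
      by (rule sum.mono_neutral_right[OF D]) (auto simp: D_def)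
    then show ?thesis using True by (auto intro: sum.cong)
  qed simp
  finally show ?thesis unfolding s_def ymon_nth_0 .
qed

end

section \<open>Trees\<close>

locale tree =
  fixes V :: "'v set" and adj :: "'v \<Rightarrow> 'v \<Rightarrow> bool"
  assumes is_tree: "is_tree V adj"
begin

lemmas tree_unf = is_tree[unfolded is_tree_def]
lemmas finite_V = tree_unf[THEN conjunct1]
lemmas adj_props = tree_unf[THEN conjunct2, THEN conjunct2, THEN conjunct1, rule_format]
lemmas ex1_path = tree_unf[THEN conjunct2, THEN conjunct2, THEN conjunct2, rule_format]

lemma adj_V: "adj x y \<Longrightarrow> x \<in> V" "adj x y \<Longrightarrow> y \<in> V"
  and adj_neq: "adj x y \<Longrightarrow> x \<noteq> y" and adj_sym: "adj x y \<Longrightarrow> adj y x"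
  by (drule adj_props, elim conjE, assumption)+

lemma adj_irrefl [simp]: "\<not> adj x x"
  using adj_neq[of x x] by blast

lemma finite_nbrs: "finite (nbrs adj v)"
  by (rule finite_subset[OF _ finite_V]) (auto simp: nbrs_def dest: adj_V)

definition tpath :: "'v \<Rightarrow> 'v \<Rightarrow> 'v list" where
  "tpath u v = (THE p. gpath adj u v p)"

lemma geod_tpath: "geod adj u v = set (tpath u v)"
  by (simp add: geod_def tpath_def)

lemma tpath: "u \<in> V \<Longrightarrow> v \<in> V \<Longrightarrow> gpath adj u v (tpath u v)"
  unfolding tpath_def by (rule theI'[OF ex1_path])

lemma tpath_eqI: "u \<in> V \<Longrightarrow> v \<in> V \<Longrightarrow> gpath adj u v p \<Longrightarrow> tpath u v = p"
  unfolding tpath_def by (rule the1_equality[OF ex1_path])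

lemma gpath_Cons:
  assumes "gpath adj b y p" "adj a b" "a \<notin> set p"
  shows "gpath adj a y (a # p)"
  unfolding gpath_def
proof (intro conjI allI impI)
  fix i assume i: "Suc i < length (a # p)"
  show "adj ((a # p) ! i) ((a # p) ! Suc i)"
  proof (cases i)
    case 0
    then show ?thesis using assms by (auto simp: gpath_def hd_conv_nth)
  next
    case (Suc j)
    then show ?thesis using i assms by (auto simp: gpath_def)
  qed
qed (use assms in \<open>auto simp: gpath_def\<close>)

lemma gpath_suffix:
  assumes "gpath adj u y (p @ a # q)"
  shows "gpath adj a y (a # q)"
  unfolding gpath_def
proof (intro conjI allI impI)
  fix i assume i: "Suc i < length (a # q)"
  have "\<forall>j. Suc j < length (p @ a # q) \<longrightarrow> adj ((p @ a # q) ! j) ((p @ a # q) ! Suc j)"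
    using assms unfolding gpath_def by blast
  from this[rule_format, of "length p + i"] i
  have "adj ((p @ a # q) ! (length p + i)) ((p @ a # q) ! Suc (length p + i))" by simp
  then show "adj ((a # q) ! i) ((a # q) ! Suc i)"
    by (metis add_Suc_right nth_append_length_plus)
qed (use assms in \<open>auto simp: gpath_def\<close>)

lemma gpath_rev:
  assumes "gpath adj u v p"
  shows "gpath adj v u (rev p)"
  unfolding gpath_def
proof (intro conjI allI impI)
  fix i assume i: "Suc i < length (rev p)"
  have "adj (p ! (length p - Suc (Suc i))) (p ! Suc (length p - Suc (Suc i)))"
    using assms i unfolding gpath_def by auto
  moreover have "Suc (length p - Suc (Suc i)) = length p - Suc i" using i by auto
  ultimately show "adj (rev p ! i) (rev p ! Suc i)"
    using i by (simp add: rev_nth adj_sym)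
qed (use assms in \<open>auto simp: gpath_def hd_rev last_rev\<close>)

lemma geod_sym: "u \<in> V \<Longrightarrow> v \<in> V \<Longrightarrow> geod adj u v = geod adj v u"
  unfolding geod_tpath by (subst tpath_eqI[OF _ _ gpath_rev[OF tpath], of v u]) auto

lemma tpath_self: "u \<in> V \<Longrightarrow> tpath u u = [u]"
  by (rule tpath_eqI) (auto simp: gpath_def)

lemma tpath_not_Nil: "u \<in> V \<Longrightarrow> v \<in> V \<Longrightarrow> tpath u v \<noteq> [] \<and> hd (tpath u v) = u \<and> last (tpath u v) = v"
  using tpath unfolding gpath_def by blast

lemma geod_self: "u \<in> V \<Longrightarrow> geod adj u u = {u}"
  by (simp add: geod_tpath tpath_self)

lemma geod_ends:
  assumes "u \<in> V" "v \<in> V"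
  shows "u \<in> geod adj u v" "v \<in> geod adj u v"
  using tpath_not_Nil[OF assms] hd_in_set[of "tpath u v"] last_in_set[of "tpath u v"]
  unfolding geod_tpath by simp_all

text \<open>By uniqueness of paths there are two cases: either \<open>a\<close> is not on the path
  from \<open>b\<close> and can be put in front of it, or it is, and then the path from
  \<open>a\<close> is a final piece that avoids \<open>b\<close>.\<close>

lemma tpath_adj:
  assumes ab: "adj a b" and y: "y \<in> V"
  shows "(tpath a y = a # tpath b y \<and> a \<notin> set (tpath b y)) \<or> (tpath b y = b # tpath a y \<and> b \<notin> set (tpath a y))"
proof (cases "a \<in> set (tpath b y)")
  case False
  have "gpath adj a y (a # tpath b y)" by (rule gpath_Cons[OF tpath[OF adj_V(2)[OF ab] y] ab False])
  then show ?thesis using tpath_eqI[OF adj_V(1)[OF ab] y] False by simp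
next
  case True
  obtain p q where pq: "tpath b y = p @ a # q" using split_list[OF True] by (elim exE)
  have b: "gpath adj b y (p @ a # q)" using tpath[OF adj_V(2)[OF ab] y] unfolding pq .
  have a: "tpath a y = a # q" by (rule tpath_eqI[OF adj_V(1)[OF ab] y gpath_suffix[OF b]])
  have "hd (p @ a # q) = b" using b unfolding gpath_def by (elim conjE)
  then obtain r where r: "p = b # r" using adj_neq[OF ab] by (cases p) auto
  have "distinct (p @ a # q)" using b unfolding gpath_def by (elim conjE)
  then have nb: "b \<notin> set (a # q)" unfolding r by auto
  have "gpath adj b y (b # a # q)" by (rule gpath_Cons[OF gpath_suffix[OF b] adj_sym[OF ab] nb])
  then have "tpath b y = b # a # q" by (rule tpath_eqI[OF adj_V(2)[OF ab] y])
  then show ?thesis using a nb by simp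
qed

text \<open>For adjacent \<open>a\<close> and \<open>b\<close>, the component of \<open>b\<close>
  after the edge is removed. The recursive arguments about subtrees use its cardinality.\<close>

definition side :: "'v \<Rightarrow> 'v \<Rightarrow> 'v set" where
  "side a b = {y \<in> V. b \<in> geod adj a y}"

lemma finite_side: "finite (side a b)"
  using finite_V by (simp add: side_def)

lemma side_cases:
  assumes ab: "adj a b" "y \<in> V"
  shows "(tpath a y = a # tpath b y \<and> a \<notin> set (tpath b y) \<and> b \<in> set (tpath a y)) \<or>
    (tpath b y = b # tpath a y \<and> b \<notin> set (tpath a y) \<and> a \<in> set (tpath b y))"
proof -
  have 1: "b \<in> set (tpath a y)" if "tpath a y = a # tpath b y"
    unfolding that using geod_ends(1)[OF adj_V(2)[OF ab(1)] ab(2)] by (simp add: geod_tpath)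
  have 2: "a \<in> set (tpath b y)" if "tpath b y = b # tpath a y"
    unfolding that using geod_ends(1)[OF adj_V(1)[OF ab(1)] ab(2)] by (simp add: geod_tpath)
  show ?thesis using tpath_adj[OF ab] 1 2 by blast
qed

lemma side_iff:
  assumes ab: "adj a b" "y \<in> V"
  shows "y \<in> side a b \<longleftrightarrow> tpath a y = a # tpath b y \<and> a \<notin> set (tpath b y)"
  using side_cases[OF ab] ab(2) unfolding side_def geod_tpath mem_Collect_eq by blast

lemma side_opposite:
  assumes ab: "adj a b" "y \<in> V"
  shows "y \<in> side b a \<longleftrightarrow> y \<notin> side a b"
  using side_cases[OF ab] ab(2) unfolding side_def geod_tpath mem_Collect_eq by blast

lemma side_memV: "y \<in> side a b \<Longrightarrow> y \<in> V"
  by (simp add: side_def)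

lemma geod_side:
  assumes "adj a b" "y \<in> side a b"
  shows "geod adj a y = insert a (geod adj b y)" "a \<notin> geod adj b y"
proof -
  have *: "tpath a y = a # tpath b y" "a \<notin> set (tpath b y)"
    using side_iff[OF assms(1) side_memV[OF assms(2)]] assms(2) by blast+
  show "geod adj a y = insert a (geod adj b y)" unfolding geod_tpath *(1) by simp
  show "a \<notin> geod adj b y" unfolding geod_tpath by (rule *(2))
qed

lemma side_self: "adj a b \<Longrightarrow> b \<in> side a b"
  unfolding side_def by (intro CollectI conjI geod_ends(2)) (drule adj_V, assumption)+

lemma not_in_side: "adj a b \<Longrightarrow> a \<notin> side a b"
  using geod_self[OF adj_V(1), of a b] adj_neq[of a b] by (auto simp: side_def)

lemma ex_side:
  assumes "a \<in> V" "y \<in> V" "y \<noteq> a"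
  shows "\<exists>b. adj a b \<and> y \<in> side a b"
proof -
  have g: "gpath adj a y (tpath a y)" by (rule tpath[OF assms(1,2)])
  note nn = tpath_not_Nil[OF assms(1,2)]
  obtain q where q: "tpath a y = a # q" using nn by (cases "tpath a y") auto
  obtain b r where r: "q = b # r" using nn assms(3) unfolding q by (cases q) auto
  have p: "tpath a y = a # b # r" using q r by simp
  have "\<forall>i. Suc i < length (tpath a y) \<longrightarrow> adj (tpath a y ! i) (tpath a y ! Suc i)"
    using g unfolding gpath_def by (elim conjE)
  from this[rule_format, of 0] have "adj a b" by (simp add: p)
  moreover have "y \<in> side a b" using assms by (simp add: side_def geod_tpath p)
  ultimately show ?thesis by (intro exI conjI)
qed

lemma side_unique:
  assumes "adj a b" "adj a c" "y \<in> side a b" "y \<in> side a c"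
  shows "b = c"
proof -
  have y: "y \<in> V" by (rule side_memV[OF assms(3)])
  have "tpath a y = a # tpath b y" "tpath a y = a # tpath c y"
    using assms side_iff[OF assms(1) y] side_iff[OF assms(2) y] by blast+
  from trans[OF this(1)[symmetric] this(2)] have e: "tpath b y = tpath c y" by (rule list.inject[THEN iffD1, THEN conjunct2])
  have "hd (tpath b y) = b" "hd (tpath c y) = c"
    using tpath_not_Nil[OF adj_V(2)[OF assms(1)] y] tpath_not_Nil[OF adj_V(2)[OF assms(2)] y] by blast+
  from this(1)[symmetric] show ?thesis unfolding e by (rule trans) fact
qed

lemma nbrs_geod:
  assumes ab: "adj a b" "y \<in> side a b"
  shows "nbrs adj a \<inter> geod adj a y = {b}"
proof (intro equalityI subsetI)
  fix x assume "x \<in> nbrs adj a \<inter> geod adj a y"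
  then have x: "adj a x" "y \<in> side a x" using side_memV[OF ab(2)] by (auto simp: nbrs_def side_def)
  show "x \<in> {b}" using side_unique[OF x(1) ab(1) x(2) ab(2)] by simp
next
  fix x assume "x \<in> {b}"
  then show "x \<in> nbrs adj a \<inter> geod adj a y" using ab by (simp add: nbrs_def side_def)
qed

lemma side_step:
  assumes "adj a b" "adj b c" "c \<noteq> a"
  shows "side b c \<subseteq> side a b"
proof
  fix y assume y: "y \<in> side b c"
  have "y \<notin> side b a" using side_unique[OF assms(2) adj_sym[OF assms(1)] y] assms(3) by blast
  then show "y \<in> side a b" using side_opposite[OF assms(1) side_memV[OF y]] by blast
qed

lemma side_rec:
  assumes ab: "adj a b"
  shows "side a b = insert b (\<Union>c\<in>nbrs adj b - {a}. side b c)"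
proof (intro equalityI subsetI)
  fix y assume h: "y \<in> side a b"
  show "y \<in> insert b (\<Union>c\<in>nbrs adj b - {a}. side b c)"
  proof (cases "y = b")
    case False
    obtain c where c: "adj b c" "y \<in> side b c"
      using ex_side[OF adj_V(2)[OF ab] side_memV[OF h] False] by (elim exE conjE)
    have "c \<noteq> a" using side_opposite[OF ab side_memV[OF h]] h c(2) by blast
    then show ?thesis using c by (auto simp: nbrs_def)
  qed simp
next
  fix y assume y: "y \<in> insert b (\<Union>c\<in>nbrs adj b - {a}. side b c)"
  show "y \<in> side a b"
  proof (cases "y = b")
    case True then show ?thesis using side_self[OF ab] by simp
  next
    case False
    then obtain c where "c \<noteq> a" "adj b c" "y \<in> side b c" using y by (auto simp: nbrs_def)
    then show ?thesis using side_step[OF ab] by blast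
  qed
qed

lemma card_side_step:
  assumes "adj a b" "adj b c" "c \<noteq> a"
  shows "card (side b c) < card (side a b)"
proof (rule psubset_card_mono[OF finite_side])
  show "side b c \<subset> side a b"
    using side_step[OF assms] side_self[OF assms(1)] not_in_side[OF assms(2)] by blast
qed

text \<open>An edge not touching \<open>s\<close> is not cut by the removal of \<open>s\<close>: the
  geodesics from its two ends to \<open>s\<close> differ only in one of these ends.\<close>

lemma same_side:
  assumes ab: "adj a b" and st: "adj s t" and "a \<noteq> s" "b \<noteq> s" and ast: "a \<in> side s t"
  shows "b \<in> side s t"
proof -
  have V: "a \<in> V" "b \<in> V" "s \<in> V" using adj_V[OF ab] adj_V[OF st] by simp_all
  have ta: "t \<in> geod adj a s" using ast geod_sym[OF V(1,3)] by (simp add: side_def)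
  have "t \<in> geod adj b s"
  proof (cases "s \<in> side a b")
    case True
    \<comment> \<open>Were \<open>t\<close> equal to \<open>a\<close>, the next vertex from
      \<open>a\<close> towards \<open>s\<close> would be \<open>s\<close> itself, but in this case
      it is \<open>b\<close>.\<close>
    have "t \<noteq> a"
    proof
      assume "t = a"
      have "nbrs adj a \<inter> geod adj a s = {s}"
        using nbrs_geod[OF adj_sym[OF st] side_self[OF adj_sym[OF st]]] unfolding \<open>t = a\<close> .
      moreover have "b \<in> nbrs adj a \<inter> geod adj a s" using True ab by (simp add: nbrs_def side_def)
      ultimately show False using assms(4) by simp
    qed
    then show ?thesis using geod_side(1)[OF ab True] ta by simp
  next
    case False
    then have "s \<in> side b a" using side_opposite[OF ab V(3)] by simp
    then show ?thesis using geod_side(1)[OF adj_sym[OF ab]] ta by simp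
  qed
  then show ?thesis using geod_sym[OF V(2,3)] V by (simp add: side_def)
qed

text \<open>Induction on the distance to \<open>s\<close>; in the step, \<open>a\<close> is the
  neighbour of \<open>b\<close> towards \<open>s\<close>, expressed by
  \<open>s \<in> side b a\<close>.\<close>

lemma side_induct [consumes 2, case_names base step]:
  assumes st: "adj s t" and y: "y \<in> side s t"
    and base: "P t"
    and step: "\<And>a b. adj a b \<Longrightarrow> a \<in> side s t \<Longrightarrow> b \<in> side s t \<Longrightarrow> s \<in> side b a \<Longrightarrow> P a \<Longrightarrow> P b"
  shows "P y"
  using y
proof (induction "card (geod adj y s)" arbitrary: y rule: less_induct)
  case less
  have V: "y \<in> V" "s \<in> V" using side_memV[OF less.prems] adj_V[OF st] by simp_all
  have ys: "s \<noteq> y" using less.prems not_in_side[OF st] by blast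
  obtain a where a: "adj y a" "s \<in> side y a" using ex_side[OF V ys] by (elim exE conjE)
  show ?case
  proof (cases "a = s")
    case True
    then have sy: "adj s y" using adj_sym[OF a(1)] by simp
    have "t = y" by (rule side_unique[OF st sy less.prems side_self[OF sy]])
    then show ?thesis using base by simp
  next
    case False
    have as: "a \<in> side s t" by (rule same_side[OF a(1) st ys[symmetric] False less.prems])
    have "card (geod adj a s) < card (geod adj y s)"
      unfolding geod_side(1)[OF a] using geod_side(2)[OF a] by (simp add: geod_tpath)
    then have "P a" using as by (rule less.hyps)
    then show ?thesis by (rule step[OF adj_sym[OF a(1)] as less.prems a(2)])
  qed
qed

text \<open>A path leaving the subtree must pass through \<open>s\<close>, so from \<open>b\<close>
  everything outside is seen in the direction of \<open>s\<close>.\<close>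

lemma side_outside:
  assumes st: "adj s t" and b: "b \<in> side s t" and ba: "adj b a" "s \<in> side b a"
  shows "V - side s t \<subseteq> side b a"
proof -
  have "\<forall>a. adj b a \<longrightarrow> s \<in> side b a \<longrightarrow> V - side s t \<subseteq> side b a"
    using st b
  proof (induction rule: side_induct)
    case base
    show ?case
    proof (intro allI impI)
      fix a assume a: "adj t a" "s \<in> side t a"
      have "a = s" by (rule side_unique[OF a(1) adj_sym[OF st] a(2) side_self[OF adj_sym[OF st]]])
      then show "V - side s t \<subseteq> side t a" using side_opposite[OF st] by blast
    qed
  next
    case (step a b)
    show ?case
    proof (intro allI impI)
      fix a' assume a': "adj b a'" "s \<in> side b a'"
      have eq: "a' = a" by (rule side_unique[OF a'(1) adj_sym[OF step(1)] a'(2) step(4)])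
      have sa: "s \<noteq> a" using not_in_side[OF st] step(2) by blast
      obtain c where c: "adj a c" "s \<in> side a c"
        using ex_side[OF adj_V(1)[OF step(1)] adj_V(1)[OF st] sa] by (elim exE conjE)
      have "c \<noteq> b" using c(2) step(4) side_opposite[OF step(1) adj_V(1)[OF st]] by blast
      then have "side a c \<subseteq> side b a" by (rule side_step[OF adj_sym[OF step(1)] c(1)])
      moreover have "V - side s t \<subseteq> side a c" using step(5) c by blast
      ultimately show "V - side s t \<subseteq> side b a'" unfolding eq by blast
    qed
  qed
  then show ?thesis using ba by blast
qed

section \<open>Leaves, and the leaves beyond an edge\<close>

lemma leaf_nbr:
  assumes "u \<in> leaves V adj" "adj u v"
  shows "nbrs adj u = {v}"
proof -
  obtain x where "nbrs adj u = {x}"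
    using assms(1) unfolding leaves_def valency_def by (auto simp: card_1_singleton_iff)
  moreover have "v \<in> nbrs adj u" using assms(2) by (simp add: nbrs_def)
  ultimately show ?thesis by simp
qed

lemma side_leaf: "adj v u \<Longrightarrow> u \<in> leaves V adj \<Longrightarrow> side v u = {u}"
  using side_rec[of v u] leaf_nbr[of u v] adj_sym[of v u] by simp

lemma leaves_beyond_side: "adj v u \<Longrightarrow> leaves_beyond V adj v u = leaves V adj \<inter> side v u"
  using geod_ends(1)[OF adj_V(1), of v u] by (auto simp: leaves_beyond_def side_def leaves_def)

lemma finite_leaves: "finite (leaves V adj)"
  using finite_V by (simp add: leaves_def)

lemma leaves_V: "leaves V adj \<subseteq> V"
  by (auto simp: leaves_def)

lemma ex_leaf_side: "adj a b \<Longrightarrow> leaves V adj \<inter> side a b \<noteq> {}"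
proof (induction "card (side a b)" arbitrary: a b rule: less_induct)
  case less
  show ?case
  proof (cases "nbrs adj b = {a}")
    case True
    then have "b \<in> leaves V adj" using adj_V(2)[OF less.prems] by (simp add: leaves_def valency_def)
    then show ?thesis using side_self[OF less.prems] by blast
  next
    case False
    then obtain c where c: "adj b c" "c \<noteq> a" using adj_sym[OF less.prems] by (auto simp: nbrs_def)
    show ?thesis using less.hyps[OF card_side_step[OF less.prems c] c(1)] side_step[OF less.prems c] by blast
  qed
qed

end

section \<open>Splice diagrams\<close>

locale splice =
  fixes V :: "'v set" and adj :: "'v \<Rightarrow> 'v \<Rightarrow> bool" and d :: "'v \<Rightarrow> 'v \<Rightarrow> nat"
  assumes sd: "splice_diagram V adj d" and ed: "edge_determinant V adj d"
begin

sublocale tree V adj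
  using sd unfolding splice_diagram_def by unfold_locales (elim conjE)

abbreviation "L \<equiv> leaves V adj"
abbreviation "N \<equiv> nodes V adj"
abbreviation "l \<equiv> ell V adj d"
abbreviation "wv \<equiv> wvec V adj d"

lemma node_V: "u \<in> N \<Longrightarrow> u \<in> V" and node_not_leaf: "u \<in> N \<Longrightarrow> u \<notin> L"
  and nodeI: "u \<in> V \<Longrightarrow> u \<notin> L \<Longrightarrow> u \<in> N"
  by (auto simp: nodes_def)

lemma ex_branch: "\<exists>v\<in>V. valency adj v \<ge> 3" and val2: "v \<in> V \<Longrightarrow> valency adj v \<noteq> 2"
  and d_pos: "v \<in> N \<Longrightarrow> adj v u \<Longrightarrow> d v u > 0"
  using sd unfolding splice_diagram_def nbrs_def by blast+

lemma leaf_valency: "u \<in> L \<Longrightarrow> valency adj u = 1"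
  by (simp add: leaves_def)

text \<open>Nodes are merely the vertices that are not leaves, so valency 0 must be excluded as
  well: a path leads to the vertex of valency at least 3.\<close>

lemma node_valency: "v \<in> N \<Longrightarrow> valency adj v \<ge> 3"
proof -
  assume v: "v \<in> N"
  obtain b where b: "b \<in> V" "valency adj b \<ge> 3" using ex_branch by blast
  have "valency adj v \<noteq> 0"
  proof (cases "b = v")
    case False
    obtain c where "adj v c" using ex_side[OF node_V[OF v] b(1) False] by blast
    then have "c \<in> nbrs adj v" by (simp add: nbrs_def)
    then show ?thesis using finite_nbrs[of v] unfolding valency_def by auto
  qed (use b in simp)
  moreover have "valency adj v \<noteq> 1" using v by (auto simp: nodes_def leaves_def)
  moreover have "valency adj v \<noteq> 2" using val2[OF node_V[OF v]] .
  ultimately show ?thesis by linarith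
qed

text \<open>Two adjacent leaves would be the whole tree, leaving no place for a vertex of valency at
  least 3.\<close>

lemma leaf_nbr_node:
  assumes u: "u \<in> L" and uv: "adj u v"
  shows "v \<in> N"
proof (rule nodeI[OF adj_V(2)[OF uv]], rule notI)
  assume v: "v \<in> L"
  have 1: "side v u = {u}" "side u v = {v}" using side_leaf[OF uv v] side_leaf[OF adj_sym[OF uv] u] by simp_all
  obtain b where b: "b \<in> V" "valency adj b \<ge> 3" using ex_branch by blast
  have "b = u \<or> b = v" using side_opposite[OF uv b(1)] 1 by blast
  then show False using b(2) leaf_valency[OF u] leaf_valency[OF v] by auto
qed

lemma dv_pos: "v \<in> N \<Longrightarrow> dv adj d v > 0"
  unfolding dv_def by (rule prod_pos) (auto simp: nbrs_def d_pos)

text \<open>The separate convention for \<open>u = y\<close> agrees with the general product,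
  because a one-point geodesic contains no edge. Later proofs can thus treat both cases
  alike.\<close>

lemma ell_eq:
  assumes "u \<in> N"
  shows "l u y = (\<Prod>w\<in>N \<inter> geod adj u y. \<Prod>x\<in>nbrs adj w - geod adj u y. d w x)"
proof (cases "u = y")
  case True
  have "nbrs adj u - {u} = nbrs adj u" by (auto simp: nbrs_def)
  then show ?thesis using assms by (simp add: ell_def True[symmetric] geod_self[OF node_V[OF assms]] dv_def)
qed (simp add: ell_def)

lemma finite_N_geod: "finite (N \<inter> S)"
  using finite_V by (simp add: nodes_def)

lemma ell_pos: "u \<in> N \<Longrightarrow> l u y > 0"
  unfolding ell_eq by (intro prod_pos) (auto simp: nbrs_def d_pos)

lemma ell_self: "l u u = dv adj d u"
  by (simp add: ell_def)

lemma prod_nbrs_minus: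
  assumes "adj v u"
  shows "d v u * (\<Prod>x\<in>nbrs adj v - {u}. d v x) = dv adj d v"
  unfolding dv_def using prod.remove[OF finite_nbrs, of u v "d v"] assms by (simp add: nbrs_def)

text \<open>The products over \<open>[v,y]\<close> and \<open>[u,y]\<close> differ only at
  \<open>v\<close> and \<open>u\<close>: at \<open>v\<close> all weights but \<open>d v u\<close>
  come in, and at \<open>u\<close> the weight \<open>d u v\<close> drops out because its edge now
  lies on the geodesic.\<close>

lemma ell_step:
  assumes v: "v \<in> N" and u: "u \<in> N" and vu: "adj v u" and y: "y \<in> side v u"
  shows "l v y * (d v u * d u v) = dv adj d v * l u y"
proof -
  let ?g = "geod adj u y"
  note g = geod_side[OF vu y]
  have yV: "y \<in> V" by (rule side_memV[OF y])
  have ug: "u \<in> ?g" by (rule geod_ends(1)[OF node_V[OF u] yV])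
  have n1: "nbrs adj v - geod adj v y = nbrs adj v - {u}" using nbrs_geod[OF vu y] by blast
  \<comment> \<open>No other vertex of \<open>[u,y]\<close> is adjacent to \<open>v\<close>, so at
    the remaining nodes the edges off the geodesic are unchanged.\<close>
  have adjv: "w = u" if "w \<in> ?g" "adj w v" for w
  proof -
    have "w \<in> nbrs adj v \<inter> geod adj v y" using that g(1) adj_sym[OF that(2)] by (simp add: nbrs_def)
    then show ?thesis using nbrs_geod[OF vu y] by simp
  qed
  define f where "f w = (\<Prod>x\<in>nbrs adj w - geod adj v y. d w x)" for w
  define h where "h w = (\<Prod>x\<in>nbrs adj w - ?g. d w x)" for w
  have fh: "f w = h w" if "w \<in> N \<inter> ?g - {u}" for w
  proof -
    have "nbrs adj w - geod adj v y = nbrs adj w - ?g" using that adjv g(1) by (auto simp: nbrs_def)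
    then show ?thesis by (simp add: f_def h_def)
  qed
  have "v \<in> nbrs adj u - ?g" using vu g(2) adj_sym[OF vu] by (simp add: nbrs_def)
  moreover have "nbrs adj u - geod adj v y = (nbrs adj u - ?g) - {v}" unfolding g(1) by blast
  ultimately have hu: "h u = d u v * f u"
    unfolding h_def f_def using prod.remove[of "nbrs adj u - ?g" v "d u"] finite_nbrs by simp
  have split: "(\<Prod>w\<in>N \<inter> ?g. F w) = F u * (\<Prod>w\<in>N \<inter> ?g - {u}. F w)" for F :: "'v \<Rightarrow> nat"
    using prod.remove[OF finite_N_geod, of u ?g F] u ug by simp
  have "l v y = (\<Prod>w\<in>insert v (N \<inter> ?g). f w)"
    unfolding ell_eq[OF v] f_def using v g(1) by (intro prod.cong) auto
  also have "\<dots> = f v * (\<Prod>w\<in>N \<inter> ?g. f w)" using g(2) finite_N_geod by simp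
  also have "(\<Prod>w\<in>N \<inter> ?g. f w) = f u * (\<Prod>w\<in>N \<inter> ?g - {u}. h w)"
    unfolding split using fh by simp
  finally have 1: "l v y = f v * (f u * (\<Prod>w\<in>N \<inter> ?g - {u}. h w))" .
  have 2: "l u y = d u v * f u * (\<Prod>w\<in>N \<inter> ?g - {u}. h w)"
    unfolding ell_eq[OF u] h_def[symmetric] split hu ..
  have 3: "d v u * f v = dv adj d v" unfolding f_def n1 by (rule prod_nbrs_minus[OF vu])
  show ?thesis unfolding 1 2 3[symmetric] by (simp add: algebra_simps)
qed

section \<open>Weight vectors on the two sides of an edge\<close>

lemma wv_node: "u \<in> N \<Longrightarrow> x \<in> L \<Longrightarrow> wv u x = real (l u x)"
  by (simp add: wvec_def node_not_leaf)

lemma wv_leaf: "u \<in> L \<Longrightarrow> wv u x = (if x = u then 1 else 0)"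
  by (simp add: wvec_def)

lemma wv_off: "x \<notin> L \<Longrightarrow> wv u x = 0"
  by (auto simp: wvec_def)

lemma wv_nonneg: "wv u x \<ge> 0"
  by (simp add: wvec_def)

lemma wv_pos: "u \<in> N \<Longrightarrow> x \<in> L \<Longrightarrow> wv u x > 0"
  using ell_pos by (simp add: wv_node)

text \<open>The constant ratio of \<open>wv u\<close> to \<open>wv v\<close> on the leaves beyond
  \<open>v\<close>, by \<open>ell_q\<close>.\<close>

definition q :: "'v \<Rightarrow> 'v \<Rightarrow> real" where
  "q u v = real (dv adj d u) / (real (d u v) * real (d v u))"

lemma q_pos: "u \<in> N \<Longrightarrow> v \<in> N \<Longrightarrow> adj u v \<Longrightarrow> q u v > 0"
  unfolding q_def using dv_pos[of u] d_pos[of u v] d_pos[of v u] adj_sym[of u v] by simp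

lemma ell_q:
  assumes "u \<in> N" "v \<in> N" "adj u v" "y \<in> side u v"
  shows "real (l u y) = q u v * real (l v y)"
proof -
  have "real (l u y) * (real (d u v) * real (d v u)) = real (dv adj d u) * real (l v y)"
    using ell_step[OF assms] by (metis of_nat_mult)
  moreover have D: "real (d u v) * real (d v u) > 0"
    using d_pos[of u v] d_pos[of v u] assms adj_sym[of u v] by simp
  moreover have "real (l u y) = real (l u y) * (real (d u v) * real (d v u)) / (real (d u v) * real (d v u))"
    by (rule nonzero_mult_div_cancel_right[symmetric]) (use D in linarith)
  ultimately show ?thesis unfolding q_def by (simp only: times_divide_eq_left)
qed

text \<open>This is the edge determinant condition divided by \<open>d u v * d v u\<close>, because
  \<open>l u v = q u v * dv adj d v\<close>.\<close>

lemma q_q: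
  assumes uv: "u \<in> N" "v \<in> N" "adj u v"
  shows "q u v * q v u < 1"
proof -
  let ?D = "real (d u v) * real (d v u)"
  have D: "?D > 0" using d_pos[of u v] d_pos[of v u] assms adj_sym[of u v] by simp
  have "d u v * d v u > l u v" using ed uv unfolding edge_determinant_def by blast
  then have 1: "?D > real (l u v)" by (metis of_nat_less_iff of_nat_mult)
  have "real (l u v) = q u v * real (dv adj d v)"
    using ell_q[OF uv side_self[OF uv(3)]] by (simp add: ell_self)
  then have "q u v * real (dv adj d v) / ?D < 1" using 1 D by (simp add: divide_less_eq)
  then show ?thesis by (simp add: q_def mult.commute)
qed

lemma wv_q: "u \<in> N \<Longrightarrow> v \<in> N \<Longrightarrow> adj u v \<Longrightarrow> x \<in> L \<Longrightarrow> x \<in> side u v \<Longrightarrow> wv u x = q u v * wv v x"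
  by (simp add: wv_node ell_q)

lemma wv_q_less:
  assumes "u \<in> N" "v \<in> N" "adj u v" "x \<in> L" "x \<in> side v u"
  shows "wv u x > q u v * wv v x"
proof -
  have "wv v x = q v u * wv u x" using wv_q[of v u x] assms adj_sym[of u v] by simp
  then have "q u v * wv v x = (q u v * q v u) * wv u x" by simp
  also have "\<dots> < 1 * wv u x" using q_q[OF assms(1-3)] wv_pos[OF assms(1,4)] by (rule mult_strict_right_mono)
  finally show ?thesis by simp
qed

text \<open>By outward induction from s; the edge determinant condition makes the comparison strict when the
first edge is crossed.\<close>
lemma wv_compare:
  assumes s: "s \<in> N" and st: "adj s t" and u: "u \<in> side s t" "u \<in> N"
  shows "(\<forall>x\<in>L - side s t. wv u x = real (l u s) / real (dv adj d s) * wv s x) \<and>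
    (\<forall>x\<in>L \<inter> side s t. wv u x > real (l u s) / real (dv adj d s) * wv s x)"
  using st u
proof (induction rule: side_induct)
  case base
  have "real (l t s) = q t s * real (dv adj d s)"
    using ell_q[OF base s adj_sym[OF st] side_self[OF adj_sym[OF st]]] by (simp add: ell_self)
  then have k: "real (l t s) / real (dv adj d s) = q t s" using dv_pos[OF s] by simp
  show ?case unfolding k
  proof (intro conjI ballI)
    fix x assume "x \<in> L - side s t"
    then have "x \<in> L" "x \<in> side t s" using side_opposite[OF st, of x] leaves_V by auto
    then show "wv t x = q t s * wv s x" using wv_q[OF base s adj_sym[OF st]] by blast
  next
    fix x assume "x \<in> L \<inter> side s t"
    then show "wv t x > q t s * wv s x" using wv_q_less[OF base s adj_sym[OF st]] by blast
  qed
next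
  case (step a b)
  note ab = step(1)
  have ba: "adj b a" by (rule adj_sym[OF ab])
  \<comment> \<open>Lying between \<open>s\<close> and \<open>b\<close>, the vertex \<open>a\<close>
    has two different neighbours and is not a leaf.\<close>
  have a: "a \<in> N"
  proof (rule nodeI[OF adj_V(1)[OF ab]], rule notI)
    assume "a \<in> L"
    have "s \<noteq> a" using step(2) not_in_side[OF st] by blast
    then obtain c where c: "adj a c" "s \<in> side a c" using ex_side[OF adj_V(1)[OF ab] node_V[OF s]] by blast
    have "c = b" using leaf_nbr[OF \<open>a \<in> L\<close> ab] c(1) by (auto simp: nbrs_def)
    then show False using c(2) step(4) side_opposite[OF ab node_V[OF s]] by blast
  qed
  let ?ka = "real (l a s) / real (dv adj d s)"
  note IH = step(5)[OF a]
  have k: "real (l b s) / real (dv adj d s) = q b a * ?ka"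
    using ell_q[OF step.prems a ba step(4)] by simp
  show ?case unfolding k
  proof (intro conjI ballI)
    fix x assume x: "x \<in> L - side s t"
    then have "x \<in> side b a" using side_outside[OF st step(3) ba step(4)] leaves_V by blast
    then have "wv b x = q b a * wv a x" using wv_q[OF step.prems a ba] x by blast
    then show "wv b x = q b a * ?ka * wv s x" using IH x by simp
  next
    fix x assume x: "x \<in> L \<inter> side s t"
    \<comment> \<open>Strictness comes from the previous vertex; the new edge has only to preserve
      it, whichever side of it \<open>x\<close> lies on.\<close>
    have "q b a * (?ka * wv s x) < q b a * wv a x"
      using IH x q_pos[OF step.prems a ba] by (intro mult_strict_left_mono) auto
    also have "q b a * wv a x \<le> wv b x"
      using wv_q[OF step.prems a ba, of x] wv_q_less[OF step.prems a ba, of x] x side_opposite[OF ba, of x] leaves_V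
      by fastforce
    finally show "q b a * ?ka * wv s x < wv b x" by (simp add: mult.assoc)
  qed
qed

end

section \<open>Weights of the monomials in a splice type system\<close>

locale splice_system = splice V adj d
  for V :: "'v set" and adj :: "'v \<Rightarrow> 'v \<Rightarrow> bool" and d :: "'v \<Rightarrow> 'v \<Rightarrow> nat" +
  fixes alpha :: "'v \<Rightarrow> 'v \<Rightarrow> 'v \<Rightarrow> nat" and c :: "'v \<Rightarrow> 'v \<Rightarrow> nat \<Rightarrow> complex"
    and g :: "'v \<Rightarrow> nat \<Rightarrow> 'v series"
  assumes sts: "splice_type_system V adj d alpha c g"
begin

abbreviation "me \<equiv> mexp V adj alpha"

lemma alpha: "v \<in> N \<Longrightarrow> adj v u \<Longrightarrow> dv adj d v = (\<Sum>x\<in>leaves_beyond V adj v u. alpha v u x * l v x)"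
  using sts unfolding splice_type_system_def admissible_alpha_def nbrs_def by blast

lemma minors: "v \<in> N \<Longrightarrow> minors_nonzero adj c v"
  using sts unfolding splice_type_system_def by blast

lemma g_adm: "v \<in> N \<Longrightarrow> i < valency adj v - 2 \<Longrightarrow> g_admissible V adj d v (g v i)"
  using sts unfolding splice_type_system_def by blast

lemma me_off: "adj v u \<Longrightarrow> x \<notin> L \<inter> side v u \<Longrightarrow> me v u x = 0"
  unfolding mexp_def by (auto simp: leaves_beyond_side)

lemma me_exps: "adj v u \<Longrightarrow> me v u \<in> exps L"
  using me_off by (auto simp: exps_def)

lemma me_sum: "v \<in> N \<Longrightarrow> adj v u \<Longrightarrow> (\<Sum>x\<in>L. l v x * me v u x) = dv adj d v"
proof -
  assume h: "v \<in> N" "adj v u"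
  have "(\<Sum>x\<in>L. l v x * me v u x) = (\<Sum>x\<in>leaves_beyond V adj v u. alpha v u x * l v x)"
    unfolding mexp_def leaves_beyond_side[OF h(2)]
    by (rule sum.mono_neutral_cong_right) (auto simp: finite_leaves)
  then show ?thesis using alpha[OF h] by simp
qed

lemma wt_me_self: "v \<in> N \<Longrightarrow> adj v u \<Longrightarrow> wt L (wv v) (me v u) = real (dv adj d v)"
  unfolding wt_def me_sum[symmetric] by (simp add: wv_node)

lemma me_supp: "v \<in> N \<Longrightarrow> adj v u \<Longrightarrow> \<exists>x\<in>L \<inter> side v u. me v u x > 0"
proof -
  assume h: "v \<in> N" "adj v u"
  have "\<exists>x\<in>L. l v x * me v u x \<noteq> 0"
  proof (rule ccontr)
    assume "\<not> (\<exists>x\<in>L. l v x * me v u x \<noteq> 0)"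
    then have "(\<Sum>x\<in>L. l v x * me v u x) = 0" by (intro sum.neutral) blast
    then show False using me_sum[OF h] dv_pos[OF h(1)] by simp
  qed
  then obtain x where x: "x \<in> L" "me v u x > 0" by auto
  then have "x \<in> L \<inter> side v u" using me_off[OF h(2), of x] by (cases "x \<in> L \<inter> side v u") auto
  then show ?thesis using x by blast
qed

text \<open>The \<open>u\<close>-weight of the leading part of the equations at \<open>s\<close>.
  For a leaf \<open>u\<close> the weight is the exponent of one variable, and 0 is the only lower
  bound available.\<close>

definition E :: "'v \<Rightarrow> 'v \<Rightarrow> real" where
  "E u s = (if u \<in> L then 0 else real (l u s))"

text \<open>Away from the side of \<open>u\<close> the vector \<open>w_u\<close> is
  \<open>l u s / d_s\<close> times \<open>w_s\<close>, and every admissible monomial at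
  \<open>s\<close> has \<open>w_s\<close>-weight \<open>d_s\<close>.\<close>

lemma wt_me_eq:
  assumes s: "s \<in> N" and st: "adj s t" and u: "u \<in> side s t \<or> u = s" and z: "adj s z" "z \<noteq> t"
  shows "wt L (wv u) (me s z) = E u s"
proof -
  have uV: "u \<in> V" using u side_memV node_V[OF s] by blast
  consider "u = s" | "u \<in> side s t" "u \<in> N" | "u \<in> side s t" "u \<in> L" using u nodeI[OF uV] by blast
  then show ?thesis
  proof cases
    case 1
    then show ?thesis using wt_me_self[OF s z(1)] node_not_leaf[OF s] by (simp add: E_def ell_self)
  next
    case 2
    let ?k = "real (l u s) / real (dv adj d s)"
    have "wt L (wv u) (me s z) = (\<Sum>x\<in>L. ?k * (wv s x * real (me s z x)))"
      unfolding wt_def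
    proof (rule sum.cong[OF refl])
      fix x assume x: "x \<in> L"
      show "wv u x * real (me s z x) = ?k * (wv s x * real (me s z x))"
      proof (cases "x \<in> side s t")
        case True
        then have "x \<notin> side s z" using side_unique[OF st z(1)] z(2) by blast
        then show ?thesis using me_off[OF z(1), of x] by simp
      next
        case False
        then have "wv u x = ?k * wv s x" using wv_compare[OF s st 2] x by blast
        then show ?thesis by simp
      qed
    qed
    also have "\<dots> = ?k * wt L (wv s) (me s z)" unfolding wt_def by (rule sum_distrib_left[symmetric])
    also have "\<dots> = real (l u s)" using dv_pos[OF s] by (simp add: wt_me_self[OF s z(1)])
    finally show ?thesis using node_not_leaf[OF 2(2)] by (simp add: E_def)
  next
    case 3
    then have "u \<notin> side s z" using side_unique[OF st z(1)] z(2) by blast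
    then have "me s z u = 0" using me_off[OF z(1)] by simp
    then have "wt L (wv u) (me s z) = 0" unfolding wt_def by (intro sum.neutral) (auto simp: wv_leaf[OF 3(2)])
    then show ?thesis using 3(2) by (simp add: E_def)
  qed
qed

lemma wt_me_leaf: "u \<in> L \<Longrightarrow> wt L (wv u) m = real (m u)"
proof -
  assume u: "u \<in> L"
  have "wt L (wv u) m = (\<Sum>x\<in>L. if x = u then real (m x) else 0)"
    unfolding wt_def by (rule sum.cong) (auto simp: wv_leaf[OF u])
  then show ?thesis using u finite_leaves by simp
qed

text \<open>The monomial of the edge towards \<open>u\<close> is supported on the side where the
  comparison of weight vectors is strict. A leaf is included only if it is the end \<open>t\<close>
  of the edge, where the monomial must be a power of its variable.\<close>

lemma wt_me_gt:
  assumes s: "s \<in> N" and st: "adj s t" and u: "u \<in> side s t" "u \<in> N \<or> u = t"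
  shows "wt L (wv u) (me s t) > E u s"
proof (cases "u \<in> N")
  case True
  let ?k = "real (l u s) / real (dv adj d s)"
  note cmp = wv_compare[OF s st u(1) True]
  obtain x0 where x0: "x0 \<in> L \<inter> side s t" "me s t x0 > 0" using me_supp[OF s st] by blast
  have "(\<Sum>x\<in>L. ?k * (wv s x * real (me s t x))) < wt L (wv u) (me s t)"
    unfolding wt_def
  proof (rule sum_strict_mono_ex1[OF finite_leaves])
    show "\<forall>x\<in>L. ?k * (wv s x * real (me s t x)) \<le> wv u x * real (me s t x)"
    proof
      fix x assume x: "x \<in> L"
      have "?k * wv s x \<le> wv u x" using cmp x by (cases "x \<in> side s t") (blast intro: less_imp_le eq_refl[OF sym])+
      then have "?k * wv s x * real (me s t x) \<le> wv u x * real (me s t x)" by (rule mult_right_mono) simp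
      then show "?k * (wv s x * real (me s t x)) \<le> wv u x * real (me s t x)" by (simp only: mult.assoc)
    qed
    have "?k * wv s x0 < wv u x0" using cmp x0 by blast
    then have "?k * wv s x0 * real (me s t x0) < wv u x0 * real (me s t x0)"
      using x0(2) by (intro mult_strict_right_mono) auto
    then show "\<exists>x\<in>L. ?k * (wv s x * real (me s t x)) < wv u x * real (me s t x)"
      using x0(1) by (auto simp only: mult.assoc)
  qed
  also have "(\<Sum>x\<in>L. ?k * (wv s x * real (me s t x))) = ?k * wt L (wv s) (me s t)"
    unfolding wt_def by (rule sum_distrib_left[symmetric])
  also have "\<dots> = real (l u s)" using dv_pos[OF s] by (simp add: wt_me_self[OF s st])
  finally show ?thesis using node_not_leaf[OF True] by (simp add: E_def)
next
  case False
  then have uL: "u \<in> L" "u = t" using u nodeI side_memV by blast+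
  obtain x where "x \<in> L \<inter> side s t" "me s t x > 0" using me_supp[OF s st] by blast
  then have "me s t u > 0" using side_leaf[OF st] uL by auto
  then show ?thesis using uL by (simp add: wt_me_leaf E_def)
qed

lemma wt_me_ge:
  assumes s: "s \<in> N" and st: "adj s t" and u: "u \<in> side s t \<or> u = s"
  shows "wt L (wv u) (me s t) \<ge> E u s"
proof -
  have uV: "u \<in> V" using u side_memV node_V[OF s] by blast
  consider "u = s" | "u \<in> side s t" "u \<in> N" | "u \<in> L" using u nodeI[OF uV] by blast
  then show ?thesis
  proof cases
    case 1
    then show ?thesis using wt_me_self[OF s st] node_not_leaf[OF s] by (simp add: E_def ell_self)
  next
    case 2
    then show ?thesis using wt_me_gt[OF s st] by (simp add: less_imp_le)
  next
    case 3
    then show ?thesis by (simp add: wt_me_leaf E_def)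
  qed
qed

lemma g_conv: "s \<in> N \<Longrightarrow> i < valency adj s - 2 \<Longrightarrow> conv_series L (g s i)"
  using g_adm unfolding g_admissible_def by blast

lemma wt_wv_node: "u \<in> N \<Longrightarrow> wt L (wv u) m = (\<Sum>x\<in>L. real (l u x) * real (m x))"
  unfolding wt_def by (simp add: wv_node)

lemma wt_g_gt:
  assumes "s \<in> N" "i < valency adj s - 2" "g s i m \<noteq> 0" "u \<in> N"
  shows "wt L (wv u) m > E u s"
proof -
  have "(\<Sum>x\<in>L. real (l s x) * real (m x)) > real (dv adj d s)"
    "u \<noteq> s \<Longrightarrow> (\<Sum>x\<in>L. real (l u x) * real (m x)) > real (l u s)"
    using g_adm[OF assms(1,2)] assms(3,4) unfolding g_admissible_def by blast+
  then show ?thesis using assms(4) node_not_leaf[OF assms(4)]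
    by (cases "u = s") (simp_all add: wt_wv_node E_def ell_self)
qed

lemma wt_g_ge:
  assumes "s \<in> N" "i < valency adj s - 2" "g s i m \<noteq> 0" "u \<in> V"
  shows "wt L (wv u) m \<ge> E u s"
proof (cases "u \<in> L")
  case True then show ?thesis by (simp add: wt_me_leaf E_def)
next
  case False then show ?thesis using wt_g_gt[OF assms(1-3) nodeI] assms(4) by (simp add: less_imp_le)
qed

text \<open>Weights p for which the initial forms at the node s drop exactly the term of the edge to t.\<close>
definition good :: "('v \<Rightarrow> real) \<Rightarrow> 'v \<Rightarrow> 'v \<Rightarrow> real \<Rightarrow> bool" where
  "good p s t W \<longleftrightarrow> (\<forall>z. adj s z \<longrightarrow> z \<noteq> t \<longrightarrow> wt L p (me s z) = W) \<and> wt L p (me s t) > W \<and>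
     (\<forall>i m. i < valency adj s - 2 \<longrightarrow> g s i m \<noteq> 0 \<longrightarrow> wt L p m > W)"

lemma wt_comb: "wt L (\<lambda>x. a * p x + b * r x) m = a * wt L p m + b * wt L r m"
  unfolding wt_def by (simp add: algebra_simps sum.distrib sum_distrib_left)

lemma good_node:
  assumes "u \<in> N" "s \<in> N" "adj s t" "u \<in> side s t"
  shows "good (wv u) s t (E u s)"
  unfolding good_def using wt_me_eq[of s t u] wt_me_gt[of s t u] wt_g_gt[of s _ _ u] assms by blast

text \<open>Equalities and weak inequalities add up, so one strict inequality from either vector is
  enough. The assumption \<open>strict\<close> provides it for the monomial towards
  \<open>t\<close>, and \<open>node\<close> for the terms of \<open>g\<close>.\<close>

lemma good_comb:
  assumes s: "s \<in> N" and st: "adj s t" and a: "a > 0" and b: "b > 0"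
    and u: "u \<in> side s t \<or> u = s" and v: "v \<in> side s t \<or> v = s"
    and strict: "(u \<in> side s t \<and> (u \<in> N \<or> u = t)) \<or> (v \<in> side s t \<and> (v \<in> N \<or> v = t))"
    and node: "u \<in> N \<or> v \<in> N"
  shows "good (\<lambda>x. a * wv u x + b * wv v x) s t (a * E u s + b * E v s)"
  unfolding good_def wt_comb
proof (intro conjI allI impI)
  fix z assume "adj s z" "z \<noteq> t"
  then show "a * wt L (wv u) (me s z) + b * wt L (wv v) (me s z) = a * E u s + b * E v s"
    using wt_me_eq[OF s st u] wt_me_eq[OF s st v] by simp
next
  have ge: "a * wt L (wv u) (me s t) \<ge> a * E u s" "b * wt L (wv v) (me s t) \<ge> b * E v s"
    using wt_me_ge[OF s st u] wt_me_ge[OF s st v] a b by (simp_all add: mult_left_mono)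
  from strict show "a * E u s + b * E v s < a * wt L (wv u) (me s t) + b * wt L (wv v) (me s t)"
  proof
    assume "u \<in> side s t \<and> (u \<in> N \<or> u = t)"
    then have "a * E u s < a * wt L (wv u) (me s t)" using wt_me_gt[OF s st] a by (simp add: mult_strict_left_mono)
    then show ?thesis using ge by linarith
  next
    assume "v \<in> side s t \<and> (v \<in> N \<or> v = t)"
    then have "b * E v s < b * wt L (wv v) (me s t)" using wt_me_gt[OF s st] b by (simp add: mult_strict_left_mono)
    then show ?thesis using ge by linarith
  qed
next
  fix i m assume im: "i < valency adj s - 2" "g s i m \<noteq> 0"
  have V: "u \<in> V" "v \<in> V" using u v side_memV node_V[OF s] by blast+
  have ge: "a * wt L (wv u) m \<ge> a * E u s" "b * wt L (wv v) m \<ge> b * E v s"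
    using wt_g_ge[OF s im] V a b by (simp_all add: mult_left_mono)
  from node show "a * E u s + b * E v s < a * wt L (wv u) m + b * wt L (wv v) m"
  proof
    assume "u \<in> N"
    then have "a * E u s < a * wt L (wv u) m" using wt_g_gt[OF s im] a by (simp add: mult_strict_left_mono)
    then show ?thesis using ge by linarith
  next
    assume "v \<in> N"
    then have "b * E v s < b * wt L (wv v) m" using wt_g_gt[OF s im] b by (simp add: mult_strict_left_mono)
    then show ?thesis using ge by linarith
  qed
qed

text \<open>Supplies the strictness assumption of \<open>good_comb\<close>: a leaf end
  \<open>u\<close> different from \<open>t\<close> has as neighbour a node in the same subtree, and
  that node gives the strict inequality.\<close>

lemma edge_side:
  assumes uv: "adj u v" and s: "s \<in> N" and st: "adj s t" and us: "u \<in> side s t"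
  shows "(v \<in> side s t \<or> v = s) \<and> (u \<in> N \<or> u = t \<or> v \<in> side s t \<and> v \<in> N)"
proof -
  have "u \<noteq> s" using us not_in_side[OF st] by blast
  then have 1: "v \<in> side s t \<or> v = s" using same_side[OF uv st _ _ us] by blast
  have "v \<in> N" "v \<in> side s t" if "u \<notin> N" "u \<noteq> t"
  proof -
    have "u \<in> L" using that(1) nodeI[OF adj_V(1)[OF uv]] by blast
    then show "v \<in> N" by (rule leaf_nbr_node[OF _ uv])
    have "v \<noteq> s"
    proof
      assume "v = s"
      then have su: "adj s u" using adj_sym[OF uv] by simp
      show False using side_unique[OF st su us side_self[OF su]] that(2) by blast
    qed
    then show "v \<in> side s t" using 1 by blast
  qed
  then show ?thesis using 1 by blast
qed

lemma good_edge:
  assumes uv: "adj u v" and s: "s \<in> N" and st: "adj s t" and a: "a > 0" and b: "b > 0"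
    and "u \<in> side s t \<or> v \<in> side s t"
  shows "good (\<lambda>x. a * wv u x + b * wv v x) s t (a * E u s + b * E v s)"
proof -
  have node: "u \<in> N \<or> v \<in> N" using leaf_nbr_node[OF _ uv] nodeI[OF adj_V(1)[OF uv]] by blast
  from assms(6) show ?thesis
  proof
    assume us: "u \<in> side s t"
    show ?thesis by (rule good_comb[OF s st a b _ _ _ node]) (use us edge_side[OF uv s st us] in blast)+
  next
    assume vs: "v \<in> side s t"
    show ?thesis by (rule good_comb[OF s st a b _ _ _ node]) (use vs edge_side[OF adj_sym[OF uv] s st vs] in blast)+
  qed
qed

end

section \<open>Linear algebra of the coefficient matrices\<close>

lemma minors_inverse:
  assumes m: "minors_nonzero adj c v" and S: "S \<subseteq> nbrs adj v" "finite S" "card S = valency adj v - 2"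
  shows "\<exists>\<beta>. (\<forall>e\<in>S. \<forall>e'\<in>S. (\<Sum>i<card S. c v e i * \<beta> i e') = (if e = e' then 1 else 0)) \<and>
    (\<forall>i<card S. \<forall>j<card S. (\<Sum>e\<in>S. \<beta> i e * c v e j) = (if i = j then 1 else 0))"
proof -
  define k where "k = card S"
  obtain \<sigma> where \<sigma>: "bij_betw \<sigma> {..<k} S"
    using ex_bij_betw_nat_finite[OF S(2)] unfolding k_def atLeast0LessThan by blast
  define A where "A = Matrix.mat k k (\<lambda>(a, b). c v (\<sigma> a) b)"
  have A: "A \<in> carrier_mat k k" by (simp add: A_def)
  have "Determinant.det A \<noteq> 0" using m S \<sigma> unfolding minors_nonzero_def Let_def A_def k_def by metis
  then have "A \<in> Units (ring_mat TYPE(complex) k ())" by (rule det_non_zero_imp_unit[OF A])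
  then obtain B where B: "B \<in> carrier_mat k k" "A * B = 1\<^sub>m k" "B * A = 1\<^sub>m k"
    unfolding Units_def ring_mat_def by auto
  define \<tau> where "\<tau> = inv_into {..<k} \<sigma>"
  have \<tau>: "\<tau> e < k" "\<sigma> (\<tau> e) = e" if "e \<in> S" for e
    using bij_betw_inv_into_right[OF \<sigma> that] bij_betwE[OF bij_betw_inv_into[OF \<sigma>]] that by (auto simp: \<tau>_def)
  have \<tau>\<sigma>: "\<tau> (\<sigma> a) = a" if "a < k" for a
    using bij_betw_inv_into_left[OF \<sigma>] that by (simp add: \<tau>_def)
  define \<beta> where "\<beta> i e = B $$ (i, \<tau> e)" for i e
  have "(\<Sum>i<k. c v e i * \<beta> i e') = (if e = e' then 1 else 0)" if e: "e \<in> S" "e' \<in> S" for e e'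
  proof -
    have "(A * B) $$ (\<tau> e, \<tau> e') = (\<Sum>i<k. c v e i * \<beta> i e')"
      using \<tau>[OF e(1)] \<tau>[OF e(2)] A B(1)
      by (auto simp: scalar_prod_def \<beta>_def A_def atLeast0LessThan intro!: sum.cong)
    moreover have "\<tau> e = \<tau> e' \<longleftrightarrow> e = e'" using \<tau>(2)[OF e(1)] \<tau>(2)[OF e(2)] by metis
    ultimately show ?thesis unfolding B(2) using \<tau>[OF e(1)] \<tau>[OF e(2)] by auto
  qed
  moreover have "(\<Sum>e\<in>S. \<beta> i e * c v e j) = (if i = j then 1 else 0)" if ij: "i < k" "j < k" for i j
  proof -
    have "(\<Sum>e\<in>S. \<beta> i e * c v e j) = (\<Sum>a<k. \<beta> i (\<sigma> a) * c v (\<sigma> a) j)"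
      by (rule sum.reindex_bij_betw[OF \<sigma>, symmetric])
    also have "\<dots> = (B * A) $$ (i, j)"
      using ij A B(1) by (auto simp: scalar_prod_def \<beta>_def A_def atLeast0LessThan \<tau>\<sigma> intro!: sum.cong)
    finally show ?thesis unfolding B(3) using ij by simp
  qed
  ultimately show ?thesis unfolding k_def by blast
qed

lemma minors_solve:
  assumes m: "minors_nonzero adj c v" and S: "S \<subseteq> nbrs adj v" "finite S" "card S = valency adj v - 2"
  shows minors_rows: "\<exists>r. \<forall>i<card S. (\<Sum>e\<in>S. r e * c v e i) = t i"
    and minors_rows_0: "(\<And>i. i < card S \<Longrightarrow> (\<Sum>e\<in>S. r e * c v e i) = 0) \<Longrightarrow> e' \<in> S \<Longrightarrow> r e' = 0"
    and minors_cols: "\<exists>\<kappa>. \<forall>e\<in>S. (\<Sum>i<card S. \<kappa> i * c v e i) = s e"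
    and minors_cols_0: "(\<And>e. e \<in> S \<Longrightarrow> (\<Sum>i<card S. \<kappa> i * c v e i) = 0) \<Longrightarrow> j < card S \<Longrightarrow> \<kappa> j = 0"
proof -
  obtain \<beta> where \<beta>: "\<And>e e'. e \<in> S \<Longrightarrow> e' \<in> S \<Longrightarrow> (\<Sum>i<card S. c v e i * \<beta> i e') = (if e = e' then 1 else 0)"
    "\<And>i j. i < card S \<Longrightarrow> j < card S \<Longrightarrow> (\<Sum>e\<in>S. \<beta> i e * c v e j) = (if i = j then 1 else 0)"
    using minors_inverse[OF assms] by blast
  show "\<exists>r. \<forall>i<card S. (\<Sum>e\<in>S. r e * c v e i) = t i"
  proof (intro exI allI impI)
    fix j assume j: "j < card S"
    have "(\<Sum>e\<in>S. (\<Sum>i<card S. t i * \<beta> i e) * c v e j) = (\<Sum>i<card S. t i * (\<Sum>e\<in>S. \<beta> i e * c v e j))"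
      unfolding sum_distrib_left sum_distrib_right by (subst sum.swap) (simp add: mult.assoc)
    also have "\<dots> = (\<Sum>i<card S. if i = j then t j else 0)" using \<beta>(2)[OF _ j] by (intro sum.cong) auto
    also have "\<dots> = t j" using j by simp
    finally show "(\<Sum>e\<in>S. (\<Sum>i<card S. t i * \<beta> i e) * c v e j) = t j" .
  qed
  show "r e' = 0" if h: "\<And>i. i < card S \<Longrightarrow> (\<Sum>e\<in>S. r e * c v e i) = 0" and e': "e' \<in> S"
  proof -
    have "r e' = (\<Sum>e\<in>S. if e = e' then r e else 0)" using e' S(2) by simp
    also have "\<dots> = (\<Sum>e\<in>S. r e * (\<Sum>i<card S. c v e i * \<beta> i e'))" using \<beta>(1)[OF _ e'] by (intro sum.cong) auto
    also have "\<dots> = (\<Sum>i<card S. (\<Sum>e\<in>S. r e * c v e i) * \<beta> i e')"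
      unfolding sum_distrib_left sum_distrib_right by (subst sum.swap) (simp add: mult.assoc)
    also have "\<dots> = 0" using h by (intro sum.neutral) auto
    finally show ?thesis .
  qed
  show "\<exists>\<kappa>. \<forall>e\<in>S. (\<Sum>i<card S. \<kappa> i * c v e i) = s e"
  proof (intro exI ballI)
    fix e assume e: "e \<in> S"
    have "(\<Sum>i<card S. (\<Sum>e'\<in>S. \<beta> i e' * s e') * c v e i) = (\<Sum>e'\<in>S. (\<Sum>i<card S. c v e i * \<beta> i e') * s e')"
      unfolding sum_distrib_left sum_distrib_right by (subst sum.swap) (simp add: mult_ac)
    also have "\<dots> = (\<Sum>e'\<in>S. if e = e' then s e' else 0)" using \<beta>(1)[OF e] by (intro sum.cong) auto
    also have "\<dots> = s e" using e S(2) by simp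
    finally show "(\<Sum>i<card S. (\<Sum>e'\<in>S. \<beta> i e' * s e') * c v e i) = s e" .
  qed
  show "\<kappa> j = 0" if h: "\<And>e. e \<in> S \<Longrightarrow> (\<Sum>i<card S. \<kappa> i * c v e i) = 0" and j: "j < card S"
  proof -
    have "\<kappa> j = (\<Sum>i<card S. if j = i then \<kappa> i else 0)" using j by simp
    also have "\<dots> = (\<Sum>i<card S. (\<Sum>e\<in>S. \<beta> j e * c v e i) * \<kappa> i)" using \<beta>(2)[OF j] by (intro sum.cong) auto
    also have "\<dots> = (\<Sum>e\<in>S. \<beta> j e * (\<Sum>i<card S. \<kappa> i * c v e i))"
      unfolding sum_distrib_left sum_distrib_right by (subst sum.swap) (simp add: mult_ac)
    also have "\<dots> = 0" using h by (intro sum.neutral) auto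
    finally show ?thesis .
  qed
qed

context splice_system
begin

lemma card_nbrs_minus:
  assumes "v \<in> N" "adj v e1" "adj v e2" "e1 \<noteq> e2"
  shows "card (nbrs adj v - {e1, e2}) = valency adj v - 2" "nbrs adj v - {e1, e2} \<subseteq> nbrs adj v" "finite (nbrs adj v - {e1, e2})"
proof -
  have "card (nbrs adj v - {e1, e2}) = card (nbrs adj v) - card {e1, e2}"
    by (rule card_Diff_subset) (use assms in \<open>auto simp: nbrs_def\<close>)
  then show "card (nbrs adj v - {e1, e2}) = valency adj v - 2" using assms(4) by (simp add: valency_def)
qed (use finite_nbrs in auto)

text \<open>The combination is prescribed on all edges but \<open>e1\<close> and \<open>e2\<close>.
  If it also vanished on one of these two, it would vanish on the complement of another pair of
  edges and hence be trivial by the corresponding minor.\<close>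

lemma trinomial_coeffs:
  assumes v: "v \<in> N" and e: "adj v e1" "adj v e2" "adj v e3" "e1 \<noteq> e2" "e1 \<noteq> e3" "e2 \<noteq> e3"
  shows "\<exists>\<kappa>. \<forall>e\<in>nbrs adj v. (\<Sum>i<valency adj v - 2. \<kappa> i * c v e i) = 0 \<longleftrightarrow> e \<notin> {e1, e2, e3}"
proof -
  let ?k = "valency adj v - 2"
  note S = card_nbrs_minus[OF v]
  note S12 = S[OF e(1,2,4)] and S13 = S[OF e(1,3,5)] and S23 = S[OF e(2,3,6)]
  obtain \<kappa> where \<kappa>: "\<forall>e\<in>nbrs adj v - {e1, e2}. (\<Sum>i<?k. \<kappa> i * c v e i) = (if e = e3 then 1 else 0)"
    using minors_cols[OF minors[OF v] S12(2,3,1), of "\<lambda>e. if e = e3 then 1 else 0"] unfolding S12(1) by blast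
  have 3: "(\<Sum>i<?k. \<kappa> i * c v e3 i) = 1" using \<kappa> e by (auto simp: nbrs_def)
  have nz: "\<not> (\<forall>i<?k. \<kappa> i = 0)"
  proof
    assume "\<forall>i<?k. \<kappa> i = 0"
    then have "(\<Sum>i<?k. \<kappa> i * c v e3 i) = 0" by (intro sum.neutral) auto
    then show False using 3 by simp
  qed
  have 1: "(\<Sum>i<?k. \<kappa> i * c v e1 i) \<noteq> 0"
  proof
    assume z: "(\<Sum>i<?k. \<kappa> i * c v e1 i) = 0"
    have "(\<Sum>i<?k. \<kappa> i * c v e i) = 0" if "e \<in> nbrs adj v - {e2, e3}" for e
      using that z \<kappa> by (cases "e = e1") auto
    then show False using minors_cols_0[OF minors[OF v] S23(2,3,1), of \<kappa>] nz unfolding S23(1) by blast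
  qed
  have 2: "(\<Sum>i<?k. \<kappa> i * c v e2 i) \<noteq> 0"
  proof
    assume z: "(\<Sum>i<?k. \<kappa> i * c v e2 i) = 0"
    have "(\<Sum>i<?k. \<kappa> i * c v e i) = 0" if "e \<in> nbrs adj v - {e1, e3}" for e
      using that z \<kappa> by (cases "e = e2") auto
    then show False using minors_cols_0[OF minors[OF v] S13(2,3,1), of \<kappa>] nz unfolding S13(1) by blast
  qed
  show ?thesis using 1 2 3 \<kappa> by (intro exI[of _ \<kappa>] ballI) auto
qed

lemma ex_other_nbr:
  assumes "v \<in> N" "adj v t"
  shows "\<exists>e. adj v e \<and> e \<noteq> t"
proof (rule ccontr)
  assume "\<not> (\<exists>e. adj v e \<and> e \<noteq> t)"
  then have "nbrs adj v \<subseteq> {t}" by (auto simp: nbrs_def)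
  then have "card (nbrs adj v) \<le> 1" using card_mono[of "{t}"] by simp
  then show False using node_valency[OF assms(1)] by (simp add: valency_def)
qed

text \<open>One invertible minor already reaches every right-hand side, so one further entry is put
  to 0. This solves the linearized equations in the lifting.\<close>

lemma surj_coeffs:
  assumes v: "v \<in> N" and t: "adj v t"
  shows "\<exists>r. \<forall>i<valency adj v - 2. (\<Sum>e\<in>nbrs adj v - {t}. r e * c v e i) = T i"
proof -
  obtain e0 where e0: "adj v e0" "t \<noteq> e0" using ex_other_nbr[OF assms] by blast
  note S = card_nbrs_minus[OF v t e0]
  obtain r where r: "\<forall>i<valency adj v - 2. (\<Sum>e\<in>nbrs adj v - {t, e0}. r e * c v e i) = T i"
    using minors_rows[OF minors[OF v] S(2,3,1), of T] unfolding S(1) by blast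
  have "(\<Sum>e\<in>nbrs adj v - {t}. (if e = e0 then 0 else r e) * c v e i) = (\<Sum>e\<in>nbrs adj v - {t, e0}. r e * c v e i)" for i
    by (rule sum.mono_neutral_cong_right) (use finite_nbrs in auto)
  then show ?thesis using r by (intro exI[of _ "\<lambda>e. if e = e0 then 0 else r e"]) simp
qed

text \<open>Values for the remaining monomials that solve the leading equations in the torus. The
  entry at \<open>e0\<close> is normalized to 1; a zero entry elsewhere would force this one to
  vanish by another minor.\<close>

lemma kernel_coeffs:
  assumes v: "v \<in> N" and t: "adj v t"
  shows "\<exists>b. (\<forall>e\<in>nbrs adj v - {t}. b e \<noteq> 0) \<and> (\<forall>i<valency adj v - 2. (\<Sum>e\<in>nbrs adj v - {t}. b e * c v e i) = 0)"
proof -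
  obtain e0 where e0: "adj v e0" "t \<noteq> e0" using ex_other_nbr[OF assms] by blast
  note S = card_nbrs_minus[OF v t e0]
  obtain r where r: "\<forall>i<valency adj v - 2. (\<Sum>e\<in>nbrs adj v - {t, e0}. r e * c v e i) = - c v e0 i"
    using minors_rows[OF minors[OF v] S(2,3,1), of "\<lambda>i. - c v e0 i"] unfolding S(1) by blast
  define b where "b e = (if e = e0 then 1 else r e)" for e
  have b0: "(\<Sum>e\<in>nbrs adj v - {t}. b e * c v e i) = 0" if i: "i < valency adj v - 2" for i
  proof -
    have "(\<Sum>e\<in>nbrs adj v - {t}. b e * c v e i) = b e0 * c v e0 i + (\<Sum>e\<in>nbrs adj v - {t} - {e0}. b e * c v e i)"
      by (rule sum.remove) (use e0 finite_nbrs in \<open>auto simp: nbrs_def\<close>)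
    also have "(\<Sum>e\<in>nbrs adj v - {t} - {e0}. b e * c v e i) = (\<Sum>e\<in>nbrs adj v - {t, e0}. r e * c v e i)"
      by (rule sum.cong) (auto simp: b_def)
    finally show ?thesis using r i by (simp add: b_def)
  qed
  have "b e1 \<noteq> 0" if e1: "e1 \<in> nbrs adj v - {t}" for e1
  proof
    assume z: "b e1 = 0"
    have ne: "e1 \<noteq> e0" using z by (auto simp: b_def)
    have e1': "adj v e1" "t \<noteq> e1" using e1 by (auto simp: nbrs_def)
    note S' = card_nbrs_minus[OF v t e1']
    have "(\<Sum>e\<in>nbrs adj v - {t, e1}. b e * c v e i) = 0" if i: "i < valency adj v - 2" for i
    proof -
      have "(\<Sum>e\<in>nbrs adj v - {t, e1}. b e * c v e i) = (\<Sum>e\<in>nbrs adj v - {t}. b e * c v e i)"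
        by (rule sum.mono_neutral_left) (use finite_nbrs z in auto)
      then show ?thesis using b0[OF i] by simp
    qed
    then have "b e0 = 0" using minors_rows_0[OF minors[OF v] S'(2,3,1), of b e0] ne e0 unfolding S'(1) by (simp add: nbrs_def)
    then show False by (simp add: b_def)
  qed
  then show ?thesis using b0 by blast
qed

text \<open>Applied with P B saying that the product of the variables in B is nilpotent modulo an ideal, and with
P B saying that some leaf in B has a positive coordinate.\<close>
lemma propagate:
  assumes mono: "\<And>A B. P A \<Longrightarrow> A \<subseteq> B \<Longrightarrow> B \<subseteq> L \<Longrightarrow> P B"
    and swap: "\<And>s t z z' B. s \<in> N \<Longrightarrow> s \<in> side x y \<Longrightarrow> adj s t \<Longrightarrow> x \<in> side s t \<Longrightarrow>
       adj s z \<Longrightarrow> adj s z' \<Longrightarrow> z \<noteq> t \<Longrightarrow> z' \<noteq> t \<Longrightarrow> B \<subseteq> L \<Longrightarrow>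
       P (B \<union> {i. me s z i > 0}) \<Longrightarrow> P (B \<union> {i. me s z' i > 0})"
    and xy: "adj x y" and i: "i \<in> L \<inter> side x y" and j: "j \<in> L \<inter> side x y" and B: "B \<subseteq> L"
    and Pi: "P (insert i B)"
  shows "P (insert j B)"
  using swap xy i j B Pi
proof (induction "card (side x y)" arbitrary: x y i j B rule: less_induct)
  case less
  note swap = less.prems(1) and xy = less.prems(2)
  have supp: "{i. me s z i > 0} \<subseteq> L \<inter> side s z" if "adj s z" for s z
    using me_off[OF that] by force
  show ?case
  proof (cases "y \<in> L")
    case True
    then have "i = j" using side_leaf[OF xy True] less.prems(3,4) by auto
    then show ?thesis using less.prems by simp
  next
    case False
    then have y: "y \<in> N" using nodeI adj_V(2)[OF xy] by blast
    have ex: "\<exists>z. adj y z \<and> z \<noteq> x \<and> i \<in> side y z" if "i \<in> L \<inter> side x y" for i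
      using that side_rec[OF xy] False by (auto simp: nbrs_def)
    obtain z where z: "adj y z" "z \<noteq> x" "i \<in> side y z" using ex[OF less.prems(3)] by blast
    obtain z' where z': "adj y z'" "z' \<noteq> x" "j \<in> side y z'" using ex[OF less.prems(4)] by blast
    \<comment> \<open>The exchange hypothesis passes to a smaller subtree, since from a node inside
      it \<open>x\<close> and \<open>y\<close> lie in the same direction.\<close>
    have IH: "P (insert j B)" if w: "adj y w" "w \<noteq> x" and ij: "i \<in> L \<inter> side y w" "j \<in> L \<inter> side y w" "B \<subseteq> L" "P (insert i B)" for w i j B
    proof (rule less.hyps[OF card_side_step[OF xy w] _ w(1) ij])
      fix s t z z' B assume h: "s \<in> N" "s \<in> side y w" "adj s t" "y \<in> side s t" "adj s z" "adj s z'" "z \<noteq> t" "z' \<noteq> t" "B \<subseteq> L"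
        "P (B \<union> {i. me s z i > 0})"
      have sx: "s \<in> side x y" using h(2) side_step[OF xy w] by blast
      have "x \<in> side s t"
      proof (rule same_side[OF adj_sym[OF xy] h(3) _ _ h(4)])
        show "y \<noteq> s" using not_in_side[OF w(1)] h(2) by blast
        show "x \<noteq> s" using not_in_side[OF xy] sx by blast
      qed
      then show "P (B \<union> {i. me s z' i > 0})" using swap[of s t z z' B] h sx by blast
    qed
    \<comment> \<open>The route from \<open>i\<close> to \<open>j\<close>: within the branch of
      \<open>i\<close> to some \<open>k\<close> in the support of its monomial, from there by
      exchange to the support of the monomial of the other branch, and within that branch to
      \<open>j\<close>.\<close>
    obtain k where k: "k \<in> L \<inter> side y z" "me y z k > 0" using me_supp[OF y z(1)] by blast
    have iL: "i \<in> L \<inter> side y z" "j \<in> L \<inter> side y z'" using less.prems(3,4) z z' by blast+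
    have "P (insert k B)" using IH[OF z(1,2) iL(1) k(1)] less.prems by blast
    then have "P (B \<union> {i. me y z i > 0})" by (rule mono) (use k less.prems(5) supp[OF z(1)] in auto)
    then have 1: "P (B \<union> {i. me y z' i > 0})"
      using swap[OF y side_self[OF xy] adj_sym[OF xy] side_self[OF adj_sym[OF xy]] z(1) z'(1) z(2) z'(2)] less.prems(5) by blast
    \<comment> \<open>The members of the support are replaced by \<open>j\<close> one at a time;
      those already replaced are carried along in \<open>B\<close>.\<close>
    have "P (insert j B)" if "finite T" "T \<subseteq> L \<inter> side y z'" "B \<subseteq> L" "P (B \<union> T)" for T B
      using that
    proof (induction T arbitrary: B rule: finite_induct)
      case empty
      show ?case by (rule mono[OF empty(3)]) (use empty iL in auto)
    next
      case (insert a T)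
      have aT: "a \<in> L \<inter> side y z'" "B \<union> T \<subseteq> L" "P (insert a (B \<union> T))" using insert.prems by auto
      have "P (insert j (B \<union> T))" by (rule IH[OF z'(1,2) aT(1) iL(2) aT(2,3)])
      then have "P (insert j (insert j B))" using insert.IH[of "insert j B"] insert.prems iL by auto
      then show ?case by simp
    qed
    from this[OF finite_subset[OF supp[OF z'(1)]] supp[OF z'(1)] less.prems(5) 1] show ?thesis
      using finite_leaves by blast
  qed
qed


section \<open>Logarithmic equations on subtrees\<close>

lemma side_sub:
  assumes yb: "adj y b" and s: "s \<in> side y b" and z: "adj s z" "y \<notin> side s z"
  shows "side s z \<subseteq> side y b"
proof
  fix i assume i: "i \<in> side s z"
  have "y \<noteq> s" using not_in_side[OF yb] s by blast
  then obtain t where t: "adj s t" "y \<in> side s t"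
    using ex_side[OF side_memV[OF s] adj_V(1)[OF yb]] by blast
  have "t \<noteq> z" using t z by blast
  then have "i \<notin> side s t" using side_unique[OF t(1) z(1) _ i] by blast
  then show "i \<in> side y b" using side_outside[OF yb s t] side_memV[OF i] by blast
qed

text \<open>The \<open>w_y\<close>-weight of an admissible monomial at \<open>s\<close> pointing
  away from \<open>y\<close> is independent of the edge. Adding a multiple of \<open>w_y\<close> to
  a solution therefore changes only the constant at \<open>s\<close>.\<close>

lemma me_ell_sum:
  assumes y: "y \<in> N" and s: "s \<in> N" "adj s t" "y \<in> side s t" and z: "adj s z" "z \<noteq> t"
  shows "(\<Sum>x\<in>L. of_nat (me s z x) * of_nat (l y x)) = (of_nat (l y s) :: complex)"
proof -
  have "real (\<Sum>x\<in>L. me s z x * l y x) = real (l y s)"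
    using wt_me_eq[OF s(1,2) _ z, of y] s(3) y node_not_leaf[OF y]
    by (simp add: wt_wv_node E_def mult.commute)
  then have "(\<Sum>x\<in>L. me s z x * l y x) = l y s" by (simp only: of_nat_eq_iff)
  then show ?thesis by (metis (no_types, lifting) of_nat_mult of_nat_sum sum.cong)
qed

text \<open>On each subtree the exponent matrix can be solved modulo constants; a multiple of the weight
vector of the root only changes the constants, and adjusts the term of the root edge.\<close>
lemma solve_side:
  assumes "adj x y"
  shows "\<exists>\<xi>::'v \<Rightarrow> complex. \<forall>s\<in>N \<inter> side x y. \<exists>\<kappa>. \<forall>z. adj s z \<longrightarrow> x \<notin> side s z \<longrightarrow>
    (\<Sum>i\<in>L. of_nat (me s z i) * \<xi> i) = r s z + \<kappa>"
  using assms
proof (induction "card (side x y)" arbitrary: x y rule: less_induct)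
  case less
  note xy = less.prems
  show ?case
  proof (cases "y \<in> L")
    case True
    then show ?thesis using side_leaf[OF xy True] node_not_leaf by auto
  next
    case False
    then have y: "y \<in> N" using nodeI adj_V(2)[OF xy] by blast
    let ?C = "nbrs adj y - {x}"
    have C: "adj y z \<and> z \<noteq> x" if "z \<in> ?C" for z using that by (simp add: nbrs_def)
    have "\<forall>z\<in>?C. \<exists>\<xi>::'v \<Rightarrow> complex. \<forall>s\<in>N \<inter> side y z. \<exists>\<kappa>. \<forall>z'. adj s z' \<longrightarrow> y \<notin> side s z' \<longrightarrow>
      (\<Sum>i\<in>L. of_nat (me s z' i) * \<xi> i) = r s z' + \<kappa>"
      using less.hyps[OF card_side_step[OF xy]] C by blast
    then obtain X :: "'v \<Rightarrow> 'v \<Rightarrow> complex" where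
      X: "\<And>z s. z \<in> ?C \<Longrightarrow> s \<in> N \<inter> side y z \<Longrightarrow> \<exists>\<kappa>. \<forall>z'. adj s z' \<longrightarrow> y \<notin> side s z' \<longrightarrow>
      (\<Sum>i\<in>L. of_nat (me s z' i) * X z i) = r s z' + \<kappa>" by metis
    \<comment> \<open>Chosen so that adding \<open>\<sigma> z * w_y\<close> on the branch of
      \<open>z\<close> makes the equation of the edge \<open>z\<close> at \<open>y\<close> exact;
      \<open>w_y\<close> pairs with that monomial to \<open>d_y\<close>, which is not 0.\<close>
    define \<sigma> where "\<sigma> z = (r y z - (\<Sum>i\<in>L. of_nat (me y z i) * X z i)) / of_nat (dv adj d y)" for z
    define ch where "ch i = (THE z. adj y z \<and> i \<in> side y z)" for i
    have ch: "ch i = z" if "adj y z" "i \<in> side y z" for z i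
      unfolding ch_def by (rule the_equality) (use that side_unique in blast)+
    define \<xi> where "\<xi> i = X (ch i) i + \<sigma> (ch i) * of_nat (l y i)" for i
    have expand: "(\<Sum>i\<in>L. of_nat (me s z' i) * \<xi> i) =
        (\<Sum>i\<in>L. of_nat (me s z' i) * X z i) + \<sigma> z * (\<Sum>i\<in>L. of_nat (me s z' i) * of_nat (l y i))"
      if z: "adj y z" and sz: "adj s z'" "side s z' \<subseteq> side y z" for s z z'
    proof -
      have "of_nat (me s z' i) * \<xi> i = of_nat (me s z' i) * X z i + \<sigma> z * (of_nat (me s z' i) * of_nat (l y i))"
        if "i \<in> L" for i
      proof (cases "i \<in> side s z'")
        case True
        then show ?thesis using ch[OF z] sz(2) by (auto simp: \<xi>_def algebra_simps)
      next
        case False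
        then show ?thesis using me_off[OF sz(1), of i] by simp
      qed
      then show ?thesis by (simp add: sum.distrib sum_distrib_left)
    qed
    show ?thesis
    proof (intro exI[of _ \<xi>] ballI)
      fix s assume s: "s \<in> N \<inter> side x y"
      show "\<exists>\<kappa>. \<forall>z. adj s z \<longrightarrow> x \<notin> side s z \<longrightarrow> (\<Sum>i\<in>L. of_nat (me s z i) * \<xi> i) = r s z + \<kappa>"
      proof (cases "s = y")
        case True
        show ?thesis unfolding True
        proof (intro exI[of _ 0] allI impI)
          fix z assume z: "adj y z" "x \<notin> side y z"
          have "(\<Sum>i\<in>L. of_nat (me y z i) * of_nat (l y i)) = (of_nat (dv adj d y) :: complex)"
            unfolding me_sum[OF y z(1), symmetric] by (simp add: mult.commute)
          then show "(\<Sum>i\<in>L. of_nat (me y z i) * \<xi> i) = r y z + 0"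
            using expand[OF z(1) z(1) order_refl] dv_pos[OF y] by (simp add: \<sigma>_def)
        qed
      next
        case False
        then obtain z where z: "z \<in> ?C" "s \<in> side y z" using s side_rec[OF xy] by blast
        have yz: "adj y z" using C[OF z(1)] by blast
        have yx: "y \<noteq> s" "x \<noteq> s" using False s not_in_side[OF xy] by blast+
        have sN: "s \<in> N" using s by blast
        obtain t where t: "adj s t" "y \<in> side s t" using ex_side[OF node_V[OF sN] node_V[OF y] yx(1)] by blast
        have xt: "x \<in> side s t" by (rule same_side[OF adj_sym[OF xy] t(1) yx t(2)])
        obtain \<kappa> where \<kappa>: "\<And>z'. adj s z' \<Longrightarrow> y \<notin> side s z' \<Longrightarrow> (\<Sum>i\<in>L. of_nat (me s z' i) * X z i) = r s z' + \<kappa>"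
          using X[OF z(1), of s] sN z(2) by blast
        show ?thesis
        \<comment> \<open>The correction shifts all the equations at \<open>s\<close> by the same
          amount, so it is absorbed into the constant.\<close>
        proof (intro exI[of _ "\<kappa> + \<sigma> z * of_nat (l y s)"] allI impI)
          fix z' assume z': "adj s z'" "x \<notin> side s z'"
          have zt: "z' \<noteq> t" using z'(2) xt by blast
          have ny: "y \<notin> side s z'" using side_unique[OF z'(1) t(1) _ t(2)] zt by blast
          show "(\<Sum>i\<in>L. of_nat (me s z' i) * \<xi> i) = r s z' + (\<kappa> + \<sigma> z * of_nat (l y s))"
            unfolding expand[OF yz z'(1) side_sub[OF yz z(2) z'(1) ny]] \<kappa>[OF z'(1) ny] me_ell_sum[OF y sN t z'(1) zt]
            by simp
        qed
      qed
    qed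
  qed
qed

text \<open>The two halves are independent: a monomial pointing away from both ends of the edge is
  supported in the half containing its node.\<close>

lemma solve_edge:
  assumes uv: "adj u v"
  shows "\<exists>\<xi>::'v \<Rightarrow> complex. \<forall>s\<in>N. \<exists>\<kappa>. \<forall>z. adj s z \<longrightarrow> u \<notin> side s z \<longrightarrow> v \<notin> side s z \<longrightarrow>
    (\<Sum>i\<in>L. of_nat (me s z i) * \<xi> i) = r s z + \<kappa>"
proof -
  obtain X where X: "\<And>s. s \<in> N \<inter> side u v \<Longrightarrow> \<exists>\<kappa>. \<forall>z. adj s z \<longrightarrow> u \<notin> side s z \<longrightarrow>
    (\<Sum>i\<in>L. of_nat (me s z i) * (X i::complex)) = r s z + \<kappa>" using solve_side[OF uv] by blast
  obtain Y where Y: "\<And>s. s \<in> N \<inter> side v u \<Longrightarrow> \<exists>\<kappa>. \<forall>z. adj s z \<longrightarrow> v \<notin> side s z \<longrightarrow>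
    (\<Sum>i\<in>L. of_nat (me s z i) * (Y i::complex)) = r s z + \<kappa>" using solve_side[OF adj_sym[OF uv]] by blast
  let ?xi = "\<lambda>i. if i \<in> side u v then X i else Y i"
  have eq: "(\<Sum>i\<in>L. of_nat (me s z i) * ?xi i) = (\<Sum>i\<in>L. of_nat (me s z i) * F i)"
    if sz: "adj s z" and F: "\<And>i. i \<in> side s z \<Longrightarrow> ?xi i = F i" for s z and F :: "'v \<Rightarrow> complex"
  proof (rule sum.cong[OF refl])
    fix i show "of_nat (me s z i) * ?xi i = of_nat (me s z i) * F i"
      using F[of i] me_off[OF sz, of i] by (cases "i \<in> side s z") simp_all
  qed
  show ?thesis
  proof (intro exI[of _ ?xi] ballI)
    fix s assume s: "s \<in> N"
    show "\<exists>\<kappa>. \<forall>z. adj s z \<longrightarrow> u \<notin> side s z \<longrightarrow> v \<notin> side s z \<longrightarrow> (\<Sum>i\<in>L. of_nat (me s z i) * ?xi i) = r s z + \<kappa>"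
    proof (cases "s \<in> side u v")
      case True
      obtain \<kappa> where \<kappa>: "\<And>z. adj s z \<Longrightarrow> u \<notin> side s z \<Longrightarrow> (\<Sum>i\<in>L. of_nat (me s z i) * X i) = r s z + \<kappa>"
        using X[of s] s True by blast
      show ?thesis
      proof (intro exI[of _ \<kappa>] allI impI)
        fix z assume z: "adj s z" "u \<notin> side s z" "v \<notin> side s z"
        have "?xi i = X i" if "i \<in> side s z" for i using side_sub[OF uv True z(1,2)] that by auto
        then show "(\<Sum>i\<in>L. of_nat (me s z i) * ?xi i) = r s z + \<kappa>" using eq[OF z(1), of X] \<kappa>[OF z(1,2)] by simp
      qed
    next
      case False
      then have F: "s \<in> side v u" using side_opposite[OF uv node_V[OF s]] by blast
      obtain \<kappa> where \<kappa>: "\<And>z. adj s z \<Longrightarrow> v \<notin> side s z \<Longrightarrow> (\<Sum>i\<in>L. of_nat (me s z i) * Y i) = r s z + \<kappa>"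
        using Y[of s] s F by blast
      show ?thesis
      proof (intro exI[of _ \<kappa>] allI impI)
        fix z assume z: "adj s z" "u \<notin> side s z" "v \<notin> side s z"
        have "?xi i = Y i" if "i \<in> side s z" for i
          using side_sub[OF adj_sym[OF uv] F z(1,3)] that side_opposite[OF uv side_memV[OF that]] by auto
        then show "(\<Sum>i\<in>L. of_nat (me s z i) * ?xi i) = r s z + \<kappa>" using eq[OF z(1), of Y] \<kappa>[OF z(1,3)] by simp
      qed
    qed
  qed
qed

end

section \<open>Splice type systems\<close>

context splice_system
begin

abbreviation "F \<equiv> splice_F V adj alpha c g"

definition gens :: "'v series set" where
  "gens = {F v i | v i. v \<in> N \<and> i < valency adj v - 2}"

lemma splice_ideal_gens: "splice_ideal V adj alpha c g = ideal_span L gens"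
  by (simp add: splice_ideal_def gens_def)

definition Fc :: "'v \<Rightarrow> nat \<Rightarrow> 'v cs" where
  "Fc v i = Abs_cs (F v i)"

lemma conv_F:
  assumes "v \<in> N" "i < valency adj v - 2"
  shows "conv_series L (F v i)"
proof -
  have "conv_series L (f_part V adj alpha c v i)"
    unfolding f_part_def
  proof -
    have "conv_series L (\<lambda>m. \<Sum>u\<in>A. c v u i * monomial_term (me v u) m)" if "A \<subseteq> nbrs adj v" for A
      using finite_subset[OF that finite_nbrs] that
    proof (induction A rule: finite_induct)
      case empty then show ?case by (simp add: conv_series_zero)
    next
      case (insert u A)
      have "me v u \<in> exps L" by (rule me_exps) (use insert.prems in \<open>simp add: nbrs_def\<close>)
      then have "conv_series L (\<lambda>m. c v u i * monomial_term (me v u) m)"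
        by (intro conv_series_cmult conv_series_monomial)
      then show ?case using insert by (simp add: conv_series_add)
    qed
    then show "conv_series L (\<lambda>m. \<Sum>u\<in>nbrs adj v. c v u i * monomial_term (me v u) m)" by simp
  qed
  then show ?thesis unfolding splice_F_def by (rule conv_series_add[OF _ g_conv[OF assms]])
qed

lemma conv_gens: "f \<in> gens \<Longrightarrow> conv_series L f"
  unfolding gens_def using conv_F by blast

lemma cnth_Fc: "v \<in> N \<Longrightarrow> i < valency adj v - 2 \<Longrightarrow> cnth (Fc v i) = F v i"
  unfolding Fc_def by (rule cnth_Abs_cs[OF finite_leaves conv_F])

lemma F_eq: "F v i m = (\<Sum>u\<in>nbrs adj v. c v u i * monomial_term (me v u) m) + g v i m"
  by (simp add: splice_F_def f_part_def)

subsection \<open>Arcs with prescribed orders\<close>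

context
  fixes u v :: 'v and P Q :: nat and \<omega> :: "'v \<Rightarrow> nat"
  assumes uv: "adj u v" and PQ: "P > 0" "Q > 0"
    and weight_eq: "\<And>x. x \<in> L \<Longrightarrow> real (\<omega> x) = real P * wv u x + real Q * wv v x"
begin

lemma weight_pos: "x \<in> L \<Longrightarrow> \<omega> x > 0"
proof -
  assume x: "x \<in> L"
  have "u \<in> N \<or> v \<in> N" using leaf_nbr_node[OF _ uv] nodeI[OF adj_V(1)[OF uv]] by blast
  then have "wv u x > 0 \<or> wv v x > 0" using wv_pos x by blast
  then have "0 < real P * wv u x + real Q * wv v x"
    using wv_nonneg[of u x] wv_nonneg[of v x] PQ by (auto intro: add_pos_nonneg add_nonneg_pos)
  then show ?thesis using weight_eq[OF x] by simp
qed

lemma nwt_eq_wt: "real (nwt L \<omega> m) = wt L (\<lambda>x. real P * wv u x + real Q * wv v x) m"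
  unfolding nwt_def wt_def by (simp add: weight_eq)

text \<open>The edge at \<open>s\<close> leading to \<open>[u,v]\<close>; at \<open>u\<close> and
  \<open>v\<close> it is \<open>[u,v]\<close> itself. Its monomial is the one missing from the
  leading equations at \<open>s\<close>.\<close>

definition toward :: "'v \<Rightarrow> 'v" where
  "toward s = (SOME t. adj s t \<and> (u \<in> side s t \<or> v \<in> side s t))"

lemma toward: "s \<in> N \<Longrightarrow> adj s (toward s)" "s \<in> N \<Longrightarrow> u \<in> side s (toward s) \<or> v \<in> side s (toward s)"
proof -
  assume s: "s \<in> N"
  have "\<exists>t. adj s t \<and> (u \<in> side s t \<or> v \<in> side s t)"
  proof (cases "u = s")
    case True then show ?thesis using uv side_self[OF uv] by blast
  next
    case False then show ?thesis using ex_side[OF node_V[OF s] adj_V(1)[OF uv]] by blast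
  qed
  from someI_ex[OF this] show "adj s (toward s)" "u \<in> side s (toward s) \<or> v \<in> side s (toward s)"
    unfolding toward_def by blast+
qed

lemma away: "s \<in> N \<Longrightarrow> adj s z \<Longrightarrow> z \<noteq> toward s \<Longrightarrow> u \<notin> side s z \<and> v \<notin> side s z"
proof -
  assume s: "s \<in> N" and z: "adj s z" "z \<noteq> toward s"
  have "(u \<in> side s (toward s) \<or> u = s) \<and> (v \<in> side s (toward s) \<or> v = s)"
    using toward[OF s] edge_side[OF uv s toward(1)[OF s]] edge_side[OF adj_sym[OF uv] s toward(1)[OF s]] by blast
  then show ?thesis using side_unique[OF z(1) toward(1)[OF s]] z(2) not_in_side[OF z(1)] by blast
qed

text \<open>The real common weight given by \<open>good_edge\<close> is the weight of an actual
  monomial, hence a natural number; a node has an edge other than the one towards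
  \<open>[u,v]\<close>.\<close>

lemma ex_level:
  assumes s: "s \<in> N"
  shows "\<exists>W. (\<forall>z. adj s z \<longrightarrow> z \<noteq> toward s \<longrightarrow> nwt L \<omega> (me s z) = W) \<and> nwt L \<omega> (me s (toward s)) > W \<and>
    (\<forall>i m. i < valency adj s - 2 \<longrightarrow> g s i m \<noteq> 0 \<longrightarrow> nwt L \<omega> m > W)"
proof -
  let ?p = "\<lambda>x. real P * wv u x + real Q * wv v x"
  have "good ?p s (toward s) (real P * E u s + real Q * E v s)"
    by (rule good_edge[OF uv s toward(1)[OF s]]) (use PQ toward(2)[OF s] in auto)
  then obtain W where W: "\<And>z. adj s z \<Longrightarrow> z \<noteq> toward s \<Longrightarrow> real (nwt L \<omega> (me s z)) = W"
    "real (nwt L \<omega> (me s (toward s))) > W" "\<And>i m. i < valency adj s - 2 \<Longrightarrow> g s i m \<noteq> 0 \<Longrightarrow> real (nwt L \<omega> m) > W"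
    unfolding good_def nwt_eq_wt by blast
  obtain e where e: "adj s e" "e \<noteq> toward s" using ex_other_nbr[OF s toward(1)[OF s]] by blast
  have "W = real (nwt L \<omega> (me s e))" using W(1)[OF e] by simp
  then show ?thesis using W by (intro exI[of _ "nwt L \<omega> (me s e)"]) auto
qed

definition level :: "'v \<Rightarrow> nat" where
  "level s = (SOME W. (\<forall>z. adj s z \<longrightarrow> z \<noteq> toward s \<longrightarrow> nwt L \<omega> (me s z) = W) \<and> nwt L \<omega> (me s (toward s)) > W \<and>
    (\<forall>i m. i < valency adj s - 2 \<longrightarrow> g s i m \<noteq> 0 \<longrightarrow> nwt L \<omega> m > W))"

lemma level:
  assumes "s \<in> N"
  shows "\<And>z. adj s z \<Longrightarrow> z \<noteq> toward s \<Longrightarrow> nwt L \<omega> (me s z) = level s" "nwt L \<omega> (me s (toward s)) > level s"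
    "\<And>i m. i < valency adj s - 2 \<Longrightarrow> g s i m \<noteq> 0 \<Longrightarrow> nwt L \<omega> m > level s"
  using someI_ex[OF ex_level[OF assms], folded level_def] by blast+

lemma F_level:
  assumes s: "s \<in> N" "i < valency adj s - 2" and F: "cnth (Fc s i) m \<noteq> 0"
  shows "level s \<le> nwt L \<omega> m"
proof -
  have "g s i m \<noteq> 0 \<or> (\<exists>z\<in>nbrs adj s. m = me s z)"
  proof (rule ccontr)
    assume h: "\<not> (g s i m \<noteq> 0 \<or> (\<exists>z\<in>nbrs adj s. m = me s z))"
    then have "(\<Sum>z\<in>nbrs adj s. c s z i * monomial_term (me s z) m) = 0"
      by (intro sum.neutral) (auto simp: monomial_term_def)
    then show False using F h unfolding cnth_Fc[OF s] F_eq by simp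
  qed
  then show ?thesis
  proof
    assume "g s i m \<noteq> 0" then show ?thesis using level(3)[OF s] by (simp add: less_imp_le)
  next
    assume "\<exists>z\<in>nbrs adj s. m = me s z"
    then obtain z where z: "adj s z" "m = me s z" by (auto simp: nbrs_def)
    then show ?thesis using level(1)[OF s(1) z(1)] level(2)[OF s(1)] by (cases "z = toward s") auto
  qed
qed

text \<open>At weight \<open>level s\<close> only the admissible monomials pointing away from
  \<open>[u,v]\<close> survive. The arbitrary \<open>h\<close> lets the statement serve both for
  values and for derivatives.\<close>

lemma lead_sum:
  assumes s: "s \<in> N" "i < valency adj s - 2"
  shows "(\<Sum>m\<in>{m \<in> exps L. nwt L \<omega> m = level s}. cnth (Fc s i) m * h m) =
    (\<Sum>z\<in>nbrs adj s - {toward s}. c s z i * h (me s z))"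
proof -
  let ?D = "{m \<in> exps L. nwt L \<omega> m = level s}"
  have D: "finite ?D"
    by (rule finite_subset[OF _ finite_nwt_le[OF finite_leaves weight_pos, where N = "level s"]]) auto
  have "(\<Sum>m\<in>?D. cnth (Fc s i) m * h m) =
    (\<Sum>m\<in>?D. \<Sum>z\<in>nbrs adj s - {toward s}. c s z i * (monomial_term (me s z) m * h m))"
  proof (rule sum.cong[OF refl])
    fix m assume m: "m \<in> ?D"
    have "g s i m = 0" using level(3)[OF s(1), of i m] s(2) m by auto
    moreover have "monomial_term (me s (toward s)) m = 0" using level(2)[OF s(1)] m by (auto simp: monomial_term_def)
    ultimately have "cnth (Fc s i) m = (\<Sum>z\<in>nbrs adj s - {toward s}. c s z i * monomial_term (me s z) m)"
      unfolding cnth_Fc[OF s] F_eq using finite_nbrs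
      by (simp, intro sum.mono_neutral_right) auto
    then show "cnth (Fc s i) m * h m = (\<Sum>z\<in>nbrs adj s - {toward s}. c s z i * (monomial_term (me s z) m * h m))"
      by (simp add: sum_distrib_right mult.assoc)
  qed
  also have "\<dots> = (\<Sum>z\<in>nbrs adj s - {toward s}. c s z i * (\<Sum>m\<in>?D. monomial_term (me s z) m * h m))"
    unfolding sum_distrib_left by (rule sum.swap)
  also have "\<dots> = (\<Sum>z\<in>nbrs adj s - {toward s}. c s z i * h (me s z))"
  proof (rule sum.cong[OF refl])
    fix z assume z: "z \<in> nbrs adj s - {toward s}"
    have "me s z \<in> ?D" using z level(1)[OF s(1)] me_exps by (auto simp: nbrs_def)
    moreover have "(\<Sum>m\<in>?D. monomial_term (me s z) m * h m) = (\<Sum>m\<in>?D. if m = me s z then h m else 0)"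
      by (rule sum.cong) (auto simp: monomial_term_def)
    ultimately have "(\<Sum>m\<in>?D. monomial_term (me s z) m * h m) = h (me s z)" using D by simp
    then show "c s z i * (\<Sum>m\<in>?D. monomial_term (me s z) m * h m) = c s z i * h (me s z)" by simp
  qed
  finally show ?thesis .
qed

lemma arc_lead:
  assumes s: "s \<in> N" "i < valency adj s - 2"
  shows "fps_nth (arc L \<omega> y (Fc s i)) (level s) =
    (\<Sum>z\<in>nbrs adj s - {toward s}. c s z i * (\<Prod>x\<in>L. fps_nth (y x) 0 ^ me s z x))"
  using lead_sum[OF s, of "\<lambda>m. \<Prod>x\<in>L. fps_nth (y x) 0 ^ m x"]
    arc_nth_lead[OF finite_leaves weight_pos F_level[OF s], where y = y] by simp

text \<open>Hensel lifting: the equations are solved modulo higher and higher powers of the parameter.\<close>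
lemma ex_arc:
  "\<exists>y. (\<forall>x\<in>L. fps_nth (y x) 0 \<noteq> 0) \<and>
    (\<forall>s\<in>N. \<forall>i<valency adj s - 2. \<forall>n<level s + Suc k. fps_nth (arc L \<omega> y (Fc s i)) n = 0)"
proof (induction k)
  case 0
  have "\<exists>b. \<forall>s\<in>N. (\<forall>e\<in>nbrs adj s - {toward s}. b s e \<noteq> 0) \<and>
    (\<forall>i<valency adj s - 2. (\<Sum>e\<in>nbrs adj s - {toward s}. b s e * c s e i) = 0)"
    by (rule bchoice, intro ballI kernel_coeffs toward(1))
  then obtain b where b': "\<forall>s\<in>N. (\<forall>e\<in>nbrs adj s - {toward s}. b s e \<noteq> 0) \<and>
    (\<forall>i<valency adj s - 2. (\<Sum>e\<in>nbrs adj s - {toward s}. b s e * c s e i) = 0)" by (elim exE)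
  have b: "\<And>s e. s \<in> N \<Longrightarrow> e \<in> nbrs adj s - {toward s} \<Longrightarrow> b s e \<noteq> 0"
    "\<And>s i. s \<in> N \<Longrightarrow> i < valency adj s - 2 \<Longrightarrow> (\<Sum>e\<in>nbrs adj s - {toward s}. b s e * c s e i) = 0"
    using b' by blast+
  \<comment> \<open>Taking logarithms makes the monomial equations linear. The undetermined constant
    multiplies all monomials at \<open>s\<close> by one factor, which the homogeneous leading
    equations do not notice.\<close>
  obtain \<xi> :: "'v \<Rightarrow> complex" where \<xi>: "\<And>s. s \<in> N \<Longrightarrow> \<exists>\<kappa>. \<forall>z. adj s z \<longrightarrow> u \<notin> side s z \<longrightarrow> v \<notin> side s z \<longrightarrow>
    (\<Sum>i\<in>L. of_nat (me s z i) * \<xi> i) = Ln (b s z) + \<kappa>"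
    using solve_edge[OF uv, of "\<lambda>s z. Ln (b s z)"] by blast
  define y where "y x = fps_const (exp (\<xi> x))" for x
  show ?case
  proof (intro exI[of _ y] conjI ballI allI impI)
    show "fps_nth (y x) 0 \<noteq> 0" for x by (simp add: y_def)
    fix s i n assume s: "s \<in> N" "i < valency adj s - 2" and n: "n < level s + Suc 0"
    show "fps_nth (arc L \<omega> y (Fc s i)) n = 0"
    proof (cases "n = level s")
      case False
      then have lt: "n < level s" using n by simp
      show ?thesis
        by (rule arc_nth_low[OF finite_leaves weight_pos]) (assumption, rule less_le_trans[OF lt F_level[OF s]], assumption)
    next
      case True
      obtain \<kappa> where \<kappa>: "\<And>z. adj s z \<Longrightarrow> u \<notin> side s z \<Longrightarrow> v \<notin> side s z \<Longrightarrow>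
        (\<Sum>i\<in>L. of_nat (me s z i) * \<xi> i) = Ln (b s z) + \<kappa>" using \<xi>[OF s(1)] by blast
      have "(\<Prod>x\<in>L. fps_nth (y x) 0 ^ me s z x) = b s z * exp \<kappa>" if z: "z \<in> nbrs adj s - {toward s}" for z
      proof -
        have "(\<Prod>x\<in>L. fps_nth (y x) 0 ^ me s z x) = exp (\<Sum>x\<in>L. of_nat (me s z x) * \<xi> x)"
          unfolding y_def exp_sum[OF finite_leaves] by (simp add: exp_of_nat_mult)
        also have "\<dots> = exp (Ln (b s z)) * exp \<kappa>"
          using \<kappa>[of z] away[OF s(1), of z] z by (simp add: nbrs_def exp_add)
        also have "exp (Ln (b s z)) = b s z" by (rule exp_Ln) (rule b(1)[OF s(1) z])
        finally show ?thesis .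
      qed
      then have "fps_nth (arc L \<omega> y (Fc s i)) n = (\<Sum>z\<in>nbrs adj s - {toward s}. b s z * c s z i) * exp \<kappa>"
        unfolding True arc_lead[OF s] by (simp add: sum_distrib_left mult_ac)
      then show ?thesis using b(2)[OF s] by simp
    qed
  qed
next
  case (Suc k)
  let ?k = "Suc k"
  obtain y where y': "\<forall>x\<in>L. fps_nth (y x) 0 \<noteq> 0"
    "\<forall>s\<in>N. \<forall>i<valency adj s - 2. \<forall>n<level s + ?k. fps_nth (arc L \<omega> y (Fc s i)) n = 0"
    using Suc by (elim exE conjE)
  have y: "\<And>x. x \<in> L \<Longrightarrow> fps_nth (y x) 0 \<noteq> 0"
    "\<And>s i n. s \<in> N \<Longrightarrow> i < valency adj s - 2 \<Longrightarrow> n < level s + ?k \<Longrightarrow> fps_nth (arc L \<omega> y (Fc s i)) n = 0"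
    using y' by blast+
  define A where "A s z = (\<Prod>x\<in>L. fps_nth (y x) 0 ^ me s z x)" for s z
  have A: "A s z \<noteq> 0" for s z unfolding A_def using y(1) finite_leaves by simp
  define T where "T s i = fps_nth (arc L \<omega> y (Fc s i)) (level s + ?k)" for s i
  \<comment> \<open>The errors \<open>T\<close> at the first unsolved order are to be cancelled by a
    change \<open>r\<close> of the values of the leading monomials.\<close>
  have "\<exists>r. \<forall>s\<in>N. \<forall>i<valency adj s - 2. (\<Sum>e\<in>nbrs adj s - {toward s}. r s e * c s e i) = - T s i"
    by (rule bchoice, intro ballI surj_coeffs toward(1))
  then obtain r where r: "\<And>s i. s \<in> N \<Longrightarrow> i < valency adj s - 2 \<Longrightarrow> (\<Sum>e\<in>nbrs adj s - {toward s}. r s e * c s e i) = - T s i"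
    by blast
  \<comment> \<open>Dividing by the current monomial value turns the desired change into a
    logarithmic one.\<close>
  obtain \<xi> :: "'v \<Rightarrow> complex" where \<xi>: "\<And>s. s \<in> N \<Longrightarrow> \<exists>\<kappa>. \<forall>z. adj s z \<longrightarrow> u \<notin> side s z \<longrightarrow> v \<notin> side s z \<longrightarrow>
    (\<Sum>i\<in>L. of_nat (me s z i) * \<xi> i) = r s z / A s z + \<kappa>"
    using solve_edge[OF uv, of "\<lambda>s z. r s z / A s z"] by blast
  define y' where "y' x = y x * (1 + fps_const (\<xi> x) * fps_X ^ ?k)" for x
  show ?case
  proof (intro exI[of _ y'] conjI ballI allI impI)
    show "fps_nth (y' x) 0 \<noteq> 0" if "x \<in> L" for x using y(1)[OF that] by (simp add: y'_def)
    fix s i n assume s: "s \<in> N" "i < valency adj s - 2" and n: "n < level s + Suc ?k"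
    have pert: "fps_nth (arc L \<omega> y' (Fc s i)) n = fps_nth (arc L \<omega> y (Fc s i)) n + (if n = level s + ?k then
       \<Sum>m\<in>{m \<in> exps L. nwt L \<omega> m = level s}.
         cnth (Fc s i) m * (\<Prod>x\<in>L. fps_nth (y x) 0 ^ m x) * (\<Sum>x\<in>L. of_nat (m x) * \<xi> x) else 0)"
      unfolding y'_def[abs_def]
      by (rule arc_perturb[OF finite_leaves weight_pos _ F_level[OF s]]) (use n in auto)
    show "fps_nth (arc L \<omega> y' (Fc s i)) n = 0"
    proof (cases "n = level s + ?k")
      case False
      then show ?thesis using n y(2)[OF s, of n] unfolding pert by simp
    next
      case True
      obtain \<kappa> where \<kappa>: "\<And>z. adj s z \<Longrightarrow> u \<notin> side s z \<Longrightarrow> v \<notin> side s z \<Longrightarrow>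
        (\<Sum>i\<in>L. of_nat (me s z i) * \<xi> i) = r s z / A s z + \<kappa>" using \<xi>[OF s(1)] by blast
      \<comment> \<open>The leading equation, already solved, removes the contribution of the
        undetermined constant \<open>\<kappa>\<close>.\<close>
      have A0: "(\<Sum>z\<in>nbrs adj s - {toward s}. c s z i * A s z) = 0"
        using y(2)[OF s, of "level s"] unfolding arc_lead[OF s] A_def by simp
      have "(\<Sum>m\<in>{m \<in> exps L. nwt L \<omega> m = level s}.
         cnth (Fc s i) m * (\<Prod>x\<in>L. fps_nth (y x) 0 ^ m x) * (\<Sum>x\<in>L. of_nat (m x) * \<xi> x))
        = (\<Sum>z\<in>nbrs adj s - {toward s}. c s z i * (A s z * (\<Sum>x\<in>L. of_nat (me s z x) * \<xi> x)))"
        unfolding mult.assoc lead_sum[OF s] A_def ..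
      also have "\<dots> = (\<Sum>z\<in>nbrs adj s - {toward s}. r s z * c s z i + \<kappa> * (c s z i * A s z))"
      proof (rule sum.cong[OF refl])
        fix z assume z: "z \<in> nbrs adj s - {toward s}"
        have "(\<Sum>x\<in>L. of_nat (me s z x) * \<xi> x) = r s z / A s z + \<kappa>"
          using \<kappa>[of z] away[OF s(1), of z] z by (simp add: nbrs_def)
        then show "c s z i * (A s z * (\<Sum>x\<in>L. of_nat (me s z x) * \<xi> x)) = r s z * c s z i + \<kappa> * (c s z i * A s z)"
          using A[of s z] by (simp add: field_simps)
      qed
      also have "\<dots> = - T s i" unfolding sum.distrib sum_distrib_left[symmetric] A0 r[OF s] by simp
      finally show ?thesis unfolding pert using True by (simp add: T_def)
    qed
  qed
qed

text \<open>Along an arc solving the equations beyond order \<open>nwt L \<omega> a\<close> every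
  element of the ideal vanishes at that order, whereas there the coefficient of \<open>f\<close> is
  \<open>f a\<close> times a product of nonzero constants.\<close>

lemma no_initial_monomial_integral:
  assumes f: "f \<in> ideal_span L gens" and fa: "f a \<noteq> 0"
    and lt: "\<And>m. f m \<noteq> 0 \<Longrightarrow> m \<noteq> a \<Longrightarrow> nwt L \<omega> a < nwt L \<omega> m"
  shows False
proof -
  have cf: "conv_series L f" and sp: "Abs_cs f \<in> cs_ideal.span (Abs_cs ` gens)"
    using f ideal_span_iff[OF finite_leaves conv_gens] by blast+
  have cn: "cnth (Abs_cs f) = f" by (rule cnth_Abs_cs[OF finite_leaves cf])
  obtain y where y': "\<forall>x\<in>L. fps_nth (y x) 0 \<noteq> 0"
    "\<forall>s\<in>N. \<forall>i<valency adj s - 2. \<forall>n<level s + Suc (nwt L \<omega> a). fps_nth (arc L \<omega> y (Fc s i)) n = 0"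
    using ex_arc[of "nwt L \<omega> a"] by (elim exE conjE)
  have y: "\<And>x. x \<in> L \<Longrightarrow> fps_nth (y x) 0 \<noteq> 0"
    "\<And>s i n. s \<in> N \<Longrightarrow> i < valency adj s - 2 \<Longrightarrow> n < level s + Suc (nwt L \<omega> a) \<Longrightarrow> fps_nth (arc L \<omega> y (Fc s i)) n = 0"
    using y' by blast+
  have "fps_nth (arc L \<omega> y (Abs_cs f)) (nwt L \<omega> a) = 0"
  proof (rule arc_span_vanish[OF finite_leaves weight_pos sp])
    fix h n assume h: "h \<in> Abs_cs ` gens" and n: "n < Suc (nwt L \<omega> a)"
    obtain s i where s: "s \<in> N" "i < valency adj s - 2" "h = Fc s i"
      using h unfolding gens_def Fc_def by blast
    have "n < level s + Suc (nwt L \<omega> a)" using n by simp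
    then show "fps_nth (arc L \<omega> y h) n = 0" unfolding s(3) by (rule y(2)[OF s(1,2)])
  qed auto
  moreover have "fps_nth (arc L \<omega> y (Abs_cs f)) (nwt L \<omega> a) = f a * (\<Prod>x\<in>L. fps_nth (y x) 0 ^ a x)"
  proof -
    let ?D = "{m \<in> exps L. nwt L \<omega> m = nwt L \<omega> a}"
    have D: "finite ?D"
      by (rule finite_subset[OF _ finite_nwt_le[OF finite_leaves weight_pos, where N = "nwt L \<omega> a"]]) auto
    have aD: "a \<in> ?D" using conv_series_exps[OF cf fa] by simp
    have le: "nwt L \<omega> a \<le> nwt L \<omega> m" if "cnth (Abs_cs f) m \<noteq> 0" for m
      using lt[of m] that unfolding cn by (cases "m = a") auto
    have "fps_nth (arc L \<omega> y (Abs_cs f)) (nwt L \<omega> a) = (\<Sum>m\<in>?D. cnth (Abs_cs f) m * (\<Prod>x\<in>L. fps_nth (y x) 0 ^ m x))"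
      by (rule arc_nth_lead[OF finite_leaves weight_pos]) (assumption, rule le, assumption)
    also have "\<dots> = (\<Sum>m\<in>?D. f m * (\<Prod>x\<in>L. fps_nth (y x) 0 ^ m x))" unfolding cn ..
    also have "\<dots> = (\<Sum>m\<in>?D. if m = a then f a * (\<Prod>x\<in>L. fps_nth (y x) 0 ^ a x) else 0)"
    proof (rule sum.cong[OF refl])
      fix m assume m: "m \<in> ?D"
      have "f m = 0" if "m \<noteq> a" using lt[OF _ that] m by (cases "f m = 0") auto
      then show "f m * (\<Prod>x\<in>L. fps_nth (y x) 0 ^ m x) = (if m = a then f a * (\<Prod>x\<in>L. fps_nth (y x) 0 ^ a x) else 0)"
        by (cases "m = a") auto
    qed
    finally show ?thesis using D aD by simp
  qed
  ultimately show False using fa y(1) finite_leaves by simp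
qed

end

text \<open>A large multiple of \<open>w\<close>, with its coefficients rounded up, becomes an
  integral interior point of the same cone. Rounding costs a bounded amount at \<open>a\<close>,
  while the gap above \<open>a\<close> grows with the multiple.\<close>

lemma no_initial_monomial:
  assumes uv: "adj u v" and ab: "a0 \<ge> 0" "b0 \<ge> 0" and w: "\<And>x. w x = a0 * wv u x + b0 * wv v x"
    and f: "f \<in> ideal_span L gens"
  shows "\<not> initial_monomial L w f a"
proof
  assume im: "initial_monomial L w f a"
  have w0: "w x \<ge> 0" for x unfolding w using ab wv_nonneg by simp
  obtain \<eta> where \<eta>: "\<eta> > 0" "\<forall>m. wt L w a < wt L w m \<longrightarrow> wt L w a + \<eta> \<le> wt L w m"
    using wt_gap[OF finite_leaves, where w = w and a = a, OF w0] by (elim exE conjE)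
  let ?U = "\<lambda>m. wt L (wv u) m" and ?V = "\<lambda>m. wt L (wv v) m"
  \<comment> \<open>Rounding raises each coefficient by at most 1, so the weight of \<open>a\<close>
    grows by at most its two cone weights, which this \<open>M\<close> makes smaller than the scaled
    gap.\<close>
  obtain M :: nat where "(?U a + ?V a) / \<eta> < real M" using reals_Archimedean2 by blast
  then have M: "?U a + ?V a < real M * \<eta>" using \<eta>(1) by (simp add: pos_divide_less_eq)
  \<comment> \<open>The successor of the floor is positive even when \<open>a0 = 0\<close>, which
    moves a boundary point into the interior.\<close>
  define P where "P = Suc (nat \<lfloor>real M * a0\<rfloor>)"
  define Q where "Q = Suc (nat \<lfloor>real M * b0\<rfloor>)"
  have PQ: "real M * a0 \<le> real P" "real P \<le> real M * a0 + 1" "real M * b0 \<le> real Q" "real Q \<le> real M * b0 + 1"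
  proof -
    have "x \<le> real (Suc (nat \<lfloor>x\<rfloor>)) \<and> real (Suc (nat \<lfloor>x\<rfloor>)) \<le> x + 1" if "x \<ge> 0" for x :: real
      using that by (simp add: of_nat_nat) linarith
    from this[of "real M * a0"] this[of "real M * b0"] show "real M * a0 \<le> real P" "real P \<le> real M * a0 + 1"
      "real M * b0 \<le> real Q" "real Q \<le> real M * b0 + 1" unfolding P_def Q_def using ab by simp_all
  qed
  define \<omega> where "\<omega> x = P * nat \<lfloor>wv u x\<rfloor> + Q * nat \<lfloor>wv v x\<rfloor>" for x
  \<comment> \<open>Weight vectors have natural entries, so the floor loses nothing.\<close>
  have fl: "real (nat \<lfloor>wv u x\<rfloor>) = wv u x" for u x by (simp add: wvec_def)
  have weight_eq: "real (\<omega> x) = real P * wv u x + real Q * wv v x" for x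
    unfolding \<omega>_def by (simp add: fl)
  have nw: "real (nwt L \<omega> m) = real P * ?U m + real Q * ?V m" for m
    unfolding nwt_def by (simp add: weight_eq wt_def sum_distrib_left sum.distrib algebra_simps)
  have ww: "wt L w m = a0 * ?U m + b0 * ?V m" for m
    unfolding wt_comb[symmetric] w[abs_def] ..
  have UV: "?U m \<ge> 0" "?V m \<ge> 0" for m by (rule wt_nonneg, rule wv_nonneg)+
  show False
  proof (rule no_initial_monomial_integral[OF uv _ _ weight_eq f])
    show "P > 0" "Q > 0" by (simp_all add: P_def Q_def)
    show "f a \<noteq> 0" using im by (simp add: initial_monomial_def)
    fix m assume m: "f m \<noteq> 0" "m \<noteq> a"
    have "wt L w a + \<eta> \<le> wt L w m" using im m \<eta>(2) by (simp add: initial_monomial_def)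
    then have "real M * (wt L w a + \<eta>) \<le> real M * wt L w m" by (rule mult_left_mono) simp
    moreover have "real M * wt L w m \<le> real (nwt L \<omega> m)"
      using mult_right_mono[OF PQ(1) UV(1)[of m]] mult_right_mono[OF PQ(3) UV(2)[of m]] unfolding nw ww
      by (simp add: algebra_simps)
    moreover have "real (nwt L \<omega> a) \<le> real M * wt L w a + (?U a + ?V a)"
      using mult_right_mono[OF PQ(2) UV(1)[of a]] mult_right_mono[OF PQ(4) UV(2)[of a]] unfolding nw ww
      by (simp add: algebra_simps)
    ultimately have "real (nwt L \<omega> a) < real (nwt L \<omega> m)" using M by (simp add: distrib_left)
    then show "nwt L \<omega> a < nwt L \<omega> m" by simp
  qed
qed

end

section \<open>Monomial multiples, restrictions and trinomials in an ideal\<close>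

lemma cs_span_zmon_mult:
  assumes f: "f \<in> cs_ideal.span (G \<union> zmon ` A)" and b: "finite {x. b x \<noteq> 0}"
    and A: "\<And>a. a \<in> A \<Longrightarrow> finite {x. a x \<noteq> 0} \<and> (\<lambda>x. b x + a x) \<in> A'"
  shows "zmon b * f \<in> cs_ideal.span (G \<union> zmon ` A')"
proof -
  obtain t r where t: "t \<subseteq> G \<union> zmon ` A" "f = (\<Sum>h\<in>t. r h * h)"
    using f unfolding cs_ideal.span_explicit by blast
  have "zmon b * f = (\<Sum>h\<in>t. r h * (zmon b * h))"
    unfolding t(2) sum_distrib_left by (simp add: mult.left_commute)
  moreover have "zmon b * h \<in> cs_ideal.span (G \<union> zmon ` A')" if ht: "h \<in> t" for h
  proof -
    consider "h \<in> G" | a where "a \<in> A" "h = zmon a" using ht t(1) by blast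
    then show ?thesis
    proof cases
      case 1
      then show ?thesis by (intro cs_ideal.span_scale cs_ideal.span_base) blast
    next
      case 2
      then show ?thesis using A[OF 2(1)] unfolding 2(2) by (intro cs_ideal.span_base) (simp add: zmon_add[OF b])
    qed
  qed
  ultimately show ?thesis by (simp add: cs_ideal.span_sum cs_ideal.span_scale)
qed

lemma cres_span:
  assumes f: "f \<in> cs_ideal.span G" and G: "\<And>h. h \<in> G \<Longrightarrow> cres K h \<in> cs_ideal.span G'"
  shows "cres K f \<in> cs_ideal.span G'"
proof -
  obtain t r where t: "t \<subseteq> G" "f = (\<Sum>h\<in>t. r h * h)" using f unfolding cs_ideal.span_explicit by blast
  show ?thesis unfolding t(2) cres_sum cres_mult
    by (intro cs_ideal.span_sum cs_ideal.span_scale G) (use t(1) in blast)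
qed

lemma zmon_split:
  assumes m: "finite {x. m x \<noteq> 0}" and b: "b \<le> m"
  shows "zmon m = zmon (m - b) * zmon b"
proof -
  have *: "b x \<le> m x" for x using b by (simp add: le_fun_def)
  have "m x \<noteq> 0" if "b x \<noteq> 0" for x using *[of x] that by simp
  then have 1: "finite {x. (m - b) x \<noteq> 0}" "finite {x. b x \<noteq> 0}" by (auto intro: finite_subset[OF _ m])
  have "(\<lambda>x. (m - b) x + b x) = m" using * by (simp add: fun_eq_iff)
  then show ?thesis unfolding zmon_add[OF 1] by simp
qed

context splice_system
begin

text \<open>Lifts the linear combination of coefficients to an element of the ideal. The remainder
  \<open>h\<close> inherits from \<open>g\<close> every lower bound on weights.\<close>

lemma trinomial:
  assumes s: "s \<in> N" and e: "adj s e1" "adj s e2" "adj s e3" "e1 \<noteq> e2" "e1 \<noteq> e3" "e2 \<noteq> e3"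
  shows "\<exists>f \<gamma>1 \<gamma>2 \<gamma>3 h. \<gamma>1 \<noteq> 0 \<and> \<gamma>2 \<noteq> 0 \<and> \<gamma>3 \<noteq> 0 \<and> f \<in> cs_ideal.span (Abs_cs ` gens) \<and> conv_series L (cnth f) \<and>
    conv_series L (cnth h) \<and> (\<forall>m. cnth h m \<noteq> 0 \<longrightarrow> (\<exists>i<valency adj s - 2. g s i m \<noteq> 0)) \<and>
    f = cconst \<gamma>1 * zmon (me s e1) + cconst \<gamma>2 * zmon (me s e2) + cconst \<gamma>3 * zmon (me s e3) + h"
proof -
  let ?k = "valency adj s - 2"
  obtain \<kappa> where \<kappa>: "\<And>e. e \<in> nbrs adj s \<Longrightarrow> (\<Sum>i<?k. \<kappa> i * c s e i) = 0 \<longleftrightarrow> e \<notin> {e1, e2, e3}"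
    using trinomial_coeffs[OF assms] by blast
  define \<gamma> where "\<gamma> e = (\<Sum>i<?k. \<kappa> i * c s e i)" for e
  have nb: "e1 \<in> nbrs adj s" "e2 \<in> nbrs adj s" "e3 \<in> nbrs adj s" using e by (simp_all add: nbrs_def)
  define f where "f = (\<Sum>i<?k. cconst (\<kappa> i) * Fc s i)"
  define h where "h = (\<Sum>i<?k. cconst (\<kappa> i) * Abs_cs (g s i))"
  have cg: "cnth (Abs_cs (g s i)) = g s i" if "i < ?k" for i
    by (rule cnth_Abs_cs[OF finite_leaves g_conv[OF s that]])
  have cc: "conv_series L (cnth (cconst a))" for a
  proof -
    have "cnth (cconst a :: 'v cs) = (\<lambda>m. a * monomial_term (\<lambda>_. 0) m)"
      by (simp add: fun_eq_iff cnth_cconst monomial_term_def)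
    moreover have "conv_series L (monomial_term (\<lambda>_ :: 'v. 0))"
      by (rule conv_series_monomial) (simp add: exps_def)
    ultimately show ?thesis by (simp only: conv_series_cmult)
  qed
  have fin: "finite {x. me s z x \<noteq> 0}" if "z \<in> nbrs adj s" for z
    by (rule exps_finite_support[OF finite_leaves me_exps]) (use that in \<open>simp add: nbrs_def\<close>)
  show ?thesis
  proof (rule exI[of _ f], rule exI[of _ "\<gamma> e1"], rule exI[of _ "\<gamma> e2"], rule exI[of _ "\<gamma> e3"],
      rule exI[of _ h], intro conjI)
    show "\<gamma> e1 \<noteq> 0" "\<gamma> e2 \<noteq> 0" "\<gamma> e3 \<noteq> 0" using \<kappa>[OF nb(1)] \<kappa>[OF nb(2)] \<kappa>[OF nb(3)] unfolding \<gamma>_def by simp_all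
    show "f \<in> cs_ideal.span (Abs_cs ` gens)" unfolding f_def
      by (intro cs_ideal.span_sum cs_ideal.span_scale cs_ideal.span_base) (use s in \<open>auto simp: Fc_def gens_def\<close>)
    show "conv_series L (cnth f)" unfolding f_def
      by (intro conv_series_sum conv_series_mult[OF finite_leaves] cc) (use s in \<open>simp add: cnth_Fc conv_F\<close>)
    show "conv_series L (cnth h)" unfolding h_def
      by (intro conv_series_sum conv_series_mult[OF finite_leaves] cc) (use s in \<open>simp add: cg g_conv\<close>)
    show "\<forall>m. cnth h m \<noteq> 0 \<longrightarrow> (\<exists>i<?k. g s i m \<noteq> 0)"
    proof (intro allI impI, rule ccontr)
      fix m assume m: "cnth h m \<noteq> 0" "\<not> (\<exists>i<?k. g s i m \<noteq> 0)"
      have "cnth h m = 0" unfolding h_def cnth_sum cnth_cconst_mult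
        by (rule sum.neutral) (use m(2) cg in auto)
      then show False using m(1) by simp
    qed
    show "f = cconst (\<gamma> e1) * zmon (me s e1) + cconst (\<gamma> e2) * zmon (me s e2) + cconst (\<gamma> e3) * zmon (me s e3) + h"
    proof (rule cs_eqI, rule ext)
      fix m
      have "cnth f m = (\<Sum>i<?k. \<kappa> i * F s i m)"
        unfolding f_def cnth_sum cnth_cconst_mult by (rule sum.cong[OF refl]) (simp add: cnth_Fc[OF s])
      also have "\<dots> = (\<Sum>i<?k. \<Sum>z\<in>nbrs adj s. \<kappa> i * c s z i * monomial_term (me s z) m) + (\<Sum>i<?k. \<kappa> i * g s i m)"
        unfolding F_eq by (simp add: algebra_simps sum.distrib sum_distrib_left)
      also have "(\<Sum>i<?k. \<kappa> i * g s i m) = cnth h m"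
        unfolding h_def cnth_sum cnth_cconst_mult by (rule sum.cong[OF refl]) (simp add: cg)
      also have "(\<Sum>i<?k. \<Sum>z\<in>nbrs adj s. \<kappa> i * c s z i * monomial_term (me s z) m) =
        (\<Sum>z\<in>nbrs adj s. \<gamma> z * monomial_term (me s z) m)"
        unfolding \<gamma>_def sum_distrib_right by (rule sum.swap)
      also have "\<dots> = (\<Sum>z\<in>{e1, e2, e3}. \<gamma> z * monomial_term (me s z) m)"
        by (rule sum.mono_neutral_right) (use finite_nbrs nb \<kappa> in \<open>auto simp: \<gamma>_def\<close>)
      also have "\<dots> = \<gamma> e1 * monomial_term (me s e1) m + \<gamma> e2 * monomial_term (me s e2) m + \<gamma> e3 * monomial_term (me s e3) m"
        using e(4-6) by simp
      finally show "cnth f m = cnth (cconst (\<gamma> e1) * zmon (me s e1) + cconst (\<gamma> e2) * zmon (me s e2) + cconst (\<gamma> e3) * zmon (me s e3) + h) m"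
        by (simp add: cnth_add cnth_cconst_mult cnth_zmon[OF fin[OF nb(1)]] cnth_zmon[OF fin[OF nb(2)]] cnth_zmon[OF fin[OF nb(3)]])
    qed
  qed
qed

subsection \<open>Setting two coordinates to zero\<close>

definition unitv :: "'v \<Rightarrow> 'v \<Rightarrow> nat" where
  "unitv i = (\<lambda>x. if x = i then 1 else 0)"

context
  fixes u v j :: 'v and \<omega> :: "'v \<Rightarrow> nat" and G :: "'v cs set"
  assumes u: "u \<in> L" and uv: "adj u v" and j: "j \<in> L" "j \<noteq> u"
  defines "\<omega> \<equiv> l v" and "G \<equiv> Abs_cs ` gens \<union> {zmon (unitv u), zmon (unitv j)}"
begin

text \<open>Membership modulo everything of weight at least \<open>W0\<close>, so that heavy error
  terms can be ignored.\<close>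

definition ideal_above :: "nat \<Rightarrow> 'v cs set" where
  "ideal_above W0 = cs_ideal.span (G \<union> zmon ` {a \<in> exps L. W0 \<le> nwt L \<omega> a})"

text \<open>A substitute for membership in the initial ideal at the weight vector of
  \<open>v\<close>: modulo the ideal generated by \<open>G\<close>, the monomial is a combination of
  strictly heavier ones.\<close>

definition absorbed :: "('v \<Rightarrow> nat) \<Rightarrow> bool" where
  "absorbed a \<longleftrightarrow> a \<in> exps L \<and> zmon a \<in> ideal_above (Suc (nwt L \<omega> a))"

lemma v_node: "v \<in> N"
  by (rule leaf_nbr_node[OF u uv])

lemma weight_gt_0: "x \<in> L \<Longrightarrow> \<omega> x > 0"
  unfolding \<omega>_def by (rule ell_pos[OF v_node])

lemma nwt_wt: "real (nwt L \<omega> m) = wt L (wv v) m"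
  unfolding nwt_def \<omega>_def wt_wv_node[OF v_node] by simp

lemma finite_supp: "a \<in> exps L \<Longrightarrow> finite {x. a x \<noteq> 0}"
  by (rule exps_finite_support[OF finite_leaves])

lemma finite_supp_pos: "a \<in> exps L \<Longrightarrow> finite {x. 0 < a x}"
  using finite_supp by simp

lemma ideal_above_mono: "W0 \<le> W1 \<Longrightarrow> ideal_above W1 \<subseteq> ideal_above W0"
  unfolding ideal_above_def by (rule cs_ideal.span_mono) auto

lemma ideal_above_mult: "f \<in> ideal_above W0 \<Longrightarrow> b \<in> exps L \<Longrightarrow> zmon b * f \<in> ideal_above (nwt L \<omega> b + W0)"
  unfolding ideal_above_def by (rule cs_span_zmon_mult) (auto simp: nwt_add exps_add finite_supp_pos)

lemma absorbed_le:
  assumes "absorbed a" "a \<le> a'" "a' \<in> exps L"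
  shows "absorbed a'"
proof -
  have a: "a \<in> exps L" "zmon a \<in> ideal_above (Suc (nwt L \<omega> a))" using assms(1) by (auto simp: absorbed_def)
  have d: "a' - a \<in> exps L" by (rule exps_diff[OF assms(3)])
  have "zmon (a' - a) * zmon a = zmon a'" by (rule zmon_split[OF finite_supp[OF assms(3)] assms(2), symmetric])
  moreover have "nwt L \<omega> (a' - a) + Suc (nwt L \<omega> a) = Suc (nwt L \<omega> a')" using nwt_diff[OF assms(2), of L \<omega>] by simp
  ultimately show ?thesis using ideal_above_mult[OF a(2) d] assms(3) by (simp add: absorbed_def)
qed

text \<open>In a trinomial relation at \<open>s\<close> the two outgoing monomials have the same
  weight \<open>W\<close>, and everything else lies above \<open>W\<close> or in the ideal of
  \<open>G\<close>; so one of them can be traded for the other.\<close>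

lemma absorbed_swap1:
  assumes s: "s \<in> N" and st: "adj s t" "u \<in> side s t" and z: "adj s z" "adj s z'" "z \<noteq> t" "z' \<noteq> t"
    and b: "b \<in> exps L" and ab: "absorbed (\<lambda>x. b x + me s z x)"
  shows "absorbed (\<lambda>x. b x + me s z' x)"
proof (cases "z = z'")
  case True then show ?thesis using ab by simp
next
  case False
  obtain f \<gamma>1 \<gamma>2 \<gamma>3 h where tri: "\<gamma>2 \<noteq> 0" "f \<in> cs_ideal.span (Abs_cs ` gens)"
    "conv_series L (cnth h)" "\<forall>m. cnth h m \<noteq> 0 \<longrightarrow> (\<exists>i<valency adj s - 2. g s i m \<noteq> 0)"
    "f = cconst \<gamma>1 * zmon (me s z) + cconst \<gamma>2 * zmon (me s z') + cconst \<gamma>3 * zmon (me s t) + h"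
    using trinomial[OF s z(1,2) st(1) False z(3,4)] by (elim exE conjE)
  have ex: "me s z \<in> exps L" "me s z' \<in> exps L" "me s t \<in> exps L" using me_exps z st(1) by blast+
  have us: "u \<noteq> s" using not_in_side[OF st(1)] st(2) by blast
  have vs: "v \<in> side s t \<or> v = s" using same_side[OF uv st(1) us _ st(2)] by blast
  define W where "W = nwt L \<omega> (me s z)"
  have "real (nwt L \<omega> (me s z)) = E v s" "real (nwt L \<omega> (me s z')) = E v s"
    unfolding nwt_wt using wt_me_eq[OF s st(1) vs] z by blast+
  then have W: "nwt L \<omega> (me s z') = W" "E v s = real W" unfolding W_def by simp_all
  have h: "h \<in> ideal_above (Suc W)"
  proof -
    have "h \<in> cs_ideal.span (zmon ` {a \<in> exps L. Suc W \<le> nwt L \<omega> a \<and> nwt L \<omega> a < Suc W + Suc (sum \<omega> L)})"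
    proof (rule span_of_weight_ge[OF finite_leaves weight_gt_0 tri(3)])
      fix m assume "cnth h m \<noteq> 0"
      then obtain i where i: "i < valency adj s - 2" "g s i m \<noteq> 0" using tri(4) by blast
      have "real W < real (nwt L \<omega> m)" using wt_g_gt[OF s i v_node] unfolding nwt_wt W(2) .
      then show "Suc W \<le> nwt L \<omega> m" by simp
    qed
    moreover have "\<dots> \<subseteq> ideal_above (Suc W)" unfolding ideal_above_def by (rule cs_ideal.span_mono) auto
    ultimately show ?thesis by blast
  qed
  \<comment> \<open>This monomial is heavier than \<open>W\<close> by the strict comparison, except
    at \<open>s = v\<close>. There \<open>t\<close> is the leaf \<open>u\<close>, and the monomial
    is divisible by a variable put into \<open>G\<close>.\<close>
  have t: "zmon (me s t) \<in> ideal_above (Suc W)"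
  proof (cases "v = s")
    case False
    then have "E v s < wt L (wv v) (me s t)" using wt_me_gt[OF s st(1)] vs v_node by blast
    then have "Suc W \<le> nwt L \<omega> (me s t)" unfolding W(2) nwt_wt[symmetric] by simp
    then show ?thesis unfolding ideal_above_def using ex(3) by (intro cs_ideal.span_base) auto
  next
    case True
    have su: "adj s u" using adj_sym[OF uv] True by simp
    have tu: "t = u" by (rule side_unique[OF st(1) su st(2) side_self[OF su]])
    obtain x where x: "x \<in> L \<inter> side s t" "me s t x > 0" using me_supp[OF s st(1)] by blast
    have "x = u" using x(1) side_leaf[OF su u] tu by auto
    then have le: "unitv u \<le> me s t" using x(2) by (auto simp: le_fun_def unitv_def)
    have "zmon (me s t) = zmon (me s t - unitv u) * zmon (unitv u)" by (rule zmon_split[OF finite_supp[OF ex(3)] le])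
    then show ?thesis unfolding ideal_above_def G_def by (simp add: cs_ideal.span_scale cs_ideal.span_base)
  qed
  have "cs_ideal.span (Abs_cs ` gens) \<subseteq> ideal_above W0" for W0 unfolding ideal_above_def G_def by (rule cs_ideal.span_mono) blast
  then have f: "f \<in> ideal_above W0" for W0 using tri(2) by blast
  note sp = cs_ideal.span_add cs_ideal.span_diff cs_ideal.span_scale
  have add: "p + r \<in> ideal_above W0" and diff: "p - r \<in> ideal_above W0" and scale: "k * p \<in> ideal_above W0" if "p \<in> ideal_above W0" "r \<in> ideal_above W0" for p r k W0
    using that unfolding ideal_above_def by (simp_all add: sp)
  let ?W0 = "Suc (nwt L \<omega> (\<lambda>x. b x + me s z x))"
  have W0: "?W0 = nwt L \<omega> b + Suc W" by (simp add: nwt_add W_def)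
  have bz: "zmon b * zmon (me s z) = zmon (\<lambda>x. b x + me s z x)" "zmon b * zmon (me s z') = zmon (\<lambda>x. b x + me s z' x)"
    by (rule zmon_add[OF finite_supp[OF b] finite_supp[OF ex(1)]], rule zmon_add[OF finite_supp[OF b] finite_supp[OF ex(2)]])
  have "zmon b * zmon (me s z') = (cconst \<gamma>2 * cconst (1 / \<gamma>2)) * (zmon b * zmon (me s z'))"
    by (simp add: cconst_mult_inverse[OF tri(1)])
  also have "\<dots> = cconst (1 / \<gamma>2) * (zmon b * (cconst \<gamma>2 * zmon (me s z')))" by (simp only: mult_ac)
  also have "cconst \<gamma>2 * zmon (me s z') = f - cconst \<gamma>1 * zmon (me s z) - cconst \<gamma>3 * zmon (me s t) - h"
    unfolding tri(5) by (simp add: algebra_simps)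
  also have "zmon b * \<dots> = zmon b * f - cconst \<gamma>1 * zmon (\<lambda>x. b x + me s z x) - cconst \<gamma>3 * (zmon b * zmon (me s t)) - zmon b * h"
    unfolding bz(1)[symmetric] by (simp only: right_diff_distrib mult_ac)
  finally have eq: "zmon (\<lambda>x. b x + me s z' x) = cconst (1 / \<gamma>2) *
    (zmon b * f - cconst \<gamma>1 * zmon (\<lambda>x. b x + me s z x) - cconst \<gamma>3 * (zmon b * zmon (me s t)) - zmon b * h)"
    unfolding bz(2) .
  have 1: "zmon b * f \<in> ideal_above ?W0" by (rule scale[OF f f])
  have 2: "zmon (\<lambda>x. b x + me s z x) \<in> ideal_above ?W0" using ab by (simp add: absorbed_def)
  have 3: "zmon b * zmon (me s t) \<in> ideal_above ?W0" unfolding W0 by (rule ideal_above_mult[OF t b])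
  have 4: "zmon b * h \<in> ideal_above ?W0" unfolding W0 by (rule ideal_above_mult[OF h b])
  have "zmon (\<lambda>x. b x + me s z' x) \<in> ideal_above ?W0"
    unfolding eq by (rule scale[OF _ 4], rule diff[OF _ 4], rule diff[OF diff[OF 1 scale[OF 2 2]] scale[OF 3 3]])
  moreover have "nwt L \<omega> (\<lambda>x. b x + me s z' x) = nwt L \<omega> (\<lambda>x. b x + me s z x)" by (simp add: nwt_add W(1) W_def)
  ultimately show ?thesis using exps_add[OF b ex(2)] by (simp add: absorbed_def)
qed

text \<open>The \<open>n\<close> copies are traded one after another, the others serving as part of
  the cofactor \<open>b\<close>.\<close>

lemma absorbed_swap:
  assumes s: "s \<in> N" and st: "adj s t" "u \<in> side s t" and z: "adj s z" "adj s z'" "z \<noteq> t" "z' \<noteq> t"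
    and b: "b \<in> exps L" and ab: "absorbed (\<lambda>x. b x + n * me s z x)"
  shows "absorbed (\<lambda>x. b x + n * me s z' x)"
  using b ab
proof (induction n arbitrary: b)
  case 0 then show ?case by simp
next
  case (Suc n)
  have ex: "(\<lambda>x. k * me s z x) \<in> exps L" "(\<lambda>x. k * me s z' x) \<in> exps L" for k
    using me_exps[OF z(1)] me_exps[OF z(2)] by (auto simp: exps_def)
  have "absorbed (\<lambda>x. (b x + n * me s z x) + me s z x)" using Suc.prems(2) by (simp add: algebra_simps)
  then have "absorbed (\<lambda>x. (b x + n * me s z x) + me s z' x)"
    by (rule absorbed_swap1[OF s st z exps_add[OF Suc.prems(1) ex(1)]])
  then have "absorbed (\<lambda>x. (b x + me s z' x) + n * me s z x)" by (simp add: algebra_simps)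
  then have "absorbed (\<lambda>x. (b x + me s z' x) + n * me s z' x)"
    by (rule Suc.IH[OF exps_add[OF Suc.prems(1) me_exps[OF z(2)]]])
  then show ?case by (simp add: algebra_simps)
qed

text \<open>Allowing powers makes the property depend only on supports of exponents, the form
  required by \<open>propagate\<close>.\<close>

definition nilpotent_set :: "'v set \<Rightarrow> bool" where
  "nilpotent_set B \<longleftrightarrow> (\<exists>n. absorbed (\<lambda>x. if x \<in> B then n else 0))"

lemma nilpotent_set_mono:
  assumes "nilpotent_set A" "A \<subseteq> B" "B \<subseteq> L"
  shows "nilpotent_set B"
proof -
  obtain n where n: "absorbed (\<lambda>x. if x \<in> A then n else 0)" using assms(1) by (auto simp: nilpotent_set_def)
  have "absorbed (\<lambda>x. if x \<in> B then n else 0)"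
    by (rule absorbed_le[OF n]) (use assms in \<open>auto simp: le_fun_def exps_def\<close>)
  then show ?thesis unfolding nilpotent_set_def by blast
qed

lemma nilpotent_set_swap:
  assumes s: "s \<in> N" and st: "adj s t" "u \<in> side s t" and z: "adj s z" "adj s z'" "z \<noteq> t" "z' \<noteq> t"
    and B: "B \<subseteq> L" and nilpotent_set: "nilpotent_set (B \<union> {i. me s z i > 0})"
  shows "nilpotent_set (B \<union> {i. me s z' i > 0})"
proof -
  obtain n where n: "absorbed (\<lambda>x. if x \<in> B \<union> {i. me s z i > 0} then n else 0)" using nilpotent_set by (auto simp: nilpotent_set_def)
  let ?b = "\<lambda>x. if x \<in> B then n else 0"
  have b: "?b \<in> exps L" using B by (auto simp: exps_def)
  have "absorbed (\<lambda>x. ?b x + n * me s z x)"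
  proof (rule absorbed_le[OF n])
    show "(\<lambda>x. if x \<in> B \<union> {i. me s z i > 0} then n else 0) \<le> (\<lambda>x. ?b x + n * me s z x)"
      by (auto simp: le_fun_def)
    show "(\<lambda>x. ?b x + n * me s z x) \<in> exps L" using me_exps[OF z(1)] B by (auto simp: exps_def)
  qed
  then have ab: "absorbed (\<lambda>x. ?b x + n * me s z' x)" by (rule absorbed_swap[OF s st z b])
  \<comment> \<open>A bound for all exponents occurring after the exchange, so that the absorbed
    monomial divides a pure power of the product.\<close>
  define k where "k = n + n * (\<Sum>i\<in>L. me s z' i)"
  have supp: "x \<in> L" if "me s z' x > 0" for x using me_off[OF z(2), of x] that by auto
  have "absorbed (\<lambda>x. if x \<in> B \<union> {i. me s z' i > 0} then k else 0)"
  proof (rule absorbed_le[OF ab])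
    show "(\<lambda>x. ?b x + n * me s z' x) \<le> (\<lambda>x. if x \<in> B \<union> {i. me s z' i > 0} then k else 0)"
      unfolding le_fun_def
    proof
      fix x
      have "me s z' x \<le> (\<Sum>i\<in>L. me s z' i)" if "me s z' x > 0"
        by (rule member_le_sum[OF supp[OF that] _ finite_leaves]) simp
      then have "n * me s z' x \<le> n * (\<Sum>i\<in>L. me s z' i)" by (cases "me s z' x > 0") auto
      then show "?b x + n * me s z' x \<le> (if x \<in> B \<union> {i. me s z' i > 0} then k else 0)"
        unfolding k_def by (cases "x \<in> B"; cases "me s z' x > 0") (simp_all del: mult_le_cancel1 add: trans_le_add2)
    qed
    show "(\<lambda>x. if x \<in> B \<union> {i. me s z' i > 0} then k else 0) \<in> exps L" using B supp by (auto simp: exps_def)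
  qed
  then show ?thesis unfolding nilpotent_set_def by blast
qed

text \<open>All leaves but \<open>u\<close> lie on the side of \<open>v\<close>, so the exchange
  argument spreads from the given variable \<open>j\<close> to all of them.\<close>

lemma nilpotent_set_all:
  assumes i: "i \<in> L"
  shows "nilpotent_set {i}"
proof -
  have base: "nilpotent_set {k}" if "zmon (unitv k) \<in> G" "k \<in> L" for k
  proof -
    have "(\<lambda>x. if x \<in> {k} then 1 else 0) = unitv k" by (auto simp: unitv_def)
    moreover have "unitv k \<in> exps L" using that(2) by (auto simp: exps_def unitv_def)
    moreover have "zmon (unitv k) \<in> ideal_above W0" for W0 unfolding ideal_above_def by (rule cs_ideal.span_base) (use that in blast)
    ultimately have "absorbed (\<lambda>x. if x \<in> {k} then 1 else 0)" by (simp add: absorbed_def)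
    then show ?thesis unfolding nilpotent_set_def by blast
  qed
  show ?thesis
  proof (cases "i = u")
    case True
    then show ?thesis using base[of u] u by (simp add: G_def)
  next
    case False
    have sd: "k \<in> L \<inter> side u v" if "k \<in> L" "k \<noteq> u" for k
      using side_opposite[OF uv, of k] side_leaf[OF adj_sym[OF uv] u] that leaves_V by blast
    show ?thesis
      by (rule propagate[of nilpotent_set u v j i "{}", OF nilpotent_set_mono nilpotent_set_swap uv sd[OF j] sd[OF i False]])
        (use base[of j] j in \<open>auto simp: G_def\<close>)
  qed
qed

lemma ex_bound: "\<exists>n. \<forall>i\<in>L. absorbed (\<lambda>x. if x = i then n else 0)"
proof -
  have "\<forall>i\<in>L. \<exists>n. absorbed (\<lambda>x. if x = i then n else 0)"
    using nilpotent_set_all unfolding nilpotent_set_def by simp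
  then obtain n where n: "\<forall>i\<in>L. absorbed (\<lambda>x. if x = i then n i else 0)" by (rule bchoice[THEN exE])
  have "absorbed (\<lambda>x. if x = i then sum n L else 0)" if i: "i \<in> L" for i
  proof (rule absorbed_le[OF n[rule_format, OF i]])
    have "n i \<le> sum n L" by (rule member_le_sum[OF i _ finite_leaves]) simp
    then show "(\<lambda>x. if x = i then n i else 0) \<le> (\<lambda>x. if x = i then sum n L else 0)" by (simp add: le_fun_def)
    show "(\<lambda>x. if x = i then sum n L else 0) \<in> exps L" using i by (auto simp: exps_def)
  qed
  then show ?thesis by blast
qed

text \<open>A monomial of large weight has some large exponent and is divisible by an absorbed power
  of a variable.\<close>

lemma ex_absorbed_from: "\<exists>W0. \<forall>a\<in>exps L. W0 \<le> nwt L \<omega> a \<longrightarrow> absorbed a"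
proof -
  obtain n where n: "\<forall>i\<in>L. absorbed (\<lambda>x. if x = i then n else 0)" using ex_bound by (elim exE)
  have "absorbed a" if a: "a \<in> exps L" "Suc (\<Sum>x\<in>L. \<omega> x * n) \<le> nwt L \<omega> a" for a
  proof -
    have "\<exists>i\<in>L. n \<le> a i"
    proof (rule ccontr)
      assume h: "\<not> (\<exists>i\<in>L. n \<le> a i)"
      have "nwt L \<omega> a \<le> (\<Sum>x\<in>L. \<omega> x * n)" unfolding nwt_def
        by (intro sum_mono mult_le_mono order_refl) (use h in \<open>auto simp: not_le less_imp_le\<close>)
      then show False using a(2) by simp
    qed
    then obtain i where i: "i \<in> L" "n \<le> a i" by blast
    show ?thesis by (rule absorbed_le[OF n[rule_format, OF i(1)] _ a(1)]) (use i(2) in \<open>simp add: le_fun_def\<close>)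
  qed
  then show ?thesis by blast
qed

text \<open>Above \<open>W0\<close> every monomial can be replaced by heavier ones, so the cutoff
  can be raised by one unit as often as desired.\<close>

lemma ideal_above_shift:
  assumes W0: "\<forall>a\<in>exps L. W0 \<le> nwt L \<omega> a \<longrightarrow> absorbed a"
  shows "ideal_above W0 \<subseteq> ideal_above (W0 + k)"
proof (induction k)
  case 0 then show ?case by simp
next
  case (Suc k)
  have "ideal_above (W0 + k) \<subseteq> ideal_above (W0 + Suc k)"
    unfolding ideal_above_def[of "W0 + k"]
  proof (rule cs_ideal.span_minimal)
    show "cs_ideal.subspace (ideal_above (W0 + Suc k))" unfolding ideal_above_def by (rule cs_ideal.subspace_span)
    show "G \<union> zmon ` {a \<in> exps L. W0 + k \<le> nwt L \<omega> a} \<subseteq> ideal_above (W0 + Suc k)"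
    proof
      fix f assume f: "f \<in> G \<union> zmon ` {a \<in> exps L. W0 + k \<le> nwt L \<omega> a}"
      show "f \<in> ideal_above (W0 + Suc k)"
      proof (cases "f \<in> G")
        case True
        then show ?thesis unfolding ideal_above_def by (intro cs_ideal.span_base) blast
      next
        case False
        then obtain a where a: "a \<in> exps L" "W0 + k \<le> nwt L \<omega> a" "f = zmon a" using f by blast
        then have "f \<in> ideal_above (Suc (nwt L \<omega> a))" using W0 by (simp add: absorbed_def)
        then show ?thesis using ideal_above_mono[of "W0 + Suc k" "Suc (nwt L \<omega> a)"] a(2) by auto
      qed
    qed
  qed
  then show ?case using Suc by blast
qed

text \<open>Modulo \<open>G\<close>, the finitely many monomials in a window above \<open>W0\<close>
  lie in what is heavier than the window, that is, in the maximal ideal times themselves. Nakayama's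
  lemma puts them into the ideal of \<open>G\<close>.\<close>

lemma nilpotent:
  assumes i: "i \<in> L"
  shows "\<exists>n. zmon (\<lambda>x. if x = i then n else 0) \<in> cs_ideal.span G"
proof -
  obtain W0 where W0: "\<forall>a\<in>exps L. W0 \<le> nwt L \<omega> a \<longrightarrow> absorbed a" using ex_absorbed_from by (elim exE)
  let ?\<Omega> = "Suc (sum \<omega> L)"
  define B where "B = {a \<in> exps L. W0 \<le> nwt L \<omega> a \<and> nwt L \<omega> a < W0 + ?\<Omega>}"
  have B: "finite B" unfolding B_def
    by (rule finite_subset[OF _ finite_nwt_le[OF finite_leaves weight_gt_0, where N = "W0 + ?\<Omega>"]]) auto
  define M where "M = (zmon ` B :: 'v cs set)"
  have M: "finite M" unfolding M_def using B by simp
  have factor: "zmon a = zmon (a - b) * zmon b" if "a \<in> exps L" "b \<le> a" "b \<in> exps L" for a b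
    by (rule zmon_split[OF finite_supp[OF that(1)] that(2)])
  \<comment> \<open>The ideal of \<open>G\<close> plus the maximal ideal times \<open>M\<close>, the
    shape in which Nakayama's lemma takes its hypothesis.\<close>
  define S where "S = {f. \<exists>p \<mu>. p \<in> cs_ideal.span G \<and> (\<forall>b\<in>M. cnth (\<mu> b) (\<lambda>_. 0) = 0) \<and> f = p + (\<Sum>b\<in>M. \<mu> b * b)}"
  have S: "cs_ideal.subspace S"
  proof (rule cs_ideal.subspaceI)
    show "0 \<in> S" unfolding S_def
      by (intro CollectI exI[of _ 0] exI[of _ "\<lambda>_. 0"]) (simp add: cs_ideal.span_zero cnth_zero)
    fix f h assume f: "f \<in> S" and h: "h \<in> S"
    from f obtain p \<mu> where 1: "p \<in> cs_ideal.span G" "\<forall>b\<in>M. cnth (\<mu> b) (\<lambda>_. 0) = 0" "f = p + (\<Sum>b\<in>M. \<mu> b * b)"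
      unfolding S_def by (elim CollectE exE conjE)
    from h obtain p' \<mu>' where 2: "p' \<in> cs_ideal.span G" "\<forall>b\<in>M. cnth (\<mu>' b) (\<lambda>_. 0) = 0" "h = p' + (\<Sum>b\<in>M. \<mu>' b * b)"
      unfolding S_def by (elim CollectE exE conjE)
    have "f + h = (p + p') + (\<Sum>b\<in>M. (\<mu> b + \<mu>' b) * b)"
      unfolding 1(3) 2(3) distrib_right sum.distrib by (simp only: add_ac)
    moreover have "\<forall>b\<in>M. cnth (\<mu> b + \<mu>' b) (\<lambda>_. 0) = 0" using 1(2) 2(2) by (simp add: cnth_add)
    ultimately show "f + h \<in> S" unfolding S_def using cs_ideal.span_add[OF 1(1) 2(1)]
      by (intro CollectI exI[of _ "p + p'"] exI[of _ "\<lambda>b. \<mu> b + \<mu>' b"] conjI)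
  next
    fix k f assume f: "f \<in> S"
    from f obtain p \<mu> where 1: "p \<in> cs_ideal.span G" "\<forall>b\<in>M. cnth (\<mu> b) (\<lambda>_. 0) = 0" "f = p + (\<Sum>b\<in>M. \<mu> b * b)"
      unfolding S_def by (elim CollectE exE conjE)
    have "k * f = k * p + (\<Sum>b\<in>M. (k * \<mu> b) * b)"
      unfolding 1(3) distrib_left sum_distrib_left by (simp only: mult.assoc)
    moreover have "\<forall>b\<in>M. cnth (k * \<mu> b) (\<lambda>_. 0) = 0" using 1(2) by (simp add: cnth_mult_0)
    ultimately show "k * f \<in> S" unfolding S_def using cs_ideal.span_scale[OF 1(1)]
      by (intro CollectI exI[of _ "k * p"] exI[of _ "\<lambda>b. k * \<mu> b"] conjI)
  qed
  have "ideal_above (W0 + ?\<Omega>) \<subseteq> S"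
    unfolding ideal_above_def
  proof (rule cs_ideal.span_minimal[OF _ S])
    show "G \<union> zmon ` {a \<in> exps L. W0 + ?\<Omega> \<le> nwt L \<omega> a} \<subseteq> S"
    proof
      fix f assume f: "f \<in> G \<union> zmon ` {a \<in> exps L. W0 + ?\<Omega> \<le> nwt L \<omega> a}"
      show "f \<in> S"
      proof (cases "f \<in> G")
        case True
        then show ?thesis unfolding S_def
          by (intro CollectI exI[of _ f] exI[of _ "\<lambda>_. 0"]) (simp add: cs_ideal.span_base cnth_zero)
      next
        case False
        then obtain a where a: "a \<in> exps L" "W0 + ?\<Omega> \<le> nwt L \<omega> a" "f = zmon a" using f by blast
        obtain b where b: "b \<le> a" "b \<in> exps L" "W0 \<le> nwt L \<omega> b" "nwt L \<omega> b < W0 + ?\<Omega>"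
          using nwt_reduce[OF finite_leaves a(1) order_trans[OF le_add1 a(2)]] by (elim exE conjE)
        \<comment> \<open>The weight of \<open>a\<close> is beyond the window and that of
          \<open>b\<close> inside it, so the quotient is not constant.\<close>
        have ne: "a - b \<noteq> (\<lambda>_. 0)"
        proof
          assume "a - b = (\<lambda>_. 0)"
          then have "nwt L \<omega> (a - b) = 0" by (simp add: nwt_def)
          then show False using nwt_diff[OF b(1), of L \<omega>] a(2) b(4) by simp
        qed
        have 0: "cnth (zmon (a - b)) (\<lambda>_. 0) = 0"
          unfolding cnth_zmon[OF finite_supp[OF exps_diff[OF a(1)]]] monomial_term_def by (rule if_not_P[OF ne[symmetric]])
        have bM: "zmon b \<in> M" using b by (auto simp: M_def B_def)
        have "f = (\<Sum>h\<in>M. (if h = zmon b then zmon (a - b) else 0) * h)"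
        proof -
          have "(\<Sum>h\<in>M. (if h = zmon b then zmon (a - b) else 0) * h) = (\<Sum>h\<in>M. if h = zmon b then zmon (a - b) * zmon b else 0)"
            by (rule sum.cong) auto
          then show ?thesis unfolding a(3) factor[OF a(1) b(1,2)] using M bM by simp
        qed
        then show ?thesis unfolding S_def using 0
          by (intro CollectI exI[of _ 0] exI[of _ "\<lambda>h. if h = zmon b then zmon (a - b) else 0"])
            (simp add: cs_ideal.span_zero cnth_zero)
      qed
    qed
  qed
  then have "ideal_above W0 \<subseteq> S" using ideal_above_shift[OF W0] by blast
  moreover have "M \<subseteq> ideal_above W0" unfolding M_def B_def ideal_above_def by (rule subsetI, rule cs_ideal.span_base) auto
  ultimately have MS: "M \<subseteq> S" by blast
  have "M \<subseteq> cs_ideal.span G"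
  proof (rule nakayama[OF M cs_ideal.subspace_span])
    fix a assume "a \<in> M"
    then have "a \<in> S" using MS by blast
    then show "\<exists>p \<mu>. p \<in> cs_ideal.span G \<and> (\<forall>b\<in>M. cnth (\<mu> b) (\<lambda>_. 0) = 0) \<and> a = p + (\<Sum>b\<in>M. \<mu> b * b)"
      unfolding S_def by simp
  qed
  let ?a = "\<lambda>x. if x = i then W0 else 0"
  have a: "?a \<in> exps L" using i by (auto simp: exps_def)
  have "nwt L \<omega> ?a = (\<Sum>x\<in>L. if x = i then \<omega> i * W0 else 0)" unfolding nwt_def by (rule sum.cong) auto
  then have "nwt L \<omega> ?a = \<omega> i * W0" using i finite_leaves by simp
  \<comment> \<open>Weights are at least 1, so the exponent \<open>W0\<close> is enough to reach the
    cutoff.\<close>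
  then have "W0 \<le> nwt L \<omega> ?a" using weight_gt_0[OF i] by (simp del: neq0_conv)
  from nwt_reduce[OF finite_leaves a this] obtain b where b: "b \<le> ?a" "b \<in> exps L" "W0 \<le> nwt L \<omega> b" "nwt L \<omega> b < W0 + ?\<Omega>"
    by (elim exE conjE)
  then have "zmon b \<in> cs_ideal.span G" using \<open>M \<subseteq> cs_ideal.span G\<close> by (auto simp: M_def B_def)
  then have "zmon ?a \<in> cs_ideal.span G" unfolding factor[OF a b(1,2)] by (rule cs_ideal.span_scale)
  then show ?thesis by blast
qed

end

end

text \<open>A common step size for finitely many constraints. The shift \<open>c x + 1\<close> in
  its definition keeps the quotients meaningful where \<open>c\<close> vanishes.\<close>

lemma ex_small:
  fixes c r :: "'b \<Rightarrow> real"
  assumes "finite S" "\<And>x. x \<in> S \<Longrightarrow> r x > 0" "\<And>x. x \<in> S \<Longrightarrow> c x \<ge> 0"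
  shows "\<exists>e>0. e \<le> 1 \<and> (\<forall>x\<in>S. e * c x \<le> r x)"
proof -
  define e where "e = Min (insert 1 ((\<lambda>x. r x / (c x + 1)) ` S))"
  have pos: "c x + 1 > 0" if "x \<in> S" for x using assms(3)[OF that] by linarith
  have e: "e > 0" unfolding e_def using assms pos by (subst Min_gr_iff) auto
  have "e \<le> 1" unfolding e_def using assms(1) by (intro Min_le) auto
  moreover have "e * c x \<le> r x" if x: "x \<in> S" for x
  proof -
    have "e \<le> r x / (c x + 1)" unfolding e_def using assms(1) x by (intro Min_le) auto
    then have "e * (c x + 1) \<le> r x" using pos[OF x] by (simp add: pos_le_divide_eq)
    then show ?thesis using e by (simp add: distrib_left)
  qed
  ultimately show ?thesis using e by blast
qed

context splice_system
begin

subsection \<open>Weights with a vanishing coordinate\<close>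

text \<open>A power of the variable \<open>i\<close> lies in the ideal enlarged by two variables of
  positive weight. Putting all variables of positive weight to 0 removes these two, so an element of
  the ideal itself restricts to that power; its other terms have positive weight.\<close>

lemma zero_coordinate:
  assumes w: "\<And>x. x \<in> L \<Longrightarrow> w x \<ge> 0" and i: "i \<in> L" "w i = 0"
    and u: "u \<in> L" "w u > 0" and j: "j \<in> L" "w j > 0" "j \<noteq> u"
  shows "\<exists>f\<in>ideal_span L gens. \<exists>a. initial_monomial L w f a"
proof -
  let ?X = "{zmon (unitv u), zmon (unitv j)}"
  let ?G = "Abs_cs ` gens"
  have "nbrs adj u \<noteq> {}" using leaf_valency[OF u(1)] by (auto simp: valency_def)
  then obtain v where uv: "adj u v" by (auto simp: nbrs_def)
  obtain n where n: "zmon (\<lambda>x. if x = i then n else 0) \<in> cs_ideal.span (?G \<union> ?X)"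
    using nilpotent[OF u(1) uv j(1,3) i(1)] by (elim exE)
  let ?a = "\<lambda>x. if x = i then n else 0"
  obtain f0 y where fy: "f0 \<in> cs_ideal.span ?G" "y \<in> cs_ideal.span ?X" "zmon ?a = f0 + y"
    using n unfolding cs_ideal.span_Un by blast
  define K where "K = {x \<in> L. w x = 0}"
  have KL: "K \<subseteq> L" by (auto simp: K_def)
  have aK: "?a \<in> exps K" using i by (auto simp: exps_def K_def)
  have fa: "finite {x. ?a x \<noteq> 0}" by (rule finite_subset[of _ "{i}"]) auto
  \<comment> \<open>The decomposition was made in the ring of all variables; restricting to
    \<open>L\<close> returns to the given power series ring.\<close>
  define f where "f = cres L f0"
  have finite_supp: "f \<in> cs_ideal.span ?G" unfolding f_def
  proof (rule cres_span[OF fy(1)])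
    fix h assume h: "h \<in> ?G"
    then have "conv_series L (cnth h)" using cnth_Abs_cs[OF finite_leaves conv_gens] conv_gens by auto
    then show "cres L h \<in> cs_ideal.span ?G" using h by (simp add: cres_id cs_ideal.span_base)
  qed
  have cf: "conv_series L (cnth f)" unfolding f_def by (rule conv_series_cres[OF finite_leaves])
  have f: "cnth f \<in> ideal_span L gens"
    using finite_supp cf ideal_span_iff[OF finite_leaves conv_gens] by (simp add: cnth_inverse)
  have "cres K y \<in> cs_ideal.span {}"
  proof (rule cres_span[OF fy(2)])
    fix h assume "h \<in> ?X"
    then obtain k where k: "h = zmon (unitv k)" "k \<notin> K" using u j by (auto simp: K_def)
    have "finite {x. unitv k x \<noteq> 0}" by (rule finite_subset[of _ "{k}"]) (auto simp: unitv_def)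
    then have "cnth h m = monomial_term (unitv k) m" for m unfolding k(1) by (simp add: cnth_zmon)
    moreover have "unitv k \<notin> exps K" using k(2) by (auto simp: exps_def unitv_def)
    ultimately have "cnth (cres K h) m = cnth 0 m" for m
      by (cases "m = unitv k") (simp_all add: cnth_cres cnth_zero monomial_term_def)
    then have "cres K h = 0" by (intro cs_eqI ext)
    then show "cres K h \<in> cs_ideal.span {}" by simp
  qed
  then have y0: "cres K y = 0" by simp
  have fK: "cnth f m = monomial_term ?a m" if m: "m \<in> exps K" for m
  proof -
    have "cnth f m = cnth f0 m" using m exps_mono[OF KL] by (auto simp: f_def cnth_cres)
    also have "\<dots> = cnth (zmon ?a) m" unfolding fy(3) cnth_add using y0 m cnth_cres[of K y m] by (simp add: cnth_zero)
    finally show ?thesis unfolding cnth_zmon[OF fa] .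
  qed
  have "wt L w ?a = 0" unfolding wt_def using i by (intro sum.neutral) auto
  moreover have "wt L w m > 0" if m: "m \<in> exps L" "m \<notin> exps K" for m
  proof -
    obtain x where x: "x \<notin> K" "m x \<noteq> 0" using m(2) by (auto simp: exps_def)
    then have xL: "x \<in> L" using m(1) by (auto simp: exps_def)
    have "w x \<noteq> 0" using x(1) xL by (simp add: K_def)
    then have "0 < w x" using w[OF xL] by linarith
    then have "0 < w x * real (m x)" using x(2) by simp
    also have "\<dots> \<le> wt L w m" unfolding wt_def
      using w by (intro member_le_sum[OF xL _ finite_leaves]) auto
    finally show ?thesis .
  qed
  ultimately have 1: "wt L w ?a = 0" "\<And>m. m \<in> exps L \<Longrightarrow> m \<notin> exps K \<Longrightarrow> wt L w m > 0" by blast+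
  have "initial_monomial L w (cnth f) ?a"
    unfolding initial_monomial_def 1(1)
  proof (intro conjI allI impI)
    show "cnth f ?a \<noteq> 0" unfolding fK[OF aK] by (simp add: monomial_term_def)
    fix m assume m: "cnth f m \<noteq> 0" "m \<noteq> ?a"
    have "m \<notin> exps K" using fK[of m] m by (auto simp: monomial_term_def)
    then show "0 < wt L w m" by (rule 1(2)[OF conv_series_exps[OF cf m(1)]])
  qed
  then show ?thesis using f by blast
qed

subsection \<open>Positive weights\<close>

definition feasible :: "('v \<Rightarrow> real) \<Rightarrow> 'v \<Rightarrow> 'v \<Rightarrow> real \<Rightarrow> real \<Rightarrow> bool" where
  "feasible w u v a b \<longleftrightarrow> adj u v \<and> a \<ge> 0 \<and> b \<ge> 0 \<and> (\<forall>x\<in>L. a * wv u x + b * wv v x \<le> w x)"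

definition size1 :: "'v \<Rightarrow> 'v \<Rightarrow> real \<Rightarrow> real \<Rightarrow> real" where
  "size1 u v a b = (\<Sum>x\<in>L. a * wv u x + b * wv v x)"

text \<open>The maximum runs over all cones of the fan, so a maximal point on a ray is maximal in
  every cone containing that ray; \<open>maximal_node\<close> depends on this.\<close>

definition maximal :: "('v \<Rightarrow> real) \<Rightarrow> 'v \<Rightarrow> 'v \<Rightarrow> real \<Rightarrow> real \<Rightarrow> bool" where
  "maximal w u v a b \<longleftrightarrow> feasible w u v a b \<and> (\<forall>u' v' a' b'. feasible w u' v' a' b' \<longrightarrow> size1 u' v' a' b' \<le> size1 u v a b)"

lemma feasible_sym: "feasible w u v a b \<Longrightarrow> feasible w v u b a"
  unfolding feasible_def by (auto simp: add.commute adj_sym)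

lemma size1_sym: "size1 u v a b = size1 v u b a"
  unfolding size1_def by (simp add: add.commute)

lemma maximal_sym: "maximal w u v a b \<Longrightarrow> maximal w v u b a"
  unfolding maximal_def using feasible_sym size1_sym by metis

lemma ex_wv_pos:
  assumes "u \<in> V"
  shows "\<exists>x\<in>L. wv u x > 0"
proof (cases "u \<in> L")
  case True then show ?thesis by (intro bexI[of _ u]) (simp_all add: wv_leaf)
next
  case False
  then have u: "u \<in> N" using nodeI assms by blast
  obtain y where y: "adj u y" using node_valency[OF u] by (force simp: valency_def nbrs_def card_eq_0_iff)
  obtain x where "x \<in> L" using ex_leaf_side[OF y] by blast
  then show ?thesis using wv_pos[OF u] by blast
qed

lemma ex_max_edge:
  assumes uv: "adj u v" and w: "\<And>x. x \<in> L \<Longrightarrow> w x \<ge> 0"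
  shows "\<exists>a b. feasible w u v a b \<and> (\<forall>a' b'. feasible w u v a' b' \<longrightarrow> size1 u v a' b' \<le> size1 u v a b)"
proof -
  obtain x1 where x1: "x1 \<in> L" "wv u x1 > 0" using ex_wv_pos adj_V(1)[OF uv] by blast
  obtain x2 where x2: "x2 \<in> L" "wv v x2 > 0" using ex_wv_pos adj_V(2)[OF uv] by blast
  \<comment> \<open>Each weight vector is positive at some leaf, which bounds its coefficient; the
    feasible set is therefore compact.\<close>
  define S where "S = ({0..w x1 / wv u x1} \<times> {0..w x2 / wv v x2}) \<inter>
    (\<Inter>x\<in>L. {p :: real \<times> real. fst p * wv u x + snd p * wv v x \<le> w x})"
  have "compact S" unfolding S_def
    by (intro compact_Int_closed compact_Times compact_Icc closed_INT ballI closed_Collect_le continuous_intros)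
  moreover have S: "(a, b) \<in> S \<longleftrightarrow> feasible w u v a b" for a b
  proof
    assume h: "feasible w u v a b"
    then have le: "a * wv u x + b * wv v x \<le> w x" if "x \<in> L" for x using that by (simp add: feasible_def)
    have nn: "0 \<le> a * wv u x" "0 \<le> b * wv v x" for x using h wv_nonneg by (simp_all add: feasible_def)
    have "a * wv u x1 \<le> w x1" using le[OF x1(1)] nn(2)[of x1] by linarith
    moreover have "b * wv v x2 \<le> w x2" using le[OF x2(1)] nn(1)[of x2] by linarith
    ultimately show "(a, b) \<in> S" using h x1 x2 by (auto simp: S_def feasible_def pos_le_divide_eq)
  qed (use uv in \<open>auto simp: S_def feasible_def\<close>)
  moreover have "(0, 0) \<in> S" unfolding S feasible_def using uv w by simp
  moreover have "continuous_on S (\<lambda>p. size1 u v (fst p) (snd p))" unfolding size1_def by (intro continuous_intros)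
  ultimately obtain p where p: "p \<in> S" "\<forall>p'\<in>S. size1 u v (fst p') (snd p') \<le> size1 u v (fst p) (snd p)"
    using continuous_attains_sup[of S "\<lambda>p. size1 u v (fst p) (snd p)"] by blast
  have "feasible w u v (fst p) (snd p)" using p(1) S[of "fst p" "snd p"] by simp
  moreover have "size1 u v a' b' \<le> size1 u v (fst p) (snd p)" if "feasible w u v a' b'" for a' b'
    using p(2) that unfolding S[symmetric] by force
  ultimately show ?thesis by blast
qed

lemma ex_maximal:
  assumes w: "\<And>x. x \<in> L \<Longrightarrow> w x \<ge> 0" and e: "adj u0 v0"
  shows "\<exists>u v a b. maximal w u v a b"
proof -
  define Ed where "Ed = {p. adj (fst p) (snd p)}"
  have "finite Ed" by (rule finite_subset[of _ "V \<times> V"]) (use finite_V adj_V in \<open>auto simp: Ed_def\<close>)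
  have "\<forall>p\<in>Ed. \<exists>q. feasible w (fst p) (snd p) (fst q) (snd q) \<and>
    (\<forall>a' b'. feasible w (fst p) (snd p) a' b' \<longrightarrow> size1 (fst p) (snd p) a' b' \<le> size1 (fst p) (snd p) (fst q) (snd q))"
  proof
    fix p assume "p \<in> Ed"
    then have "adj (fst p) (snd p)" by (simp add: Ed_def)
    then have "\<exists>a b. feasible w (fst p) (snd p) a b \<and>
      (\<forall>a' b'. feasible w (fst p) (snd p) a' b' \<longrightarrow> size1 (fst p) (snd p) a' b' \<le> size1 (fst p) (snd p) a b)"
      by (rule ex_max_edge) (rule w)
    then obtain a b where "feasible w (fst p) (snd p) a b"
      "\<forall>a' b'. feasible w (fst p) (snd p) a' b' \<longrightarrow> size1 (fst p) (snd p) a' b' \<le> size1 (fst p) (snd p) a b" by blast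
    then show "\<exists>q. feasible w (fst p) (snd p) (fst q) (snd q) \<and>
    (\<forall>a' b'. feasible w (fst p) (snd p) a' b' \<longrightarrow> size1 (fst p) (snd p) a' b' \<le> size1 (fst p) (snd p) (fst q) (snd q))"
      by (intro exI[of _ "(a, b)"]) simp
  qed
  then obtain q where q: "\<forall>p\<in>Ed. feasible w (fst p) (snd p) (fst (q p)) (snd (q p)) \<and>
    (\<forall>a' b'. feasible w (fst p) (snd p) a' b' \<longrightarrow> size1 (fst p) (snd p) a' b' \<le> size1 (fst p) (snd p) (fst (q p)) (snd (q p)))"
    by (rule bchoice[THEN exE])
  define \<phi> where "\<phi> p = size1 (fst p) (snd p) (fst (q p)) (snd (q p))" for p
  have "Ed \<noteq> {}" using e by (auto simp: Ed_def)
  have "Max (\<phi> ` Ed) \<in> \<phi> ` Ed" using \<open>finite Ed\<close> \<open>Ed \<noteq> {}\<close> by (intro Max_in) auto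
  then obtain p where p: "p \<in> Ed" "\<phi> p = Max (\<phi> ` Ed)" by auto
  have "maximal w (fst p) (snd p) (fst (q p)) (snd (q p))"
    unfolding maximal_def
  proof (intro conjI allI impI)
    show "feasible w (fst p) (snd p) (fst (q p)) (snd (q p))" using q p(1) by blast
    fix u' v' a' b' assume h: "feasible w u' v' a' b'"
    then have "(u', v') \<in> Ed" by (simp add: Ed_def feasible_def)
    then have "size1 u' v' a' b' \<le> \<phi> (u', v')" using q h unfolding \<phi>_def by fastforce
    also have "\<dots> \<le> \<phi> p" unfolding p(2) using \<open>finite Ed\<close> \<open>(u', v') \<in> Ed\<close> by (intro Max_ge) auto
    finally show "size1 u' v' a' b' \<le> size1 (fst p) (snd p) (fst (q p)) (snd (q p))" unfolding \<phi>_def .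
  qed
  then show ?thesis by blast
qed

text \<open>Provides a direction inside the cone, \<open>w_v - r * w_u\<close>, that is positive on
  the leaves beyond \<open>v\<close> and zero on the others. Here \<open>r\<close> is
  \<open>q v u\<close> between nodes, 0 if \<open>v\<close> is a leaf, and the
  \<open>u\<close>-coordinate of \<open>w_v\<close> if \<open>u\<close> is one.\<close>

lemma direction:
  assumes uv: "adj u v"
  shows "\<exists>r\<ge>0. \<forall>x\<in>L. (x \<in> side u v \<longrightarrow> wv v x > r * wv u x) \<and> (x \<notin> side u v \<longrightarrow> wv v x = r * wv u x)"
proof -
  have opp: "x \<in> side v u" if "x \<in> L" "x \<notin> side u v" for x
    using side_opposite[OF uv, of x] that leaves_V by blast
  consider "u \<in> N" "v \<in> N" | "u \<in> N" "v \<in> L" | "u \<in> L" "v \<in> N"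
    using nodeI[OF adj_V(1)[OF uv]] nodeI[OF adj_V(2)[OF uv]] leaf_nbr_node[OF _ uv] by blast
  then show ?thesis
  proof cases
    case 1
    note vu = adj_sym[OF uv]
    show ?thesis
    proof (intro exI[of _ "q v u"] conjI ballI impI)
      show "q v u \<ge> 0" using q_pos[OF 1(2,1) vu] by simp
      fix x assume x: "x \<in> L"
      show "wv v x > q v u * wv u x" if "x \<in> side u v" by (rule wv_q_less[OF 1(2,1) vu x that])
      show "wv v x = q v u * wv u x" if "x \<notin> side u v" by (rule wv_q[OF 1(2,1) vu x opp[OF x that]])
    qed
  next
    case 2
    show ?thesis
      by (rule exI[of _ 0]) (use side_leaf[OF uv 2(2)] in \<open>auto simp: wv_leaf[OF 2(2)]\<close>)
  next
    case 3
    show ?thesis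
    proof (intro exI[of _ "wv v u"] conjI ballI impI)
      show "wv v u \<ge> 0" by (rule wv_nonneg)
      fix x assume x: "x \<in> L"
      show "wv v x > wv v u * wv u x" if "x \<in> side u v"
      proof -
        have "x \<noteq> u" using that not_in_side[OF uv] by blast
        then show ?thesis using wv_pos[OF 3(2) x] by (simp add: wv_leaf[OF 3(1)])
      qed
      show "wv v x = wv v u * wv u x" if "x \<notin> side u v"
      proof -
        have "x = u" using opp[OF x that] side_leaf[OF adj_sym[OF uv] 3(1)] by blast
        then show ?thesis by (simp add: wv_leaf[OF 3(1)])
      qed
    qed
  qed
qed

text \<open>Otherwise a small step from \<open>u\<close> towards \<open>v\<close> would increase
  coordinates only where there is slack, and so enlarge the point. Positivity of \<open>a\<close>
  keeps the coefficient of \<open>w_u\<close> nonnegative.\<close>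

lemma maximal_zero:
  assumes m: "maximal w u v a b" and a: "a > 0"
  shows "\<exists>x\<in>L \<inter> side u v. w x = a * wv u x + b * wv v x"
proof (rule ccontr)
  assume no: "\<not> (\<exists>x\<in>L \<inter> side u v. w x = a * wv u x + b * wv v x)"
  have f: "feasible w u v a b" using m by (simp add: maximal_def)
  then have uv: "adj u v" and b: "b \<ge> 0" and le: "\<And>x. x \<in> L \<Longrightarrow> a * wv u x + b * wv v x \<le> w x"
    by (auto simp: feasible_def)
  obtain r where r: "r \<ge> 0" "\<forall>x\<in>L. (x \<in> side u v \<longrightarrow> wv v x > r * wv u x) \<and> (x \<notin> side u v \<longrightarrow> wv v x = r * wv u x)"
    using direction[OF uv] by (elim exE conjE)
  let ?S = "L \<inter> side u v"
  define dl where "dl x = wv v x - r * wv u x" for x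
  define d' where "d' x = w x - (a * wv u x + b * wv v x)" for x
  have c: "dl x > 0" if "x \<in> ?S" for x using r(2) that by (auto simp: dl_def)
  have c0: "dl x = 0" if "x \<in> L" "x \<notin> side u v" for x using r(2) that by (auto simp: dl_def)
  have d: "d' x > 0" if "x \<in> ?S" for x
  proof -
    have "a * wv u x + b * wv v x \<noteq> w x" using no that by force
    then show ?thesis using le[of x] that by (auto simp: d'_def less_le)
  qed
  obtain e1 where e1: "e1 > 0" "e1 \<le> 1" "\<forall>x\<in>?S. e1 * dl x \<le> d' x"
    using ex_small[of ?S d' dl] d c finite_leaves by (auto simp: less_imp_le)
  \<comment> \<open>The first bound keeps the point below \<open>w\<close>, the second keeps
    \<open>a - e * r\<close> nonnegative.\<close>
  define e where "e = min e1 (a / (r + 1))"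
  have e: "e > 0" using e1 a r(1) by (simp add: e_def)
  have er: "e * r \<le> a"
  proof -
    have "e \<le> a / (r + 1)" by (simp add: e_def)
    then have "e * (r + 1) \<le> a" using r(1) by (simp add: pos_le_divide_eq)
    then show ?thesis using e by (simp add: distrib_left)
  qed
  have new: "(a - e * r) * wv u x + (b + e) * wv v x = (a * wv u x + b * wv v x) + e * dl x" for x
    by (simp add: dl_def algebra_simps)
  have "feasible w u v (a - e * r) (b + e)"
    unfolding feasible_def new
  proof (intro conjI ballI uv)
    show "0 \<le> a - e * r" using er by simp
    show "0 \<le> b + e" using b e by simp
    fix x assume x: "x \<in> L"
    show "a * wv u x + b * wv v x + e * dl x \<le> w x"
    proof (cases "x \<in> side u v")
      case True
      have "e * dl x \<le> e1 * dl x" using c[of x] x True by (intro mult_right_mono) (auto simp: e_def)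
      also have "\<dots> \<le> d' x" using e1(3) x True by blast
      finally show ?thesis by (simp add: d'_def)
    next
      case False then show ?thesis using c0[OF x] le[OF x] by simp
    qed
  qed
  then have "size1 u v (a - e * r) (b + e) \<le> size1 u v a b" using m unfolding maximal_def by blast
  moreover have "size1 u v (a - e * r) (b + e) = size1 u v a b + e * (\<Sum>x\<in>L. dl x)"
    unfolding size1_def new sum.distrib sum_distrib_left by simp
  moreover have "(\<Sum>x\<in>L. dl x) > 0"
  proof -
    obtain x where x: "x \<in> L" "x \<in> side u v" using ex_leaf_side[OF uv] by blast
    show ?thesis
    proof (rule sum_pos2[OF finite_leaves x(1)])
      show "0 < dl x" using c x by blast
      show "0 \<le> dl y" if "y \<in> L" for y using c[of y] c0[of y] that by (cases "y \<in> side u v") auto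
    qed
  qed
  ultimately show False using e by (simp add: mult_le_0_iff)
qed

text \<open>If \<open>w'\<close> vanished on the support of one outgoing monomial at
  \<open>s\<close> but not on that of another, a trinomial of the ideal would have the first as its
  initial form. Hence positivity, and so vanishing, is shared by the whole subtree.\<close>

lemma zero_propagate:
  assumes no: "\<And>f a. f \<in> ideal_span L gens \<Longrightarrow> \<not> initial_monomial L w f a"
    and w': "\<And>x. x \<in> L \<Longrightarrow> w x = p x + w' x" "\<And>x. x \<in> L \<Longrightarrow> w' x \<ge> 0"
    and xy: "adj x y"
    and good: "\<And>s t. s \<in> N \<Longrightarrow> s \<in> side x y \<Longrightarrow> adj s t \<Longrightarrow> x \<in> side s t \<Longrightarrow> \<exists>W. good p s t W"
    and i: "i \<in> L \<inter> side x y" "w' i = 0" and j: "j \<in> L \<inter> side x y"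
  shows "w' j = 0"
proof (rule ccontr)
  assume "w' j \<noteq> 0"
  then have j0: "w' j > 0" using w'(2) j by (auto simp: less_le)
  define P where "P B \<longleftrightarrow> (\<exists>k\<in>B. k \<in> L \<and> w' k > 0)" for B
  have wtw: "wt L w m = wt L p m + wt L w' m" for m
    unfolding wt_def sum.distrib[symmetric] by (rule sum.cong) (auto simp: w'(1) algebra_simps)
  have nn: "wt L w' m \<ge> 0" for m by (rule wt_nonneg[OF w'(2)])
  \<comment> \<open>Run contrapositively: positivity is carried from \<open>j\<close> to
    \<open>i\<close>.\<close>
  have "P (insert i {})"
  proof (rule propagate[of P x y j i "{}", OF _ _ xy j i(1)])
    show "P B" if "P A" "A \<subseteq> B" "B \<subseteq> L" for A B using that by (auto simp: P_def)
    show "P (insert j {})" using j j0 by (auto simp: P_def)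
  next
    fix s t z z' B
    assume s: "s \<in> N" "s \<in> side x y" and st: "adj s t" "x \<in> side s t"
      and z: "adj s z" "adj s z'" "z \<noteq> t" "z' \<noteq> t" and PB: "P (B \<union> {i. me s z i > 0})"
    show "P (B \<union> {i. me s z' i > 0})"
    proof (rule ccontr)
      assume nP: "\<not> P (B \<union> {i. me s z' i > 0})"
      then have "\<not> P B" by (auto simp: P_def)
      then obtain k where k: "k \<in> L" "me s z k > 0" "w' k > 0" using PB by (auto simp: P_def)
      have zz: "z \<noteq> z'" using nP k by (auto simp: P_def)
      have 0: "wt L w' (me s z') = 0"
      proof -
        have "w' k * real (me s z' k) = 0" if "k \<in> L" for k
        proof (cases "me s z' k > 0")
          case True
          then have "\<not> w' k > 0" using nP that by (auto simp: P_def)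
          then show ?thesis using w'(2)[OF that] by simp
        qed simp
        then show ?thesis unfolding wt_def by (intro sum.neutral) blast
      qed
      have pos: "wt L w' (me s z) > 0"
        unfolding wt_def by (rule sum_pos2[OF finite_leaves k(1)]) (use k w'(2) in auto)
      obtain W where W: "good p s t W" using good[OF s st] by blast
      have Wz: "wt L p (me s z) = W" "wt L p (me s z') = W" "wt L p (me s t) > W"
        "\<And>i m. i < valency adj s - 2 \<Longrightarrow> g s i m \<noteq> 0 \<Longrightarrow> wt L p m > W"
        using W z unfolding good_def by blast+
      obtain f \<gamma>1 \<gamma>2 \<gamma>3 h where tri: "\<gamma>2 \<noteq> 0" "f \<in> cs_ideal.span (Abs_cs ` gens)" "conv_series L (cnth f)"
        "\<forall>m. cnth h m \<noteq> 0 \<longrightarrow> (\<exists>i<valency adj s - 2. g s i m \<noteq> 0)"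
        "f = cconst \<gamma>1 * zmon (me s z) + cconst \<gamma>2 * zmon (me s z') + cconst \<gamma>3 * zmon (me s t) + h"
        using trinomial[OF s(1) z(1,2) st(1) zz z(3,4)] by (elim exE conjE)
      have fi: "cnth f \<in> ideal_span L gens"
        using tri(2,3) ideal_span_iff[OF finite_leaves conv_gens] by (simp add: cnth_inverse)
      have fin: "finite {x. me s z x \<noteq> 0}" if "adj s z" for z
        by (rule exps_finite_support[OF finite_leaves me_exps[OF that]])
      have fm: "cnth f m = \<gamma>1 * monomial_term (me s z) m + \<gamma>2 * monomial_term (me s z') m + \<gamma>3 * monomial_term (me s t) m + cnth h m" for m
        unfolding tri(5) cnth_add cnth_cconst_mult cnth_zmon[OF fin[OF z(1)]] cnth_zmon[OF fin[OF z(2)]] cnth_zmon[OF fin[OF st(1)]] ..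
      have h: "wt L w m > W" if "cnth h m \<noteq> 0" for m
        using tri(4) that Wz(4) nn[of m] unfolding wtw by fastforce
      have wz: "wt L w (me s z) > W" "wt L w (me s z') = W" "wt L w (me s t) > W"
        unfolding wtw using Wz pos 0 nn[of "me s t"] by linarith+
      have "initial_monomial L w (cnth f) (me s z')"
        unfolding initial_monomial_def wz(2)
      proof (intro conjI allI impI)
        have "me s z \<noteq> me s z'" "me s t \<noteq> me s z'" "cnth h (me s z') = 0" using wz h by force+
        then show "cnth f (me s z') \<noteq> 0" unfolding fm monomial_term_def using tri(1) by auto
        fix m assume m: "cnth f m \<noteq> 0" "m \<noteq> me s z'"
        then have "m = me s z \<or> m = me s t \<or> cnth h m \<noteq> 0" unfolding fm monomial_term_def by (auto split: if_splits)
        then show "W < wt L w m" using wz h by blast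
      qed
      then show False using no[OF fi] by blast
    qed
  qed simp
  then show False using i(2) by (auto simp: P_def)
qed

lemma good_scale: "good p s t W \<Longrightarrow> a > 0 \<Longrightarrow> good (\<lambda>x. a * p x) s t (a * W)"
proof -
  assume h: "good p s t W" "a > 0"
  have "wt L (\<lambda>x. a * p x) m = a * wt L p m" for m unfolding wt_def by (simp add: sum_distrib_left mult.assoc)
  then show ?thesis using h unfolding good_def by simp
qed

text \<open>The ray must belong to a node, and each subtree at this node then contains a leaf where
  the difference vanishes.\<close>

lemma maximal_node:
  assumes no: "\<And>f a. f \<in> ideal_span L gens \<Longrightarrow> \<not> initial_monomial L w f a" and w: "\<And>x. x \<in> L \<Longrightarrow> w x > 0"
    and m: "maximal w u v a 0" and a: "a > 0" and x: "x \<in> L"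
  shows "w x = a * wv u x"
proof -
  have f: "feasible w u v a 0" using m by (simp add: maximal_def)
  then have uv: "adj u v" by (simp add: feasible_def)
  have uN: "u \<in> N"
  proof (rule nodeI[OF adj_V(1)[OF uv]], rule notI)
    \<comment> \<open>On a leaf ray the point vanishes at all other leaves, so equality at one of
      them contradicts positivity of \<open>w\<close>.\<close>
    assume uL: "u \<in> L"
    obtain y where y: "y \<in> L" "y \<in> side u v" "w y = a * wv u y + 0 * wv v y" using maximal_zero[OF m a] by blast
    have "y \<noteq> u" using y(2) not_in_side[OF uv] by blast
    then show False using y(3) w[OF y(1)] by (simp add: wv_leaf[OF uL])
  qed
  have "x \<noteq> u" using x node_not_leaf[OF uN] by blast
  then obtain y where y: "adj u y" "x \<in> side u y" using ex_side[OF node_V[OF uN]] x leaves_V by blast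
  \<comment> \<open>With second coefficient 0 the point also lies in the cone of the edge towards
    \<open>x\<close>.\<close>
  have my: "maximal w u y a 0"
    using m y(1) unfolding maximal_def feasible_def size1_def by simp
  obtain i where i: "i \<in> L" "i \<in> side u y" "w i = a * wv u i + 0 * wv y i" using maximal_zero[OF my a] by blast
  have "w x - a * wv u x = 0"
  proof (rule zero_propagate[of w "\<lambda>x. a * wv u x" "\<lambda>x. w x - a * wv u x" u y i x, OF no _ _ y(1)])
    show "w x - a * wv u x \<ge> 0" if "x \<in> L" for x using f that by (simp add: feasible_def)
    show "\<exists>W. good (\<lambda>x. a * wv u x) s t W" if "s \<in> N" "s \<in> side u y" "adj s t" "u \<in> side s t" for s t
      using good_scale[OF good_node[OF uN that(1,3,4)] a] by blast
    show "i \<in> L \<inter> side u y" "w i - a * wv u i = 0" "x \<in> L \<inter> side u y" using i x y(2) by auto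
  qed simp_all
  then show ?thesis by simp
qed

lemma positive_in_cone:
  assumes no: "\<And>f a. f \<in> ideal_span L gens \<Longrightarrow> \<not> initial_monomial L w f a" and w: "\<And>x. x \<in> L \<Longrightarrow> w x > 0"
  shows "\<exists>u v a b. adj u v \<and> a \<ge> 0 \<and> b \<ge> 0 \<and> (\<forall>x\<in>L. w x = a * wv u x + b * wv v x)"
proof -
  obtain v0 where v0: "v0 \<in> V" "valency adj v0 \<ge> 3" using ex_branch by blast
  then have "nbrs adj v0 \<noteq> {}" by (auto simp: valency_def)
  then obtain u0 where e0: "adj v0 u0" by (auto simp: nbrs_def)
  obtain u v a b where m: "maximal w u v a b" using ex_maximal[OF _ e0, of w] w by (meson less_imp_le)
  have f: "feasible w u v a b" using m by (simp add: maximal_def)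
  then have uv: "adj u v" and ab: "a \<ge> 0" "b \<ge> 0" by (auto simp: feasible_def)
  consider "a = 0" "b = 0" | "a > 0" "b = 0" | "a = 0" "b > 0" | "a > 0" "b > 0" using ab by linarith
  then show ?thesis
  proof cases
    case 1
    \<comment> \<open>The origin is not maximal, since a small multiple of \<open>w_u\<close> still
      lies below the positive vector \<open>w\<close>.\<close>
    obtain e where e: "e > 0" "e \<le> 1" "\<forall>x\<in>L. e * wv u x \<le> w x"
      using ex_small[OF finite_leaves, of w "wv u"] w wv_nonneg[of u] by blast
    have "feasible w u v e 0" unfolding feasible_def using uv e by simp
    then have "size1 u v e 0 \<le> size1 u v 0 0" using m 1 unfolding maximal_def by blast
    moreover have "size1 u v e 0 = e * (\<Sum>x\<in>L. wv u x)" by (simp add: size1_def sum_distrib_left)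
    moreover obtain x where x: "x \<in> L" "wv u x > 0" using ex_wv_pos adj_V(1)[OF uv] by blast
    have "(\<Sum>x\<in>L. wv u x) > 0" by (rule sum_pos2[where f = "wv u", OF finite_leaves x]) (rule wv_nonneg)
    ultimately show ?thesis using e(1) by (simp add: size1_def mult_le_0_iff)
  next
    case 2
    have "maximal w u v a 0" using m 2(2) by simp
    then have "\<forall>x\<in>L. w x = a * wv u x + 0 * wv v x" using maximal_node[OF no w _ 2(1)] by simp
    then show ?thesis using uv ab(1) order_refl by blast
  next
    case 3
    have "maximal w v u b 0" using maximal_sym[OF m] 3(1) by simp
    then have "\<forall>x\<in>L. w x = b * wv v x + 0 * wv u x" using maximal_node[OF no w _ 3(2)] by simp
    then show ?thesis using adj_sym[OF uv] ab(2) order_refl by blast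
  next
    case 4
    let ?p = "\<lambda>x. a * wv u x + b * wv v x"
    have pr: "w x - ?p x = 0" if xy: "adj x' y'" "{x', y'} = {u, v}" and z: "\<exists>i\<in>L \<inter> side x' y'. w i = ?p i" and x: "x \<in> L \<inter> side x' y'" for x x' y'
    proof -
      obtain i where i: "i \<in> L \<inter> side x' y'" "w i = ?p i" using z by blast
      show ?thesis
      proof (rule zero_propagate[of w ?p "\<lambda>x. w x - ?p x" x' y' i x, OF no _ _ xy(1)])
        show "w x - ?p x \<ge> 0" if "x \<in> L" for x using f that by (simp add: feasible_def)
        show "\<exists>W. good ?p s t W" if "s \<in> N" "s \<in> side x' y'" "adj s t" "x' \<in> side s t" for s t
          using good_edge[OF uv that(1,3) 4] that(4) xy(2) by (auto simp: doubleton_eq_iff)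
        show "i \<in> L \<inter> side x' y'" "w i - ?p i = 0" "x \<in> L \<inter> side x' y'" using i x by auto
      qed simp_all
    qed
    have z1: "\<exists>i\<in>L \<inter> side u v. w i = ?p i" using maximal_zero[OF m] 4 by blast
    have z2: "\<exists>i\<in>L \<inter> side v u. w i = ?p i" using maximal_zero[OF maximal_sym[OF m]] 4 by (simp add: add.commute)
    have "w x = ?p x" if x: "x \<in> L" for x
    proof (cases "x \<in> side u v")
      case True then show ?thesis using pr[OF uv _ z1, of x] x by simp
    next
      case False
      then have "x \<in> side v u" using side_opposite[OF uv, of x] x leaves_V by blast
      then show ?thesis using pr[OF adj_sym[OF uv] _ z2, of x] x by (simp add: insert_commute)
    qed
    then show ?thesis using uv ab by blast
  qed
qed

subsection \<open>The splice fan\<close>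

lemma norm1_pos: "u \<in> V \<Longrightarrow> norm1 L (wv u) > 0"
proof -
  assume u: "u \<in> V"
  obtain x where x: "x \<in> L" "wv u x > 0" using ex_wv_pos[OF u] by blast
  show ?thesis unfolding norm1_def by (rule sum_pos2[OF finite_leaves x(1)]) (use x in auto)
qed

text \<open>Frees the cones from the normalization by \<open>rho\<close>: the norms of the weight
  vectors are positive and go into the coefficients.\<close>

lemma in_fan_iff:
  "w \<in> splice_fan V adj d \<longleftrightarrow> (\<exists>u v a b. adj u v \<and> a \<ge> 0 \<and> b \<ge> 0 \<and> w = (\<lambda>x. a * wv u x + b * wv v x))"
proof
  assume "w \<in> splice_fan V adj d"
  then obtain t s u v where h: "t \<ge> 0" "0 \<le> s" "s \<le> 1" "adj u v"
    "w = (\<lambda>x. t * ((1 - s) * rho V adj d u x + s * rho V adj d v x))" unfolding splice_fan_def by blast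
  let ?a = "t * (1 - s) / norm1 L (wv u)" and ?b = "t * s / norm1 L (wv v)"
  have "?a \<ge> 0" "?b \<ge> 0" using h norm1_pos adj_V[OF h(4)] by (simp_all add: less_imp_le)
  moreover have "w = (\<lambda>x. ?a * wv u x + ?b * wv v x)" unfolding h(5) rho_def by (simp add: fun_eq_iff algebra_simps)
  ultimately show "\<exists>u v a b. adj u v \<and> a \<ge> 0 \<and> b \<ge> 0 \<and> w = (\<lambda>x. a * wv u x + b * wv v x)" using h(4) by blast
next
  assume "\<exists>u v a b. adj u v \<and> a \<ge> 0 \<and> b \<ge> 0 \<and> w = (\<lambda>x. a * wv u x + b * wv v x)"
  then obtain u v a b where h: "adj u v" "a \<ge> 0" "b \<ge> 0" "w = (\<lambda>x. a * wv u x + b * wv v x)" by blast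
  define A where "A = a * norm1 L (wv u)"
  define B where "B = b * norm1 L (wv v)"
  have n: "norm1 L (wv u) > 0" "norm1 L (wv v) > 0" using norm1_pos adj_V[OF h(1)] by simp_all
  have AB: "A \<ge> 0" "B \<ge> 0" using h n by (simp_all add: A_def B_def)
  \<comment> \<open>For \<open>A = B = 0\<close> division by zero gives \<open>s = 0\<close>, still
    a legitimate parameter.\<close>
  define s where "s = B / (A + B)"
  have s: "0 \<le> s" "s \<le> 1" using AB by (auto simp: s_def divide_le_eq_1)
  have t: "(A + B) * (1 - s) = A" "(A + B) * s = B"
  proof -
    have "(A + B) * s = B"
    proof (cases "A + B = 0")
      case True then show ?thesis using AB by simp
    qed (simp add: s_def)
    then show "(A + B) * s = B" "(A + B) * (1 - s) = A" by (simp_all add: right_diff_distrib)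
  qed
  have "w = (\<lambda>x. (A + B) * ((1 - s) * rho V adj d u x + s * rho V adj d v x))"
  proof
    fix x
    have "(A + B) * ((1 - s) * rho V adj d u x + s * rho V adj d v x) = A * rho V adj d u x + B * rho V adj d v x"
      unfolding distrib_left mult.assoc[symmetric] t ..
    also have "\<dots> = w x" unfolding h(4) rho_def A_def B_def using n by simp
    finally show "w x = (A + B) * ((1 - s) * rho V adj d u x + s * rho V adj d v x)" by simp
  qed
  then show "w \<in> splice_fan V adj d" unfolding splice_fan_def using AB s h(1)
    by (intro CollectI exI[of _ "A + B"] exI[of _ s] exI[of _ u] exI[of _ v]) simp
qed

lemma local_trop_eq_fan: "local_trop L (splice_ideal V adj alpha c g) = splice_fan V adj d"
proof (rule Set.set_eqI)
  fix w
  have trop: "w \<in> local_trop L (splice_ideal V adj alpha c g) \<longleftrightarrow> (\<forall>x\<in>L. w x \<ge> 0) \<and> (\<forall>x. x \<notin> L \<longrightarrow> w x = 0) \<and>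
    \<not> (\<exists>f\<in>ideal_span L gens. \<exists>a. initial_monomial L w f a)"
    unfolding splice_ideal_gens by (rule local_trop_iff[OF finite_leaves conv_gens])
  show "w \<in> local_trop L (splice_ideal V adj alpha c g) \<longleftrightarrow> w \<in> splice_fan V adj d"
  proof
    assume "w \<in> splice_fan V adj d"
    then obtain u v a b where h: "adj u v" "a \<ge> 0" "b \<ge> 0" "w = (\<lambda>x. a * wv u x + b * wv v x)"
      unfolding in_fan_iff by blast
    have "w x \<ge> 0" for x unfolding h(4) using h wv_nonneg by simp
    moreover have "w x = 0" if "x \<notin> L" for x unfolding h(4) by (simp add: wv_off[OF that])
    moreover have "\<not> initial_monomial L w f a'" if "f \<in> ideal_span L gens" for f a'
      by (rule no_initial_monomial[OF h(1-3) _ that]) (simp add: h(4))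
    ultimately show "w \<in> local_trop L (splice_ideal V adj alpha c g)" unfolding trop by blast
  next
    assume "w \<in> local_trop L (splice_ideal V adj alpha c g)"
    then have w0: "\<And>x. x \<in> L \<Longrightarrow> w x \<ge> 0" and off: "\<And>x. x \<notin> L \<Longrightarrow> w x = 0"
      and no: "\<And>f a. f \<in> ideal_span L gens \<Longrightarrow> \<not> initial_monomial L w f a" unfolding trop by blast+
    have "\<exists>u v a b. adj u v \<and> a \<ge> 0 \<and> b \<ge> 0 \<and> (\<forall>x\<in>L. w x = a * wv u x + b * wv v x)"
    proof (cases "\<forall>x\<in>L. w x > 0")
      case True
      then show ?thesis using positive_in_cone[OF no] by blast
    next
      case False
      then obtain i where i: "i \<in> L" "w i = 0" using w0 by (force simp: less_le)
      \<comment> \<open>Next to a zero coordinate at most one coordinate is positive, so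
        \<open>w\<close> is a multiple of one leaf vector; for \<open>w = 0\<close> the leaf
        \<open>i\<close> serves.\<close>
      obtain u where u: "u \<in> L" "\<forall>x\<in>L. x \<noteq> u \<longrightarrow> w x = 0"
      proof (cases "\<exists>u\<in>L. w u > 0")
        case True
        then obtain u where u: "u \<in> L" "w u > 0" by blast
        have "w x = 0" if "x \<in> L" "x \<noteq> u" for x
        proof (rule ccontr)
          assume "w x \<noteq> 0"
          then have "w x > 0" using w0[OF that(1)] by simp
          then show False using zero_coordinate[of w, OF w0 i u that(1) _ that(2)] no by blast
        qed
        then show thesis using that u(1) by blast
      next
        case False
        then have "\<forall>x\<in>L. w x = 0" using w0 by (force simp: less_le)
        then show thesis using that i(1) by blast
      qed
      have "nbrs adj u \<noteq> {}" using leaf_valency[OF u(1)] by (auto simp: valency_def)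
      then obtain v where uv: "adj u v" by (auto simp: nbrs_def)
      have "\<forall>x\<in>L. w x = w u * wv u x + 0 * wv v x" using u by (auto simp: wv_leaf[OF u(1)])
      then show ?thesis using uv w0[OF u(1)] by (intro exI[of _ u] exI[of _ v] exI[of _ "w u"] exI[of _ 0]) simp
    qed
    then obtain u v a b where h: "adj u v" "a \<ge> 0" "b \<ge> 0" "\<forall>x\<in>L. w x = a * wv u x + b * wv v x" by blast
    have "w = (\<lambda>x. a * wv u x + b * wv v x)"
    proof
      fix x show "w x = a * wv u x + b * wv v x"
        using h(4) off[of x] wv_off[of x u] wv_off[of x v] by (cases "x \<in> L") auto
    qed
    then show "w \<in> splice_fan V adj d" unfolding in_fan_iff using h(1-3) by blast
  qed
qed

end

theorem theorem6p2:
  fixes V :: "'v set" and adj :: "'v \<Rightarrow> 'v \<Rightarrow> bool" and d :: "'v \<Rightarrow> 'v \<Rightarrow> nat"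
    and alpha :: "'v \<Rightarrow> 'v \<Rightarrow> 'v \<Rightarrow> nat" and c :: "'v \<Rightarrow> 'v \<Rightarrow> nat \<Rightarrow> complex"
    and g :: "'v \<Rightarrow> nat \<Rightarrow> 'v series"
  assumes "splice_diagram V adj d"
    and "edge_determinant V adj d"
    and "semigroup_cond V adj d"
    and "splice_type_system V adj d alpha c g"
  shows "local_trop (leaves V adj) (splice_ideal V adj alpha c g) = splice_fan V adj d"
proof -
  interpret splice_system V adj d alpha c g
    using assms by unfold_locales
  show ?thesis by (rule local_trop_eq_fan)
qed

end
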